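(* Let $\mu$ be a probability measure on $\mathbf R$. Let ord1 $=\{A_0=\emptyset',A_1,\ldots,A_n\}$ and ord2 $=\{A_0=\emptyset',A'_1,\ldots,A'_n\}$ be two consistent orderings of the same finite sub-semilattice $\mathcal A'$ with $A_i=A'_{\pi(i)}$, where $\pi$ is a permutation of $\{1,\ldots,n\}$ with $\pi(1)=1$. Let $f$, $g$ be simple flows connecting the sets of $\mathcal A'$ in the sense of ord1, respectively ord2, with $f(t_i)=\cup_{j=1}^iA_j$, $g(u_i)=\cup_{j=1}^iA'_j$, and let $\mathcal Q^f$, $\mathcal Q^g$ be one-dimensional transition systems along $f$ and $g$ with semigroups $(T^f_{st})$, $(T^g_{st})$ and generators $(\mathcal G^f_s)$, $(\mathcal G^g_s)$ on a common dense subspace $\mathcal D$ of $B(\mathbf R)$. Put $\mu^f_{t_1}(\Gamma)=\int_{\mathbf R}Q^f_{0t_1}(x;\Gamma)\mu(dx)$ and suppose that $Q^f_{0t_1}=Q^g_{0u_1}$. The following statements are equivalent. (a) For all $\Gamma_0,\ldots,\Gamma_n\in\mathcal B(\mathbf R)$, $$\int_{\mathbf R^{n+1}}I_{\Gamma_0}(x_0)I_{\Gamma_1}(x_1)\prod_{i=2}^nI_{\Gamma_i}(x_i-x_{i-1})\,Q^f_{t_{n-1}t_n}(x_{n-1};dx_n)\cdots Q^f_{t_1t_2}(x_1;dx_2)\,Q^f_{0t_1}(x_0;dx_1)\,\mu(dx_0)$$ $$=\int_{\mathbf R^{n+1}}I_{\Gamma_0}(y_0)I_{\Gamma_1}(y_1)\prod_{i=2}^nI_{\Gamma_i}(y_{\pi(i)}-y_{\pi(i)-1})\,Q^g_{u_{n-1}u_n}(y_{n-1};dy_n)\cdots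 Q^g_{u_1u_2}(y_1;dy_2)\,Q^g_{0u_1}(y_0;dy_1)\,\mu(dy_0).$$ (b) For each $i=2,\ldots,n$, if $l_1\le l_2\le\cdots\le l_{2(i-1)}$ denotes the increasing ordering of the values $\pi(2)-1,\pi(2),\ldots,\pi(i)-1,\pi(i)$, $p$ the index with $\pi(i)-1=l_{p-1}$, $\pi(i)=l_p$, and $l_0=1$, then for all $h_2,\ldots,h_i\in\mathcal D$ and for $\mu^f_{t_1}$-almost all $x_1$: (b1) if $p=2(i-1)$, $$\int_{t_{i-1}}^{t_i}T^g_{u_1u_{l_1}}T^g_{u_{l_1}u_{l_2}}\cdots T^g_{u_{l_{p-3}}u_{l_{p-2}}}\Big[\prod_{j=2}^{i-1}h_j(y_{\pi(j)}-y_{\pi(j)-1})\,(\mathcal G^f_wT^f_{wt_i}h_i)\Big(x_1+\sum_{j=2}^{i-1}(y_{\pi(j)}-y_{\pi(j)-1})\Big)\Big](x_1)\,dw$$ $$=\int_{u_{l_{p-1}}}^{u_{l_p}}T^g_{u_1u_{l_1}}\cdots T^g_{u_{l_{p-2}}u_{l_{p-1}}}\,\mathcal G^g_v\,T^g_{vu_{l_p}}\Big[\prod_{j=2}^{i-1}h_j(y_{\pi(j)}-y_{\pi(j)-1})\,h_i\Big(x_1+\sum_{j=2}^{i}(y_{\pi(j)}-y_{\pi(j)-1})\Big)\Big](x_1)\,dv;$$ (b2) if $p<2(i-1)$, $$\int_{t_{i-1}}^{t_i}T^g_{u_1u_{l_1}}\cdots T^g_{u_{l_{p-3}}u_{l_{p-2}}}T^g_{u_{l_{p-2}}u_{l_{p+1}}}T^g_{u_{l_{p+1}}u_{l_{p+2}}}\cdots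 T^g_{u_{l_{2(i-1)-1}}u_{l_{2(i-1)}}}\Big[\prod_{j=2}^{i-1}h_j(y_{\pi(j)}-y_{\pi(j)-1})\,(\mathcal G^f_wT^f_{wt_i}h_i)\Big(x_1+\sum_{j=2}^{i-1}(y_{\pi(j)}-y_{\pi(j)-1})\Big)\Big](x_1)\,dw$$ $$=\int_{u_{l_{p-1}}}^{u_{l_p}}T^g_{u_1u_{l_1}}\cdots T^g_{u_{l_{p-2}}u_{l_{p-1}}}\,\mathcal G^g_v\,T^g_{vu_{l_p}}T^g_{u_{l_p}u_{l_{p+1}}}\cdots T^g_{u_{l_{2(i-1)-1}}u_{l_{2(i-1)}}}\Big\{\prod_{j=2}^{i-1}h_j(y_{\pi(j)}-y_{\pi(j)-1})\Big[h_i\Big(x_1+\sum_{j=2}^{i}(y_{\pi(j)}-y_{\pi(j)-1})\Big)-h_i\Big(x_1+\sum_{j=2}^{i-1}(y_{\pi(j)}-y_{\pi(j)-1})\Big)\Big]\Big\}(x_1)\,dv .$$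
   Context: Framework. $T$ is a compact Hausdorff space and $\mathcal A$ is a collection of closed connected subsets of $T$ with $\emptyset,T\in\mathcal A$, closed under arbitrary intersections, containing no two disjoint non-empty sets, and separable from above: there are finite subcollections $\mathcal A_n\subseteq\mathcal A_{n+1}\subseteq\mathcal A$ closed under intersections and maps $g_n$ sending each $A\in\mathcal A$ to a finite union of sets of $\mathcal A_n$ with $A=\cap_n g_n(A)$, $g_{n+1}(A)\subseteq g_n(A)$, $A\subseteq g_n(A)^0$ (interior), $g_n(\emptyset)=\emptyset$, $g_n(\cap_\alpha A_\alpha)=\cap_\alpha g_n(A_\alpha)$ for arbitrary families, and $\cup_{i=1}^kA_i=\cup_{j=1}^mA'_j\Rightarrow\cup_{i=1}^kg_n(A_i)=\cup_{j=1}^mg_n(A'_j)$. Put $\emptyset'=\cap_{A\in\mathcal A\setminus\{\emptyset\}}A$ (a non-empty set). $\mathcal A(u)$ is the class of finite unions of sets of $\mathcal A$. A finite sub-semilattice is a non-empty finite collection $\mathcal A'\subseteq\mathcal A$ of non-empty sets closed under intersections. A consistent ordering of $\mathcal A'$ is a list $\{A_0=\emptyset',A_1,\ldots,A_n\}$ where $A_1,\ldots,A_n$ enumerates the distinct sets of $\mathcal A'$, $A_1=\cap_{A\in\mathcal A'}A$ (possibly $A_1=A_0$), and every $A\in\mathcal A'$ with $A\subsetneq A_{i+1}$ is one of $A_1,\ldots,A_i$. Flows. A flow is an increasing map $f:[0,a]\to\mathcal A(u)$ (or on any compact interval). It is continuous if $f(t)=\cap_nf(t_n)$ for $t_n\downarrow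 t$ and $f(t)=\overline{\cup_nf(t_n)}$ for $t_n\uparrow t$. It is simple if it is continuous and there are $0=t_0<\cdots<t_n=a$ and flows $f_{i+1}:[t_i,t_{i+1}]\to\mathcal A$ with $f(0)=\emptyset'$ and $f(t)=\cup_{j=1}^if_j(t_j)\cup f_{i+1}(t)$ for $t\in[t_i,t_{i+1}]$. A simple flow connects the sets of $\mathcal A'$ in the sense of the consistent ordering $\{A_0=\emptyset',\ldots,A_n\}$ if the $f_{i+1}$ can be taken continuous with $f_{i+1}(t_{i+1})=A_{i+1}$, $f_1(0)=\emptyset'$ and $f_{i+1}(t_i)\subseteq\cup_{j=0}^iA_j$, so that $f(t_i)=\cup_{j=0}^iA_j$; $0=t_0<t_1<\cdots<t_n$ (resp. $0=u_0<u_1<\cdots<u_n$ for $g$) are the partition times. A one-dimensional transition system $\mathcal Q^f=(Q^f_{st})_{s\le t}$ along a flow $f$ on $[0,a_f]$ consists of transition probabilities on $\mathbf R$, $0\le s\le t\le a_f$, with $Q^f_{ss}(x;\cdot)=\delta_x$ satisfying the Chapman–Kolmogorov equations. $B(\mathbf R)$ is the Banach space of bounded measurable functions $\mathbf R\to\mathbf R$ with the supremum norm, and $\mathcal B(\mathbf R)$ the Borel $\sigma$-field. The semigroup is $(T^f_{st}h)(x)=\int_{\mathbf R}h(y)Q^f_{st}(x;dy)$. Standing assumption: $T^f_{st}(\mathcal D)\subseteq\mathcal D$, for each $h\in\mathcal D$ the function $T^f_{st}h$ is strongly continuously differentiable with respect to $s$ and to $t$, and $-(\frac{\partial^-}{\partial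 r}T^f_{rs}h)|_{r=s}=(\frac{\partial^+}{\partial t}T^f_{st}h)|_{t=s}$ for all $s$; this common value is $\mathcal G^f_sh$, and $\mathcal G^f_s$, with domain $\mathcal D$, is the generator at time $s$ (same for $g$). Operator notation. If $T_k$ is the operator of the transition probability $Q_k(x_k;dx_{k+1})$, $k=1,\ldots,n-1$, and $h:\mathbf R^n\to\mathbf R$ is bounded measurable, then $T_1T_2\cdots T_{n-1}[h(x_1,\ldots,x_n)](x_1)=\int_{\mathbf R^{n-1}}h(x_1,\ldots,x_n)Q_{n-1}(x_{n-1};dx_n)\cdots Q_1(x_1;dx_2)$. If $\mathcal G$ is a linear operator with domain $\mathcal D(\mathcal G)$, then $T_1\cdots T_{k-1}\mathcal GT_k\cdots T_{n-1}[h(x_1,\ldots,x_n)](x_1)=\int_{\mathbf R^{k-1}}(\mathcal G\,\phi_{x_1,\ldots,x_k})(x_k)\,Q_{k-1}(x_{k-1};dx_k)\cdots Q_1(x_1;dx_2)$, where $\phi_{x_1,\ldots,x_k}(\cdot)=\int_{\mathbf R^{n-k}}h(x_1,\ldots,x_n)Q_{n-1}(x_{n-1};dx_n)\cdots Q_{k+1}(x_{k+1};dx_{k+2})Q_k(\cdot;dx_{k+1})$ is required to lie in $\mathcal D(\mathcal G)$. In the formulas of the claim the integration variable attached to time $u_l$ is $y_l$ (so $y_1=x_1$, and equal indices $l_k=l_{k+1}$ give the same variable, the corresponding operator being the identity). It is assumed throughout that all functions to which the operators $\mathcal G$ are applied in (b), for all $v$ in the closed interval of integration, lie in $\mathcal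 D$. An empty string of operators means evaluation at $x_1$. *)

theory Defs
  imports "HOL-Probability.Probability" "HOL-Combinatorics.Permutations"
begin

(* The empty union is allowed, so {} always belongs to finite_unions C. *)
definition finite_unions :: "'s set set \<Rightarrow> 's set set" where
  "finite_unions \<C> = {\<Union>\<F> | \<F>. finite \<F> \<and> \<F> \<subseteq> \<C>}"

definition inter_closed :: "'s set set \<Rightarrow> bool" where
  "inter_closed \<C> \<longleftrightarrow> (\<forall>A\<in>\<C>. \<forall>B\<in>\<C>. A \<inter> B \<in> \<C>)"

definition separable_from_above :: "'s::topological_space set set \<Rightarrow> bool" where
  "separable_from_above \<A> \<longleftrightarrow>
    (\<exists>(\<A>n :: nat \<Rightarrow> 's set set) (gn :: nat \<Rightarrow> 's set \<Rightarrow> 's set).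
      (\<forall>n. finite (\<A>n n) \<and> \<A>n n \<subseteq> \<A>n (Suc n) \<and> \<A>n n \<subseteq> \<A> \<and> inter_closed (\<A>n n)) \<and>
      (\<forall>n. \<forall>A\<in>\<A>. gn n A \<in> finite_unions (\<A>n n)) \<and>
      (\<forall>A\<in>\<A>. A = (\<Inter>n. gn n A)) \<and>
      (\<forall>n. \<forall>A\<in>\<A>. gn (Suc n) A \<subseteq> gn n A) \<and>
      (\<forall>n. \<forall>A\<in>\<A>. A \<subseteq> interior (gn n A)) \<and>
      (\<forall>n. gn n {} = {}) \<and>
      (\<forall>n. \<forall>\<C>. \<C> \<subseteq> \<A> \<and> \<C> \<noteq> {} \<longrightarrow> gn n (\<Inter>\<C>) = (\<Inter>A\<in>\<C>. gn n A)) \<and>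
      (\<forall>n. \<forall>\<C> \<C>'. finite \<C> \<and> \<C> \<subseteq> \<A> \<and> \<C> \<noteq> {} \<and> finite \<C>' \<and> \<C>' \<subseteq> \<A> \<and> \<C>' \<noteq> {} \<and> \<Union>\<C> = \<Union>\<C>' \<longrightarrow>
        (\<Union>A\<in>\<C>. gn n A) = (\<Union>A\<in>\<C>'. gn n A)))"

(* The space T is the whole type; Hausdorff by its class t2_space. *)
definition indexing_collection :: "'s::t2_space set set \<Rightarrow> bool" where
  "indexing_collection \<A> \<longleftrightarrow>
    compact (UNIV :: 's set) \<and>
    (\<forall>A\<in>\<A>. closed A \<and> connected A) \<and>
    {} \<in> \<A> \<and> UNIV \<in> \<A> \<and>
    (\<forall>\<C>. \<C> \<subseteq> \<A> \<and> \<C> \<noteq> {} \<longrightarrow> \<Inter>\<C> \<in> \<A>) \<and>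
    (\<forall>A\<in>\<A>. \<forall>B\<in>\<A>. A \<noteq> {} \<and> B \<noteq> {} \<longrightarrow> A \<inter> B \<noteq> {}) \<and>
    separable_from_above \<A>"

definition empty_prime :: "'s set set \<Rightarrow> 's set" where
  "empty_prime \<A> = \<Inter>(\<A> - {{}})"

definition finite_sub_semilattice :: "'s set set \<Rightarrow> 's set set \<Rightarrow> bool" where
  "finite_sub_semilattice \<A> \<A>' \<longleftrightarrow>
    \<A>' \<noteq> {} \<and> finite \<A>' \<and> \<A>' \<subseteq> \<A> \<and> {} \<notin> \<A>' \<and> inter_closed \<A>'"

definition consistent_ordering ::
  "'s set set \<Rightarrow> 's set set \<Rightarrow> nat \<Rightarrow> (nat \<Rightarrow> 's set) \<Rightarrow> bool" where
  "consistent_ordering \<A> \<A>' n A \<longleftrightarrow>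
    A 0 = empty_prime \<A> \<and> bij_betw A {1..n} \<A>' \<and> A 1 = \<Inter>\<A>' \<and>
    (\<forall>i<n. \<forall>B\<in>\<A>'. B \<subset> A (i + 1) \<longrightarrow> B \<in> A ` {1..i})"

definition flow :: "'s set set \<Rightarrow> real \<Rightarrow> real \<Rightarrow> (real \<Rightarrow> 's set) \<Rightarrow> bool" where
  "flow \<C> a b f \<longleftrightarrow> f ` {a..b} \<subseteq> \<C> \<and> mono_on {a..b} f"

definition continuous_flow ::
  "'s::topological_space set set \<Rightarrow> real \<Rightarrow> real \<Rightarrow> (real \<Rightarrow> 's set) \<Rightarrow> bool" where
  "continuous_flow \<C> a b f \<longleftrightarrow> flow \<C> a b f \<and>
    (\<forall>t\<in>{a..b}. \<forall>r. range r \<subseteq> {a..b} \<and> r \<longlonglongrightarrow> t \<longrightarrow>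
      (decseq r \<longrightarrow> f t = (\<Inter>n. f (r n))) \<and>
      (incseq r \<longrightarrow> f t = closure (\<Union>n. f (r n))))"

definition flow_decomposition ::
  "'s::topological_space set set \<Rightarrow> (real \<Rightarrow> 's set) \<Rightarrow> nat \<Rightarrow> (nat \<Rightarrow> real)
    \<Rightarrow> (nat \<Rightarrow> real \<Rightarrow> 's set) \<Rightarrow> bool" where
  "flow_decomposition \<A> f m t F \<longleftrightarrow>
    m \<ge> 1 \<and> t 0 = 0 \<and> (\<forall>i<m. t i < t (i + 1)) \<and>
    (\<forall>i<m. flow \<A> (t i) (t (i + 1)) (F (i + 1))) \<and>
    f 0 = empty_prime \<A> \<and>
    (\<forall>i<m. \<forall>s\<in>{t i..t (i + 1)}. f s = (\<Union>j\<in>{1..i}. F j (t j)) \<union> F (i + 1) s)"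

definition simple_flow ::
  "'s::topological_space set set \<Rightarrow> real \<Rightarrow> (real \<Rightarrow> 's set) \<Rightarrow> bool" where
  "simple_flow \<A> a f \<longleftrightarrow> continuous_flow (finite_unions \<A>) 0 a f \<and>
    (\<exists>m t F. t m = a \<and> flow_decomposition \<A> f m t F)"

definition connects ::
  "'s::topological_space set set \<Rightarrow> nat \<Rightarrow> (nat \<Rightarrow> 's set) \<Rightarrow> (nat \<Rightarrow> real)
    \<Rightarrow> (real \<Rightarrow> 's set) \<Rightarrow> bool" where
  "connects \<A> n A t f \<longleftrightarrow> simple_flow \<A> (t n) f \<and>
    (\<exists>F. flow_decomposition \<A> f n t F \<and>
      (\<forall>i<n. continuous_flow \<A> (t i) (t (i + 1)) (F (i + 1)) \<and>
             F (i + 1) (t (i + 1)) = A (i + 1) \<and>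
             F (i + 1) (t i) \<subseteq> (\<Union>j\<in>{0..i}. A j)) \<and>
      F 1 0 = empty_prime \<A>)"

definition bounded_measurable :: "(real \<Rightarrow> real) set" where
  "bounded_measurable = {h \<in> borel_measurable borel. bounded (range h)}"

(* Supremum-norm convergence is expressed by uniform_limit UNIV throughout. *)

definition dense_subspace :: "(real \<Rightarrow> real) set \<Rightarrow> bool" where
  "dense_subspace D \<longleftrightarrow> D \<subseteq> bounded_measurable \<and>
    (\<lambda>_. 0) \<in> D \<and>
    (\<forall>h\<in>D. \<forall>k\<in>D. (\<lambda>x. h x + k x) \<in> D) \<and>
    (\<forall>c. \<forall>h\<in>D. (\<lambda>x. c * h x) \<in> D) \<and>
    (\<forall>h\<in>bounded_measurable. \<forall>e>0. \<exists>k\<in>D. \<forall>x. \<bar>h x - k x\<bar> < e)"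

definition has_strong_derivative ::
  "(real \<Rightarrow> real \<Rightarrow> real) \<Rightarrow> (real \<Rightarrow> real) \<Rightarrow> real \<Rightarrow> real set \<Rightarrow> bool" where
  "has_strong_derivative H H' s I \<longleftrightarrow> H' \<in> bounded_measurable \<and>
    uniform_limit UNIV (\<lambda>r x. (H r x - H s x) / (r - s)) H' (at s within I)"

definition strongly_C1_on :: "real set \<Rightarrow> (real \<Rightarrow> real \<Rightarrow> real) \<Rightarrow> bool" where
  "strongly_C1_on I H \<longleftrightarrow>
    (\<exists>H'. \<forall>s\<in>I. has_strong_derivative H (H' s) s I \<and>
                 uniform_limit UNIV H' (H' s) (at s within I))"

definition transition_system :: "real \<Rightarrow> (real \<Rightarrow> real \<Rightarrow> real \<Rightarrow> real measure) \<Rightarrow> bool" where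
  "transition_system a Q \<longleftrightarrow>
    (\<forall>s t. 0 \<le> s \<and> s \<le> t \<and> t \<le> a \<longrightarrow> Q s t \<in> borel \<rightarrow>\<^sub>M prob_algebra borel) \<and>
    (\<forall>s x. 0 \<le> s \<and> s \<le> a \<longrightarrow> Q s s x = return borel x) \<and>
    (\<forall>r s t x. 0 \<le> r \<and> r \<le> s \<and> s \<le> t \<and> t \<le> a \<longrightarrow> Q r t x = Q r s x \<bind> Q s t)"

definition semigroup_op ::
  "(real \<Rightarrow> real \<Rightarrow> real \<Rightarrow> real measure) \<Rightarrow> real \<Rightarrow> real \<Rightarrow> (real \<Rightarrow> real) \<Rightarrow> real \<Rightarrow> real" where
  "semigroup_op Q s t h x = (LINT y|Q s t x. h y)"

(* G s is only relevant on D.  At s = 0 (resp. s = a) only the right (resp. left)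
   derivative makes sense, and it alone determines G s h. *)
definition has_generator ::
  "real \<Rightarrow> (real \<Rightarrow> real \<Rightarrow> real \<Rightarrow> real measure) \<Rightarrow> (real \<Rightarrow> real) set
    \<Rightarrow> (real \<Rightarrow> (real \<Rightarrow> real) \<Rightarrow> real \<Rightarrow> real) \<Rightarrow> bool" where
  "has_generator a Q D G \<longleftrightarrow>
    (\<forall>s t. 0 \<le> s \<and> s \<le> t \<and> t \<le> a \<longrightarrow> semigroup_op Q s t ` D \<subseteq> D) \<and>
    (\<forall>h\<in>D. \<forall>t\<in>{0..a}. strongly_C1_on {0..t} (\<lambda>s. semigroup_op Q s t h)) \<and>
    (\<forall>h\<in>D. \<forall>s\<in>{0..a}. strongly_C1_on {s..a} (\<lambda>t. semigroup_op Q s t h)) \<and>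
    (\<forall>h\<in>D. \<forall>s\<in>{0..a}.
      (0 < s \<longrightarrow> has_strong_derivative (\<lambda>r. semigroup_op Q r s h) (\<lambda>x. - G s h x) s {0..<s}) \<and>
      (s < a \<longrightarrow> has_strong_derivative (\<lambda>t. semigroup_op Q s t h) (G s h) s {s<..a}))"

(* iterated Q u k [m1, ..., mr] F y is the string
     T_{u k, u m1} T_{u m1, u m2} ... T_{u m(r-1), u mr} [F],
   where F is a function of a family y of variables, y m being attached to the time u m;
   the starting point is y k.  A repeated index rewrites the variable with its own value,
   because Q s s x is the Dirac measure at x. *)
primrec iterated ::
  "(real \<Rightarrow> real \<Rightarrow> real \<Rightarrow> real measure) \<Rightarrow> (nat \<Rightarrow> real) \<Rightarrow> nat \<Rightarrow> nat list
    \<Rightarrow> ((nat \<Rightarrow> real) \<Rightarrow> real) \<Rightarrow> (nat \<Rightarrow> real) \<Rightarrow> real" where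
  "iterated Q u k [] F y = F y"
| "iterated Q u k (m # ms) F y =
    (LINT z|Q (u k) (u m) (y k). iterated Q u m ms F (y(m := z)))"

(* The function of one variable T_{v, u m} T_{u m, u ms!0} ... [F], the variables
   that precede m being frozen at their values in y. *)
definition generator_arg ::
  "(real \<Rightarrow> real \<Rightarrow> real \<Rightarrow> real measure) \<Rightarrow> (nat \<Rightarrow> real) \<Rightarrow> real \<Rightarrow> nat \<Rightarrow> nat list
    \<Rightarrow> ((nat \<Rightarrow> real) \<Rightarrow> real) \<Rightarrow> (nat \<Rightarrow> real) \<Rightarrow> real \<Rightarrow> real" where
  "generator_arg Q u v m ms F y = (\<lambda>x. LINT z|Q v (u m) x. iterated Q u m ms F (y(m := z)))"

(* T_{u k, u ks!0} ... T_{.., u (last ks)} G_v T_{v, u m} T_{u m, u ms!0} ... [F] *)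
definition iterated_generator ::
  "(real \<Rightarrow> real \<Rightarrow> real \<Rightarrow> real measure) \<Rightarrow> (real \<Rightarrow> (real \<Rightarrow> real) \<Rightarrow> real \<Rightarrow> real)
    \<Rightarrow> (nat \<Rightarrow> real) \<Rightarrow> nat \<Rightarrow> nat list \<Rightarrow> real \<Rightarrow> nat \<Rightarrow> nat list
    \<Rightarrow> ((nat \<Rightarrow> real) \<Rightarrow> real) \<Rightarrow> (nat \<Rightarrow> real) \<Rightarrow> real" where
  "iterated_generator Q G u k ks v m ms F =
    iterated Q u k ks (\<lambda>y. G v (generator_arg Q u v m ms F y) (y (last (k # ks))))"

(* The list [l_0, l_1, ..., l_{2(i-1)}] with l_0 = 1. *)
definition idx :: "(nat \<Rightarrow> nat) \<Rightarrow> nat \<Rightarrow> nat list" where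
  "idx \<pi> i = 1 # sort (concat (map (\<lambda>j. [\<pi> j - 1, \<pi> j]) [2..<i + 1]))"

(* For pi permuting {1..n} with pi 1 = 1 and 2 <= i <= n there is exactly one such p: the
   last position of pi i - 1 in the sorted list. *)
definition pos :: "(nat \<Rightarrow> nat) \<Rightarrow> nat \<Rightarrow> nat" where
  "pos \<pi> i = (THE p. 2 \<le> p \<and> p \<le> 2 * (i - 1) \<and> idx \<pi> i ! (p - 1) = \<pi> i - 1 \<and> idx \<pi> i ! p = \<pi> i)"

(* The list [l_a, ..., l_b], empty for a > b. *)
definition idx_seg :: "(nat \<Rightarrow> nat) \<Rightarrow> nat \<Rightarrow> nat \<Rightarrow> nat \<Rightarrow> nat list" where
  "idx_seg \<pi> i a b = map ((!) (idx \<pi> i)) [a..<b + 1]"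

definition incr_prod ::
  "(nat \<Rightarrow> nat) \<Rightarrow> (nat \<Rightarrow> real \<Rightarrow> real) \<Rightarrow> nat \<Rightarrow> (nat \<Rightarrow> real) \<Rightarrow> real" where
  "incr_prod \<pi> h k y = (\<Prod>j=2..k. h j (y (\<pi> j) - y (\<pi> j - 1)))"

(* Here x_1 is y 1. *)
definition incr_sum :: "(nat \<Rightarrow> nat) \<Rightarrow> nat \<Rightarrow> (nat \<Rightarrow> real) \<Rightarrow> real" where
  "incr_sum \<pi> k y = y 1 + (\<Sum>j=2..k. y (\<pi> j) - y (\<pi> j - 1))"

definition integrand_b1 ::
  "(nat \<Rightarrow> nat) \<Rightarrow> (nat \<Rightarrow> real \<Rightarrow> real) \<Rightarrow> nat \<Rightarrow> (nat \<Rightarrow> real) \<Rightarrow> real" where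
  "integrand_b1 \<pi> h i y = incr_prod \<pi> h (i - 1) y * h i (incr_sum \<pi> i y)"

definition integrand_b2 ::
  "(nat \<Rightarrow> nat) \<Rightarrow> (nat \<Rightarrow> real \<Rightarrow> real) \<Rightarrow> nat \<Rightarrow> (nat \<Rightarrow> real) \<Rightarrow> real" where
  "integrand_b2 \<pi> h i y =
    incr_prod \<pi> h (i - 1) y * (h i (incr_sum \<pi> i y) - h i (incr_sum \<pi> (i - 1) y))"

end

theory Submission
  imports Defs
begin

text \<open>
  Let \<open>X\<close> be the Markov chain with kernels \<open>Qf\<close> at the times \<open>t 0 < \<dots> < t n\<close>, let \<open>Y\<close> be the chain with
  kernels \<open>Qg\<close> at the times \<open>u 0 < \<dots> < u n\<close>, both with initial law \<open>\<mu>\<close>, and write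
  \<open>d i = Y (\<pi> i) - Y (\<pi> i - 1)\<close> for the increments of \<open>Y\<close> in the order of the first flow. Condition (a)
  says that \<open>(X 0, X 1, X 2 - X 1, \<dots>, X n - X (n - 1))\<close> and \<open>(Y 0, Y 1, d 2, \<dots>, d n)\<close> have the same
  law. The law of the first vector is determined by that of \<open>(X 0, X 1)\<close>, which is also the law of
  \<open>(Y 0, Y 1)\<close>, and by the Markov property: given the first \<open>i - 1\<close> steps, \<open>X i\<close> has the distribution
  \<open>Qf (t (i - 1)) (t i) (X (i - 1))\<close>. With \<open>S k = Y 1 + d 2 + \<dots> + d k\<close> in the role of \<open>X k\<close>,
  condition (a) therefore holds if and only if for every \<open>i \<ge> 2\<close> and all \<open>h 2, \<dots>, h i \<in> D\<close>, almost surely,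

  \<open>E[h 2 (d 2) \<dots> h (i - 1) (d (i - 1)) \<cdot> (T h i) (S (i - 1)) | Y 1] =
   E[h 2 (d 2) \<dots> h (i - 1) (d (i - 1)) \<cdot> h i (S i) | Y 1]\<close>,   (*)

  where \<open>T\<close> is the semigroup of the first flow from \<open>t (i - 1)\<close> to \<open>t i\<close>. One direction tests equal laws
  with two different functions; the other is an induction on \<open>i\<close>, in which the density of \<open>D\<close> and a
  \<open>\<pi>\<close>-system argument pass from products of functions in \<open>D\<close> to laws
  (\<open>condition_b_imp_same_law\<close>).

  Condition (b) is (*) in integrated form. Subtract the same expectation with \<open>h i (S (i - 1))\<close> from
  both sides. The backward equation \<open>\<partial>/\<partial>s T s t h = - G s (T s t h)\<close> writes the left difference as
  an integral over \<open>[t (i - 1), t i]\<close> and the right one as an integral over \<open>[u (\<pi> i - 1), u (\<pi> i)]\<close>,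
  because moving the lower time of a kernel up to \<open>u (\<pi> i)\<close> replaces \<open>Y (\<pi> i)\<close> by
  \<open>Y (\<pi> i - 1)\<close> and thus \<open>S i\<close> by \<open>S (i - 1)\<close>. If other variables live at later times, this shift
  would alter their law as well, and for this reason (b2) has the difference \<open>h i (S i) - h i (S (i - 1))\<close>
  inside: the shifted term then vanishes identically (\<open>condition_b_iff\<close>).

  The delicate point is the interchange of this time integral with the integral over paths. The
  generator acts on a function that depends on the path, so it has to be bounded uniformly over an
  infinite family of functions in \<open>D\<close>, while \<open>D\<close> need not be complete and generators are in general
  unbounded. Here they are bounded (\<open>generator_bounded\<close>), because the semigroups are strongly
  continuous on the space of all bounded measurable functions, where the supremum norm sees single
  points: the probability of leaving \<open>x\<close> between \<open>s\<close> and \<open>t\<close> is at most \<open>K (t - s)\<close>, uniformly in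
  \<open>x\<close> (\<open>bounded_rates\<close>). Otherwise there would be points \<open>x k\<close> and short time intervals
  with large exit rates, and a gliding hump argument produces a set that contains infinitely many
  of these points but hardly any of the mass that leaves them (\<open>gliding_hump\<close>).
\<close>

section \<open>Functions of paths\<close>

text \<open>A path carries a value at every natural number; a chain with \<open>n\<close> steps writes only the coordinates
  up to \<open>n\<close>. One measurable space then serves for all strings of operators, whatever indices they use.\<close>

abbreviation paths :: "(nat \<Rightarrow> real) measure" where
  "paths \<equiv> Pi\<^sub>M UNIV (\<lambda>_. borel)"

lemma measurable_const_path: "(\<lambda>x. (\<lambda>_. x)) \<in> borel \<rightarrow>\<^sub>M paths"
  by (intro measurable_PiM_single') auto

lemma measurable_path_upd [measurable (raw)]:
  assumes "f \<in> M \<rightarrow>\<^sub>M paths" "g \<in> borel_measurable M"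
  shows "(\<lambda>x. (f x)(m := g x)) \<in> M \<rightarrow>\<^sub>M paths"
  by (rule measurable_fun_upd[where J = UNIV, OF _ assms(1)]) (simp_all add: assms(2))

text \<open>Irrelevant coordinates are the reason why strings of operators with different index lists can be
  compared, so dependence on a set of coordinates has to be recorded separately.\<close>

definition depends_on :: "((nat \<Rightarrow> real) \<Rightarrow> 'b) \<Rightarrow> nat set \<Rightarrow> bool" where
  "depends_on F C \<longleftrightarrow> (\<forall>y y'. (\<forall>j\<in>C. y j = y' j) \<longrightarrow> F y = F y')"

lemma depends_onD: "depends_on F C \<Longrightarrow> (\<And>j. j \<in> C \<Longrightarrow> y j = y' j) \<Longrightarrow> F y = F y'"
  unfolding depends_on_def by blast

lemma depends_on_mono: "depends_on F C \<Longrightarrow> C \<subseteq> C' \<Longrightarrow> depends_on F C'"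
  unfolding depends_on_def by blast

definition bounded_path :: "((nat \<Rightarrow> real) \<Rightarrow> real) set" where
  "bounded_path = {F \<in> borel_measurable paths. bounded (range F)}"

lemma bounded_pathI:
  "F \<in> borel_measurable paths \<Longrightarrow> (\<And>y. \<bar>F y\<bar> \<le> C) \<Longrightarrow> F \<in> bounded_path"
  unfolding bounded_path_def by (intro CollectI conjI boundedI[where B = C]) auto

lemma bounded_pathE:
  assumes "F \<in> bounded_path"
  obtains C where "C \<ge> 0" "\<And>y. \<bar>F y\<bar> \<le> C"
proof -
  obtain C where C: "\<And>y. \<bar>F y\<bar> \<le> C"
    using assms unfolding bounded_path_def by (auto simp: bounded_iff)
  have "C \<ge> 0" using C[of undefined] by linarith
  with C that show thesis by blast
qed

lemma bounded_path_measurable [measurable_dest]: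
  "F \<in> bounded_path \<Longrightarrow> F \<in> borel_measurable paths"
  unfolding bounded_path_def by simp

lemma bounded_path_diff:
  assumes "F \<in> bounded_path" "G \<in> bounded_path"
  shows "(\<lambda>y. F y - G y) \<in> bounded_path"
proof -
  note [measurable] = assms[THEN bounded_path_measurable]
  obtain C C' where C: "\<And>y. \<bar>F y\<bar> \<le> C" "\<And>y. \<bar>G y\<bar> \<le> C'"
    using assms by (meson bounded_pathE)
  show ?thesis
  proof (rule bounded_pathI[where C = "C + C'"])
    show "\<bar>F y - G y\<bar> \<le> C + C'" for y using C[of y] by linarith
  qed measurable
qed

lemma bounded_path_mult:
  assumes "F \<in> bounded_path" "G \<in> bounded_path"
  shows "(\<lambda>y. F y * G y) \<in> bounded_path"
proof -
  note [measurable] = assms[THEN bounded_path_measurable]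
  obtain C C' where C: "\<And>y. \<bar>F y\<bar> \<le> C" "\<And>y. \<bar>G y\<bar> \<le> C'" "C \<ge> 0"
    using assms by (meson bounded_pathE)
  show ?thesis
  proof (rule bounded_pathI[where C = "C * C'"])
    show "\<bar>F y * G y\<bar> \<le> C * C'" for y using C(1,2)[of y] C(3)
      by (simp add: abs_mult mult_mono)
  qed measurable
qed

lemma bounded_path_const: "(\<lambda>_. c) \<in> bounded_path"
  by (rule bounded_pathI[where C = "\<bar>c\<bar>"]) auto

lemma bounded_path_prod:
  assumes "\<And>j. j \<in> J \<Longrightarrow> F j \<in> bounded_path"
  shows "(\<lambda>y. \<Prod>j\<in>J. F j y) \<in> bounded_path"
  using assms
  by (induction J rule: infinite_finite_induct) (auto intro: bounded_path_mult bounded_path_const)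

lemma bounded_measurable_measurable [measurable_dest]:
  "h \<in> bounded_measurable \<Longrightarrow> h \<in> borel_measurable borel"
  unfolding bounded_measurable_def by simp

lemma bounded_measurableE:
  assumes "h \<in> bounded_measurable"
  obtains C where "C \<ge> 0" "\<And>x. \<bar>h x\<bar> \<le> C"
proof -
  obtain C where C: "\<And>x. \<bar>h x\<bar> \<le> C"
    using assms unfolding bounded_measurable_def by (auto simp: bounded_iff)
  have "C \<ge> 0" using C[of undefined] by linarith
  with C that show thesis by blast
qed

lemma bounded_measurableI:
  "h \<in> borel_measurable borel \<Longrightarrow> (\<And>x. \<bar>h x\<bar> \<le> C) \<Longrightarrow> h \<in> bounded_measurable"
  unfolding bounded_measurable_def by (intro CollectI conjI boundedI[where B = C]) auto

lemma bounded_measurable_indicat: "\<Gamma> \<in> sets borel \<Longrightarrow> indicat_real \<Gamma> \<in> bounded_measurable"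
  by (rule bounded_measurableI[where C = 1]) (auto simp: indicator_def)

lemma bounded_path_comp:
  assumes "h \<in> bounded_measurable" "s \<in> borel_measurable paths"
  shows "(\<lambda>y. h (s y)) \<in> bounded_path"
proof -
  obtain C where "\<And>x. \<bar>h x\<bar> \<le> C" using assms(1) by (meson bounded_measurableE)
  moreover have "(\<lambda>y. h (s y)) \<in> borel_measurable paths"
    using assms by (intro measurable_compose[OF assms(2)]) (rule bounded_measurable_measurable)
  ultimately show ?thesis by (intro bounded_pathI[where C = C]) auto
qed

lemma measurable_path_section [measurable]: "(\<lambda>x. y(m := x)) \<in> borel \<rightarrow>\<^sub>M paths"
  by (rule measurable_path_upd) (auto simp: space_PiM)

lemma bounded_path_section:
  assumes "F \<in> bounded_path"
  shows "(\<lambda>x. F (y(m := x))) \<in> bounded_measurable"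
proof -
  note [measurable] = assms[THEN bounded_path_measurable]
  obtain C where "\<And>y. \<bar>F y\<bar> \<le> C" using assms by (meson bounded_pathE)
  then show ?thesis by (intro bounded_measurableI[where C = C]) (auto simp: space_PiM)
qed

lemma bounded_path_comp_path:
  assumes F: "F \<in> bounded_path" and [measurable]: "X \<in> paths \<rightarrow>\<^sub>M paths"
  shows "(\<lambda>y. F (X y)) \<in> bounded_path"
proof -
  note [measurable] = F[THEN bounded_path_measurable]
  obtain C where "\<And>y. \<bar>F y\<bar> \<le> C" using F by (meson bounded_pathE)
  then show ?thesis by (intro bounded_pathI[where C = C]) auto
qed

section \<open>Laws of paths and strings of operators\<close>

text \<open>The measure behind \<open>iterated\<close>. Turning nested integrals into an integral with respect to one
  probability measure makes linearity, dominated convergence and differentiation under the integral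
  available in a single step.\<close>

primrec path_law ::
  "(real \<Rightarrow> real \<Rightarrow> real \<Rightarrow> real measure) \<Rightarrow> (nat \<Rightarrow> real) \<Rightarrow> nat \<Rightarrow> nat list
    \<Rightarrow> (nat \<Rightarrow> real) \<Rightarrow> (nat \<Rightarrow> real) measure" where
  "path_law Q u k [] y = return paths y"
| "path_law Q u k (m # ms) y = Q (u k) (u m) (y k) \<bind> (\<lambda>z. path_law Q u m ms (y(m := z)))"

lemma iterated_append:
  "iterated Q u k (ks @ ms) F y = iterated Q u k ks (iterated Q u (last (k # ks)) ms F) y"
  by (induction ks arbitrary: k y) auto

lemma iterated_cong_unwritten:
  assumes "\<And>z. (\<And>j. j \<notin> set ms \<Longrightarrow> z j = y j) \<Longrightarrow> F z = F' z"
  shows "iterated Q u k ms F y = iterated Q u k ms F' y"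
  using assms
proof (induction ms arbitrary: k y)
  case (Cons m ms)
  have "iterated Q u m ms F (y(m := z)) = iterated Q u m ms F' (y(m := z))" for z
    by (rule Cons.IH) (use Cons.prems in auto)
  then show ?case by simp
qed simp

lemma iterated_cong_start:
  assumes "depends_on F C" "y k = y' k" "\<And>j. j \<in> C - set ms \<Longrightarrow> y j = y' j"
  shows "iterated Q u k ms F y = iterated Q u k ms F y'"
  using assms
proof (induction ms arbitrary: k y y')
  case Nil
  then show ?case by (auto intro: depends_onD)
next
  case (Cons m ms)
  have "iterated Q u m ms F (y(m := z)) = iterated Q u m ms F (y'(m := z))" for z
    by (rule Cons.IH) (use Cons.prems in auto)
  then show ?case using Cons.prems(2) by simp
qed

text \<open>The part of a transition system that is visible at finitely many times.\<close>

locale transition_chain =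
  fixes Q :: "real \<Rightarrow> real \<Rightarrow> real \<Rightarrow> real measure" and u :: "nat \<Rightarrow> real" and n :: nat
  assumes chain_kernel:
      "\<And>i j. i \<le> j \<Longrightarrow> j \<le> n \<Longrightarrow> Q (u i) (u j) \<in> borel \<rightarrow>\<^sub>M prob_algebra borel"
    and chain_refl: "\<And>i x. i \<le> n \<Longrightarrow> Q (u i) (u i) x = return borel x"
    and chain_kolmogorov:
      "\<And>i j k x. i \<le> j \<Longrightarrow> j \<le> k \<Longrightarrow> k \<le> n \<Longrightarrow> Q (u i) (u k) x = Q (u i) (u j) x \<bind> Q (u j) (u k)"
begin

lemma chain_prob: "i \<le> j \<Longrightarrow> j \<le> n \<Longrightarrow> prob_space (Q (u i) (u j) x)"
  using measurable_space[OF chain_kernel, of i j x] by (auto simp: space_prob_algebra)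

lemma chain_sets [measurable_cong]: "i \<le> j \<Longrightarrow> j \<le> n \<Longrightarrow> sets (Q (u i) (u j) x) = sets borel"
  using measurable_space[OF chain_kernel, of i j x] by (auto simp: space_prob_algebra)

lemma path_law_measurable:
  "sorted (k # ms) \<Longrightarrow> (\<And>m. m \<in> set ms \<Longrightarrow> m \<le> n) \<Longrightarrow>
    path_law Q u k ms \<in> paths \<rightarrow>\<^sub>M prob_algebra paths"
proof (induction ms arbitrary: k)
  case Nil
  have "return paths \<in> paths \<rightarrow>\<^sub>M prob_algebra paths" by (rule measurable_return_prob_space)
  then show ?case by (simp add: path_law.simps[abs_def])
next
  case (Cons m ms)
  have IH [measurable]: "path_law Q u m ms \<in> paths \<rightarrow>\<^sub>M prob_algebra paths"
    using Cons.prems by (intro Cons.IH) auto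
  have [measurable]: "Q (u k) (u m) \<in> borel \<rightarrow>\<^sub>M prob_algebra borel"
    using Cons.prems by (intro chain_kernel) auto
  show ?case unfolding path_law.simps
    by (rule measurable_bind_prob_space2[where N = borel]) measurable
qed

lemma path_law_prob:
  assumes "sorted (k # ms)" "\<And>m. m \<in> set ms \<Longrightarrow> m \<le> n"
  shows "prob_space (path_law Q u k ms y)" "sets (path_law Q u k ms y) = sets paths"
  using measurable_space[OF path_law_measurable[OF assms], of y]
  by (auto simp: space_prob_algebra space_PiM)

lemma iterated_eq_integral:
  assumes "sorted (k # ms)" "\<And>m. m \<in> set ms \<Longrightarrow> m \<le> n" and F: "F \<in> bounded_path"
  shows "iterated Q u k ms F y = (LINT x|path_law Q u k ms y. F x)"
  using assms(1,2)
proof (induction ms arbitrary: k y)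
  case Nil
  show ?case using F by (subst path_law.simps, subst integral_return) (auto simp: space_PiM bounded_path_def)
next
  case (Cons m ms)
  note [measurable] = F[THEN bounded_path_measurable]
  obtain C where C: "\<And>y. \<bar>F y\<bar> \<le> C" using F by (meson bounded_pathE)
  have [measurable]: "path_law Q u m ms \<in> paths \<rightarrow>\<^sub>M prob_algebra paths"
    using Cons.prems by (intro path_law_measurable) auto
  have km: "k \<le> m" "m \<le> n" using Cons.prems by auto
  interpret prob_space "Q (u k) (u m) (y k)" using chain_prob[OF km] .
  have [measurable_cong]: "sets (Q (u k) (u m) (y k)) = sets borel" using chain_sets[OF km] .
  have mass: "emeasure (path_law Q u m ms (y(m := z))) (space (path_law Q u m ms (y(m := z)))) = 1" for z
    using Cons.prems by (intro prob_space.emeasure_space_1 path_law_prob) auto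
  have "iterated Q u m ms F (y(m := z)) = (LINT x|path_law Q u m ms (y(m := z)). F x)" for z
    using Cons.prems by (intro Cons.IH) auto
  then have "iterated Q u k (m # ms) F y
      = (LINT z|Q (u k) (u m) (y k). LINT x|path_law Q u m ms (y(m := z)). F x)" by simp
  also have "\<dots> = (LINT x|path_law Q u k (m # ms) y. F x)"
    unfolding path_law.simps
    by (rule integral_bind[where K = paths and B' = 1 and B = C, symmetric])
       (use C mass in \<open>auto intro!: measurable_prob_algebraD simp: emeasure_space_1\<close>)
  finally show ?case .
qed

lemma iterated_bounded:
  assumes "sorted (k # ms)" "\<And>m. m \<in> set ms \<Longrightarrow> m \<le> n" and F: "F \<in> bounded_path"
  shows "iterated Q u k ms F \<in> bounded_path"
proof -
  obtain C where C: "\<And>y. \<bar>F y\<bar> \<le> C" using F by (meson bounded_pathE)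
  note [measurable] = F[THEN bounded_path_measurable]
  have [measurable]: "path_law Q u k ms \<in> paths \<rightarrow>\<^sub>M prob_algebra paths"
    using assms by (intro path_law_measurable) auto
  have eq: "iterated Q u k ms F y = (LINT x|path_law Q u k ms y. F x)" for y
    using iterated_eq_integral[OF assms] .
  show ?thesis
  proof (rule bounded_pathI[where C = C])
    show "iterated Q u k ms F \<in> borel_measurable paths"
      unfolding eq[abs_def]
      by (rule measurable_compose[OF measurable_prob_algebraD integral_measurable_subprob_algebra]) measurable
    fix y
    interpret prob_space "path_law Q u k ms y" using path_law_prob(1)[OF assms(1,2)] .
    have [measurable_cong]: "sets (path_law Q u k ms y) = sets paths" 
      using path_law_prob[OF assms(1,2)] by blast
    have int: "integrable (path_law Q u k ms y) F"
      by (rule integrable_const_bound[where B = C]) (use C in auto)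
    have "norm (LINT x|path_law Q u k ms y. F x) \<le> (LINT x|path_law Q u k ms y. norm (F x))"
      by (rule integral_norm_bound)
    also have "\<dots> \<le> (LINT x|path_law Q u k ms y. C)"
      by (rule integral_mono) (use C int in auto)
    finally show "\<bar>iterated Q u k ms F y\<bar> \<le> C" unfolding eq by (simp add: prob_space)
  qed
qed

lemma iterated_diff:
  assumes "sorted (k # ms)" "\<And>m. m \<in> set ms \<Longrightarrow> m \<le> n" and F: "F \<in> bounded_path" "G \<in> bounded_path"
  shows "iterated Q u k ms (\<lambda>y. F y - G y) y = iterated Q u k ms F y - iterated Q u k ms G y"
proof -
  obtain C C' where C: "\<And>y. \<bar>F y\<bar> \<le> C" "\<And>y. \<bar>G y\<bar> \<le> C'" using F by (meson bounded_pathE)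
  note [measurable] = F[THEN bounded_path_measurable]
  interpret prob_space "path_law Q u k ms y" using path_law_prob(1)[OF assms(1,2)] .
  have [measurable_cong]: "sets (path_law Q u k ms y) = sets paths" 
    using path_law_prob[OF assms(1,2)] by blast
  have "integrable (path_law Q u k ms y) F" "integrable (path_law Q u k ms y) G"
    by (rule integrable_const_bound[where B = C] integrable_const_bound[where B = C']; use C in simp)+
  then show ?thesis
    using assms by (subst (1 2 3) iterated_eq_integral) (auto intro: bounded_path_diff)
qed

lemma iterated_const:
  assumes "sorted (k # ms)" "\<And>m. m \<in> set ms \<Longrightarrow> m \<le> n" and "\<And>z. (\<And>j. j \<notin> set ms \<Longrightarrow> z j = y j) \<Longrightarrow> F z = c"
  shows "iterated Q u k ms F y = c"
proof -
  have "iterated Q u k ms F y = iterated Q u k ms (\<lambda>_. c) y"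
    by (rule iterated_cong_unwritten) (rule assms(3))
  also have "\<dots> = (LINT x|path_law Q u k ms y. c)"
    by (rule iterated_eq_integral) (use assms bounded_path_const in auto)
  also have "\<dots> = c" using path_law_prob[OF assms(1,2)] by (simp add: prob_space.prob_space)
  finally show ?thesis .
qed

text \<open>Chapman--Kolmogorov: the variables strictly between \<open>k\<close> and \<open>m\<close> can be integrated out when the
  integrand does not see them.\<close>

lemma iterated_jump:
  assumes "k < m" "m \<le> n" and F: "F \<in> bounded_path" and dep: "depends_on F (- {k<..<m})"
  shows "iterated Q u k [k + 1..<n + 1] F y
    = (LINT w|Q (u k) (u m) (y k). iterated Q u m [m + 1..<n + 1] F (y(m := w)))"
  using assms(1) dep
proof (induction k arbitrary: y rule: strict_inc_induct)
  case (base k)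
  have "[k + 1..<n + 1] = m # [m + 1..<n + 1]"
    using base assms by (simp add: upt_conv_Cons del: upt_Suc)
  then show ?case by (simp only: iterated.simps)
next
  case (step k)
  define H where "H = (\<lambda>w. iterated Q u m [m + 1..<n + 1] F (y(m := w)))"
  have km: "k \<le> Suc k" "Suc k \<le> n" "Suc k \<le> m" using step assms by auto
  have H: "H \<in> bounded_measurable"
    unfolding H_def by (intro bounded_path_section iterated_bounded) (use assms in \<open>auto simp del: upt_Suc\<close>)
  obtain C where C: "\<And>x. \<bar>H x\<bar> \<le> C" using H by (meson bounded_measurableE)
  note [measurable] = H[THEN bounded_measurable_measurable]
  interpret prob_space "Q (u k) (u (Suc k)) (y k)" using chain_prob[OF km(1,2)] .
  have [measurable_cong]: "sets (Q (u k) (u (Suc k)) (y k)) = sets borel" using chain_sets[OF km(1,2)] .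
  have [measurable]: "Q (u (Suc k)) (u m) \<in> borel \<rightarrow>\<^sub>M prob_algebra borel"
    using km assms by (intro chain_kernel) auto
  have mass: "emeasure (Q (u (Suc k)) (u m) z) (space (Q (u (Suc k)) (u m) z)) = 1" for z
    using km assms by (intro prob_space.emeasure_space_1 chain_prob) auto
  have "iterated Q u k [k + 1..<n + 1] F y
      = (LINT z|Q (u k) (u (Suc k)) (y k). iterated Q u (Suc k) [Suc k + 1..<n + 1] F (y(Suc k := z)))"
  proof -
    have "[k + 1..<n + 1] = Suc k # [Suc k + 1..<n + 1]"
      using km by (simp add: upt_conv_Cons del: upt_Suc)
    then show ?thesis by (simp only: iterated.simps)
  qed
  also have "\<dots> = (LINT z|Q (u k) (u (Suc k)) (y k). LINT w|Q (u (Suc k)) (u m) z. H w)"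
  proof (rule Bochner_Integration.integral_cong[OF refl])
    fix z
    have "iterated Q u (Suc k) [Suc k + 1..<n + 1] F (y(Suc k := z))
      = (LINT w|Q (u (Suc k)) (u m) z. iterated Q u m [m + 1..<n + 1] F (y(Suc k := z, m := w)))"
      by (subst step.IH) (use step.prems in \<open>auto intro: depends_on_mono\<close>)
    moreover have "iterated Q u m [m + 1..<n + 1] F (y(Suc k := z, m := w)) = H w" for w
      unfolding H_def using step.hyps 
      by (intro iterated_cong_start[OF step.prems]) auto
    ultimately show "iterated Q u (Suc k) [Suc k + 1..<n + 1] F (y(Suc k := z))
      = (LINT w|Q (u (Suc k)) (u m) z. H w)" by simp
  qed
  also have "\<dots> = (LINT w|(Q (u k) (u (Suc k)) (y k) \<bind> Q (u (Suc k)) (u m)). H w)"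
    by (rule integral_bind[where K = borel and B' = 1 and B = C, symmetric])
       (use C mass in \<open>auto intro!: measurable_prob_algebraD simp: emeasure_space_1\<close>)
  also have "Q (u k) (u (Suc k)) (y k) \<bind> Q (u (Suc k)) (u m) = Q (u k) (u m) (y k)"
    using chain_kolmogorov[of k "Suc k" m "y k"] km assms by simp
  finally show ?case unfolding H_def .
qed

text \<open>A string of operators over a sorted list of indices, repetitions allowed, equals the string over all
  later indices: missing indices are supplied by Chapman--Kolmogorov, a repeated index integrates
  against a Dirac measure, and the indices after the last relevant one contribute mass one. Since the
  right side no longer mentions the list, the various strings in condition (b) become comparable.\<close>

lemma iterated_eq_full:
  assumes "sorted (k # ms)" "\<And>m. m \<in> set ms \<Longrightarrow> m \<le> n" "k \<le> n"
    and F: "F \<in> bounded_path" and dep: "depends_on F ({..k} \<union> set ms)"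
  shows "iterated Q u k ms F y = iterated Q u k [k + 1..<n + 1] F y"
  using assms(1-3) dep
proof (induction ms arbitrary: k y)
  case Nil
  have "iterated Q u k [k + 1..<n + 1] F y = F y"
  proof (rule iterated_const)
    fix z assume "\<And>j. j \<notin> set [k + 1..<n + 1] \<Longrightarrow> z j = y j"
    then show "F z = F y" by (intro depends_onD[OF Nil.prems(4)]) auto
  qed (auto simp del: upt_Suc)
  then show ?case by simp
next
  case (Cons m ms)
  have IH: "iterated Q u m ms F y' = iterated Q u m [m + 1..<n + 1] F y'" for y'
    by (rule Cons.IH) (use Cons.prems in \<open>auto intro: depends_on_mono[OF Cons.prems(4)]\<close>)
  show ?case
  proof (cases "k = m")
    case True
    have "(\<lambda>z. iterated Q u m ms F (y(m := z))) \<in> borel_measurable borel"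
      using Cons.prems F by (intro bounded_measurable_measurable bounded_path_section iterated_bounded) auto
    then show ?thesis
      using True IH Cons.prems chain_refl[of m "y m"]
      by (simp add: integral_return)
  next
    case False
    then have km: "k < m" "m \<le> n" using Cons.prems by auto
    have "depends_on F (- {k<..<m})"
      by (rule depends_on_mono[OF Cons.prems(4)]) (use Cons.prems km in auto)
    from iterated_jump[OF km F this] IH show ?thesis by simp
  qed
qed

end

section \<open>The gliding hump argument\<close>

text \<open>If the measures \<open>P k\<close> resembled the Dirac measures at \<open>x k\<close> on every single Borel set, with errors
  that are small compared with the mass \<open>P k\<close> has outside \<open>x k\<close>, then a subsequence could be chosen along
  which the points selected before \<open>x k\<close> and the points selected after it carry little of that mass.
  On the set \<open>A\<close> of all selected points \<open>P k\<close> then misses most of its mass outside \<open>x k\<close>, whereas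
  \<open>x k \<in> A\<close>. The measurability of the arbitrary countable set \<open>A\<close> is what makes the argument work.\<close>

lemma gliding_hump:
  fixes x :: "nat \<Rightarrow> real" and P :: "nat \<Rightarrow> real measure"
  assumes prob: "\<And>k. prob_space (P k)" and sets: "\<And>k. sets (P k) = sets borel"
    and atom: "\<And>k. measure (P k) {x k} < 1"
    and conv: "\<And>A. A \<in> sets borel \<Longrightarrow> eventually (\<lambda>k.
        \<bar>measure (P k) A - indicat_real A (x k)\<bar> \<le> (1 - measure (P k) {x k}) / 6) sequentially"
  shows False
proof -
  define \<alpha> where "\<alpha> k = 1 - measure (P k) {x k}" for k
  have \<alpha>_pos: "\<alpha> k > 0" for k using atom[of k] by (simp add: \<alpha>_def)
  \<comment> \<open>On \<open>{c}\<close> with \<open>c = x k\<close> the error is \<open>\<alpha> k\<close> itself, so no point can recur for ever.\<close>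
  have fin: "finite {k. x k = c}" for c
  proof (rule ccontr)
    assume "infinite {k. x k = c}"
    then have "\<exists>\<^sub>F k in sequentially. x k = c"
      by (simp add: frequently_cofinite cofinite_eq_sequentially[symmetric])
    moreover have "eventually (\<lambda>k. \<bar>measure (P k) {c} - indicat_real {c} (x k)\<bar> \<le> \<alpha> k / 6) sequentially"
      unfolding \<alpha>_def by (rule conv) simp
    ultimately have "\<exists>\<^sub>F k in sequentially. x k = c \<and>
        \<bar>measure (P k) {c} - indicat_real {c} (x k)\<bar> \<le> \<alpha> k / 6"
      by (rule frequently_eventually_frequently)
    then obtain k where "x k = c" "\<bar>measure (P k) {c} - indicat_real {c} (x k)\<bar> \<le> \<alpha> k / 6"
      using frequently_ex by blast
    then show False using \<alpha>_pos[of k] by (auto simp: \<alpha>_def)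
  qed
  have countable_sets: "x ` I \<in> sets borel" for I
    by (meson countable_image countable_subset countableI_type subset_UNIV sets.countable
        borel_closed closed_singleton)
  \<comment> \<open>A tail of the sequence is light for each fixed measure, since no point lies in all tails.\<close>
  have future: "\<exists>N. \<forall>k'\<ge>N. measure (P k) (x ` {k'..}) \<le> \<alpha> k / 6" for k
  proof -
    interpret prob_space "P k" by (rule prob)
    have "(\<Inter>N. x ` {N..}) = {}"
    proof (rule ccontr)
      assume "(\<Inter>N. x ` {N..}) \<noteq> {}"
      then obtain c where "\<And>N. c \<in> x ` {N..}" by blast
      then have "\<forall>N. \<exists>k\<ge>N. x k = c" by (metis imageE atLeast_iff)
      then have "infinite {k. x k = c}" by (auto simp: infinite_nat_iff_unbounded_le)
      with fin show False by blast
    qed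
    moreover have "(\<lambda>N. prob (x ` {N..})) \<longlonglongrightarrow> prob (\<Inter>N. x ` {N..})"
      by (rule finite_Lim_measure_decseq)
         (auto simp: sets countable_sets decseq_def intro!: image_mono)
    ultimately have "(\<lambda>N. prob (x ` {N..})) \<longlonglongrightarrow> 0" by simp
    then have "eventually (\<lambda>N. prob (x ` {N..}) < \<alpha> k / 6) sequentially"
      using \<alpha>_pos[of k] by (intro order_tendstoD) auto
    then show ?thesis unfolding eventually_sequentially by (meson less_imp_le)
  qed
  \<comment> \<open>A finite set of points eventually avoids \<open>x k'\<close>, so that \<open>conv\<close> makes it light for \<open>P k'\<close>.\<close>
  have past: "eventually (\<lambda>k'. measure (P k') (x ` {..k}) \<le> \<alpha> k' / 6) sequentially" for k
  proof -
    have "finite {k'. x k' \<in> x ` {..k}}"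
      using fin by (auto simp: finite_UN[of "{..k}", symmetric] intro: finite_subset[of _ "\<Union>j\<le>k. {k'. x k' = x j}"])
    then have "eventually (\<lambda>k'. x k' \<notin> x ` {..k}) sequentially"
      by (simp add: cofinite_eq_sequentially[symmetric] eventually_cofinite)
    moreover have "eventually (\<lambda>k'. \<bar>measure (P k') (x ` {..k}) - indicat_real (x ` {..k}) (x k')\<bar>
        \<le> \<alpha> k' / 6) sequentially"
      unfolding \<alpha>_def by (rule conv) (rule countable_sets)
    ultimately show ?thesis by eventually_elim (auto simp: indicator_def)
  qed
  \<comment> \<open>One step of the selection: the tail from \<open>k'\<close> on is light for \<open>P k\<close>, and everything up to \<open>k\<close> is light for \<open>P k'\<close>.\<close>
  have "\<exists>k'>k. measure (P k) (x ` {k'..}) \<le> \<alpha> k / 6 \<and> measure (P k') (x ` {..k}) \<le> \<alpha> k' / 6" for k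
  proof -
    obtain N where N: "\<And>k'. k' \<ge> N \<Longrightarrow> measure (P k) (x ` {k'..}) \<le> \<alpha> k / 6" using future by blast
    obtain N' where N': "\<And>k'. k' \<ge> N' \<Longrightarrow> measure (P k') (x ` {..k}) \<le> \<alpha> k' / 6"
      using past unfolding eventually_sequentially by blast
    show ?thesis by (rule exI[of _ "N + N' + Suc k"]) (intro conjI N N', auto)
  qed
  then obtain nx where nx: "\<And>k. nx k > k" "\<And>k. measure (P k) (x ` {nx k..}) \<le> \<alpha> k / 6"
      "\<And>k. measure (P (nx k)) (x ` {..k}) \<le> \<alpha> (nx k) / 6" by metis
  define r where "r j = (nx ^^ j) 0" for j
  have r_Suc: "r (Suc j) = nx (r j)" for j by (simp add: r_def)
  have r_mono: "strict_mono r" by (rule strict_mono_Suc_iff[THEN iffD2]) (simp add: r_Suc nx(1))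
  define A where "A = x ` range r"
  have A: "A \<in> sets borel" unfolding A_def by (rule countable_sets)
  obtain N where N: "\<And>k. k \<ge> N \<Longrightarrow> \<bar>measure (P k) A - indicat_real A (x k)\<bar> \<le> \<alpha> k / 6"
    using conv[OF A] unfolding \<alpha>_def eventually_sequentially by blast
  define k where "k = r (Suc N)"
  interpret prob_space "P k" by (rule prob)
  have k_ge: "k \<ge> N" unfolding k_def using strict_mono_imp_increasing[OF r_mono, of "Suc N"] by simp
  have un: "x ` {..r N} \<union> {x k} \<union> x ` {nx k..} \<in> events"
    unfolding sets by (intro sets.Un countable_sets) simp
  have "A \<subseteq> x ` {..r N} \<union> {x k} \<union> x ` {nx k..}"
  proof
    fix c assume "c \<in> A"
    then obtain j where j: "c = x (r j)" by (auto simp: A_def)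
    consider "j \<le> N" | "j = Suc N" | "Suc (Suc N) \<le> j" by linarith
    then show "c \<in> x ` {..r N} \<union> {x k} \<union> x ` {nx k..}"
    proof cases
      case 1
      then have "r j \<le> r N" using r_mono by (simp add: strict_mono_less_eq)
      then show ?thesis using j by auto
    next
      case 2
      then show ?thesis using j by (simp add: k_def)
    next
      case 3
      then have "nx k \<le> r j" using r_mono unfolding k_def r_Suc[symmetric] by (simp add: strict_mono_less_eq)
      then show ?thesis using j by auto
    qed
  qed
  then have "prob A \<le> prob (x ` {..r N} \<union> {x k} \<union> x ` {nx k..})"
    by (rule finite_measure_mono) (rule un)
  also have "\<dots> \<le> prob (x ` {..r N}) + prob {x k} + prob (x ` {nx k..})"
    by (intro order_trans[OF measure_Un_le] add_mono order_refl measure_Un_le)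
      (simp_all only: sets, (intro sets.Un countable_sets; simp)+, simp)
  also have "\<dots> \<le> \<alpha> k / 6 + (1 - \<alpha> k) + \<alpha> k / 6"
    using nx(2)[of k] nx(3)[of "r N"] by (simp add: k_def r_Suc \<alpha>_def)
  finally have "prob A \<le> 1 - 2 / 3 * \<alpha> k" by simp
  moreover have "x k \<in> A" by (simp add: A_def k_def)
  ultimately show False using N[OF k_ge] \<alpha>_pos[of k] by (simp add: indicator_def)
qed

section \<open>Strong derivatives\<close>

text \<open>Continuity in \<open>s\<close>, uniform in \<open>x\<close>, makes the bound locally uniform in \<open>s\<close>; the interval is compact.\<close>

lemma strongly_C1_bounded_derivative:
  fixes c d :: real
  assumes "c \<le> d" and lim: "\<And>s. s \<in> {c..d} \<Longrightarrow> H' s \<in> bounded_measurable \<and> uniform_limit UNIV H' (H' s) (at s within {c..d})"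
  shows "\<exists>K. \<forall>s\<in>{c..d}. \<forall>x. \<bar>H' s x\<bar> \<le> K"
proof -
  define B where "B a b \<longleftrightarrow> (\<exists>K. \<forall>s\<in>{c..d} \<inter> {a..b}. \<forall>x. \<bar>H' s x\<bar> \<le> K)" for a b
  have "B c d"
    using \<open>c \<le> d\<close>
  proof (induction rule: Bolzano)
    case (trans a b e)
    then obtain K K' where "\<forall>s\<in>{c..d} \<inter> {a..b}. \<forall>x. \<bar>H' s x\<bar> \<le> K" "\<forall>s\<in>{c..d} \<inter> {b..e}. \<forall>x. \<bar>H' s x\<bar> \<le> K'"
      unfolding B_def by blast
    then have "\<bar>H' s x\<bar> \<le> max K K'" if "s \<in> {c..d} \<inter> {a..e}" for s x
      using that by (cases "s \<le> b") (force simp: le_max_iff_disj)+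
    then show ?case unfolding B_def by blast
  next
    case (local s)
    then have s: "s \<in> {c..d}" by simp
    obtain C where C: "\<And>x. \<bar>H' s x\<bar> \<le> C" using lim[OF s] by (meson bounded_measurableE)
    have "eventually (\<lambda>r. \<forall>x\<in>UNIV. dist (H' r x) (H' s x) < 1) (at s within {c..d})"
      using lim[OF s] by (auto simp: uniform_limit_iff)
    then obtain e where e: "e > 0" "\<And>r x. r \<in> {c..d} \<Longrightarrow> r \<noteq> s \<Longrightarrow> dist r s < e \<Longrightarrow> dist (H' r x) (H' s x) < 1"
      unfolding eventually_at by blast
    have bound: "\<bar>H' r x\<bar> \<le> C + 1" if "r \<in> {c..d}" "\<bar>r - s\<bar> < e" for r x
      using e(2)[of r x] C[of x] that by (cases "r = s") (auto simp: dist_real_def)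
    show ?case unfolding B_def
      by (intro exI[of _ e] conjI e allI impI exI[of _ "C + 1"] ballI bound) auto
  qed
  then show ?thesis unfolding B_def by simp
qed

lemma has_strong_derivative_pointwise:
  assumes "has_strong_derivative H H' s I"
  shows "((\<lambda>r. H r x) has_real_derivative H' x) (at s within I)"
proof -
  have "((\<lambda>r. (H r x - H s x) / (r - s)) \<longlongrightarrow> H' x) (at s within I)"
    using assms unfolding has_strong_derivative_def by (auto intro: tendsto_uniform_limitI)
  then show ?thesis by (simp add: has_field_derivative_iff)
qed

lemma strongly_C1_Lipschitz:
  fixes c d :: real
  assumes "c \<le> d" "strongly_C1_on {c..d} H"
  obtains K where "K \<ge> 0" "\<And>r s x. r \<in> {c..d} \<Longrightarrow> s \<in> {c..d} \<Longrightarrow> \<bar>H r x - H s x\<bar> \<le> K * \<bar>r - s\<bar>"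
proof -
  obtain H' where H': "\<And>s. s \<in> {c..d} \<Longrightarrow> has_strong_derivative H (H' s) s {c..d}"
      "\<And>s. s \<in> {c..d} \<Longrightarrow> uniform_limit UNIV H' (H' s) (at s within {c..d})"
    using assms(2) unfolding strongly_C1_on_def by blast
  obtain K where K: "\<And>s x. s \<in> {c..d} \<Longrightarrow> \<bar>H' s x\<bar> \<le> K"
    using strongly_C1_bounded_derivative[OF assms(1), of H'] H' unfolding has_strong_derivative_def by blast
  have "K \<ge> 0" using K[of c undefined] assms(1) by auto
  moreover have "\<bar>H r x - H s x\<bar> \<le> K * \<bar>r - s\<bar>" if "r \<in> {c..d}" "s \<in> {c..d}" for r s x
    using field_differentiable_bound[of "{c..d}" "\<lambda>r. H r x" "\<lambda>s. H' s x" K s r]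
      has_strong_derivative_pointwise[OF H'(1)] K that by (auto simp: abs_minus_commute)
  ultimately show thesis using that by blast
qed

text \<open>Only the mass outside the atom at \<open>x\<close> can move the integral away from \<open>h x\<close>.\<close>

lemma integral_diff_atom:
  fixes M :: "real measure"
  assumes "prob_space M" "sets M = sets borel" "h \<in> bounded_measurable" and C: "\<And>y. \<bar>h y\<bar> \<le> C"
  shows "\<bar>(LINT y|M. h y) - h (x::real)\<bar> \<le> 2 * C * (1 - measure M {x})"
proof -
  interpret prob_space M by fact
  note [measurable_cong] = assms(2)
  note [measurable] = assms(3)[THEN bounded_measurable_measurable]
  have sp: "space M = UNIV" using sets_eq_imp_space_eq[OF assms(2)] by simp
  have int: "integrable M h" by (rule integrable_const_bound[where B = C]) (use C in auto)
  have "(LINT y|M. h y) - h x = (LINT y|M. h y - h x)" using int by (simp add: prob_space)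
  also have "\<bar>\<dots>\<bar> \<le> (LINT y|M. \<bar>h y - h x\<bar>)" using integral_norm_bound[of M "\<lambda>y. h y - h x"] by simp
  also have "\<dots> \<le> (LINT y|M. 2 * C * indicator (- {x}) y)"
  proof (rule integral_mono)
    show "integrable M (\<lambda>y. \<bar>h y - h x\<bar>)" using int by auto
    show "integrable M (\<lambda>y. 2 * C * indicator (- {x}) y :: real)"
      by (rule integrable_const_bound[where B = "\<bar>2 * C\<bar>"]) (auto simp: indicator_def)
    show "\<bar>h y - h x\<bar> \<le> 2 * C * indicator (- {x}) y" for y
      using C[of y] C[of x] by (auto simp: indicator_def)
  qed
  also have "\<dots> = 2 * C * measure M (- {x})" by (simp add: sp)
  also have "measure M (- {x}) = 1 - measure M {x}"
    using prob_compl[of "{x}"] by (simp add: sp Compl_eq_Diff_UNIV assms(2))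
  finally show ?thesis .
qed

section \<open>Semigroups of transition systems\<close>

locale transition_semigroup =
  fixes a :: real and Q :: "real \<Rightarrow> real \<Rightarrow> real \<Rightarrow> real measure"
    and D :: "(real \<Rightarrow> real) set" and G :: "real \<Rightarrow> (real \<Rightarrow> real) \<Rightarrow> real \<Rightarrow> real"
  assumes system: "transition_system a Q"
    and dense: "dense_subspace D"
    and generator: "has_generator a Q D G"
begin

abbreviation T :: "real \<Rightarrow> real \<Rightarrow> (real \<Rightarrow> real) \<Rightarrow> real \<Rightarrow> real" where
  "T \<equiv> semigroup_op Q"

lemma kernel: "0 \<le> s \<Longrightarrow> s \<le> t \<Longrightarrow> t \<le> a \<Longrightarrow> Q s t \<in> borel \<rightarrow>\<^sub>M prob_algebra borel"
  using system unfolding transition_system_def by blast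

lemma kernel_prob: "0 \<le> s \<Longrightarrow> s \<le> t \<Longrightarrow> t \<le> a \<Longrightarrow> prob_space (Q s t x)"
  using measurable_space[OF kernel, of s t x] by (auto simp: space_prob_algebra)

lemma kernel_sets: "0 \<le> s \<Longrightarrow> s \<le> t \<Longrightarrow> t \<le> a \<Longrightarrow> sets (Q s t x) = sets borel"
  using measurable_space[OF kernel, of s t x] by (auto simp: space_prob_algebra)

lemma D_bounded_measurable: "h \<in> D \<Longrightarrow> h \<in> bounded_measurable"
  using dense unfolding dense_subspace_def by blast

lemma D_approx:
  assumes "h \<in> bounded_measurable" "e > 0"
  obtains k where "k \<in> D" "\<And>x. \<bar>h x - k x\<bar> < e"
  using dense assms unfolding dense_subspace_def by meson

lemma semigroup_D: "0 \<le> s \<Longrightarrow> s \<le> t \<Longrightarrow> t \<le> a \<Longrightarrow> h \<in> D \<Longrightarrow> T s t h \<in> D"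
  using generator unfolding has_generator_def by blast

lemma semigroup_bound:
  assumes "0 \<le> s" "s \<le> t" "t \<le> a" "h \<in> bounded_measurable" and C: "\<And>y. \<bar>h y\<bar> \<le> C"
  shows "\<bar>T s t h x\<bar> \<le> C"
proof -
  interpret prob_space "Q s t x" by (rule kernel_prob) fact+
  note [measurable_cong] = kernel_sets[OF assms(1-3), of x]
  note [measurable] = assms(4)[THEN bounded_measurable_measurable]
  have int: "integrable (Q s t x) h" by (rule integrable_const_bound[where B = C]) (use C in auto)
  have "\<bar>T s t h x\<bar> \<le> (LINT y|Q s t x. \<bar>h y\<bar>)"
    unfolding semigroup_op_def using integral_norm_bound[of "Q s t x" h] by simp
  also have "\<dots> \<le> (LINT y|Q s t x. C)" by (rule integral_mono) (use C int in auto)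
  finally show ?thesis by (simp add: prob_space)
qed

lemma semigroup_bounded_measurable:
  assumes "0 \<le> s" "s \<le> t" "t \<le> a" "h \<in> bounded_measurable"
  shows "T s t h \<in> bounded_measurable"
proof -
  obtain C where C: "\<And>x. \<bar>h x\<bar> \<le> C" using assms by (meson bounded_measurableE)
  note [measurable] = assms(4)[THEN bounded_measurable_measurable] kernel[OF assms(1-3)]
  have "(\<lambda>x. LINT y|Q s t x. h y) \<in> borel_measurable borel"
    by (rule measurable_compose[OF measurable_prob_algebraD integral_measurable_subprob_algebra]) measurable
  then show ?thesis
    using semigroup_bound[OF assms C] by (intro bounded_measurableI[where C = C]) (simp_all add: semigroup_op_def[abs_def])
qed

lemma semigroup_comp:
  assumes "0 \<le> r" "r \<le> s" "s \<le> t" "t \<le> a" "h \<in> bounded_measurable"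
  shows "T r t h x = T r s (T s t h) x"
proof -
  obtain C where C: "\<And>x. \<bar>h x\<bar> \<le> C" using assms by (meson bounded_measurableE)
  note [measurable] = assms(5)[THEN bounded_measurable_measurable]
  have [measurable]: "Q s t \<in> borel \<rightarrow>\<^sub>M prob_algebra borel" by (rule kernel) (use assms in auto)
  have rs: "r \<le> s" "s \<le> a" using assms by auto
  interpret prob_space "Q r s x" by (rule kernel_prob) (use assms in auto)
  have [measurable_cong]: "sets (Q r s x) = sets borel" by (rule kernel_sets) (use assms in auto)
  have mass: "emeasure (Q s t z) (space (Q s t z)) = 1" for z
    using assms by (intro prob_space.emeasure_space_1 kernel_prob) auto
  have "Q r t x = Q r s x \<bind> Q s t" using system assms unfolding transition_system_def by blast
  then have "T r t h x = (LINT y|(Q r s x \<bind> Q s t). h y)" by (simp add: semigroup_op_def)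
  also have "\<dots> = (LINT z|Q r s x. LINT y|Q s t z. h y)"
    by (rule integral_bind[where K = borel and B' = 1 and B = C])
       (use C mass in \<open>auto intro!: measurable_prob_algebraD simp: emeasure_space_1\<close>)
  finally show ?thesis by (simp add: semigroup_op_def)
qed

lemma semigroup_refl:
  assumes "0 \<le> s" "s \<le> a" "h \<in> bounded_measurable"
  shows "T s s h x = h x"
proof -
  have "Q s s x = return borel x" using system assms unfolding transition_system_def by blast
  then show ?thesis
    using assms(3)[THEN bounded_measurable_measurable] by (simp add: semigroup_op_def integral_return)
qed

lemma semigroup_diff:
  assumes "0 \<le> s" "s \<le> t" "t \<le> a" "h \<in> bounded_measurable" "k \<in> bounded_measurable"
  shows "T s t (\<lambda>y. h y - k y) x = T s t h x - T s t k x"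
proof -
  obtain C C' where C: "\<And>x. \<bar>h x\<bar> \<le> C" "\<And>x. \<bar>k x\<bar> \<le> C'" using assms by (meson bounded_measurableE)
  interpret prob_space "Q s t x" by (rule kernel_prob) fact+
  note [measurable_cong] = kernel_sets[OF assms(1-3), of x]
  note [measurable] = assms(4,5)[THEN bounded_measurable_measurable]
  have "integrable (Q s t x) h" "integrable (Q s t x) k"
    by (rule integrable_const_bound[where B = C] integrable_const_bound[where B = C']; use C in simp)+
  then show ?thesis by (simp add: semigroup_op_def)
qed

section \<open>Bounded jump rates\<close>

definition exit_prob :: "real \<Rightarrow> real \<Rightarrow> real \<Rightarrow> real" where
  "exit_prob s t x = 1 - measure (Q s t x) {x}"

lemma semigroup_indicator:
  assumes "0 \<le> s" "s \<le> t" "t \<le> a" "A \<in> sets borel"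
  shows "T s t (indicat_real A) x = measure (Q s t x) A"
  using kernel_sets[OF assms(1-3), of x] sets_eq_imp_space_eq[OF kernel_sets[OF assms(1-3), of x]]
  unfolding semigroup_op_def by simp

lemma semigroup_diff_exit:
  assumes "0 \<le> s" "s \<le> t" "t \<le> a" "h \<in> bounded_measurable" "\<And>y. \<bar>h y\<bar> \<le> C"
  shows "\<bar>T s t h x - h x\<bar> \<le> 2 * C * exit_prob s t x"
  unfolding semigroup_op_def exit_prob_def
  using assms by (intro integral_diff_atom kernel_prob kernel_sets) auto

text \<open>Both inequalities follow from conditioning at time \<open>s\<close>: staying at \<open>x\<close> on both parts is one way to
  be at \<open>x\<close> at time \<open>t\<close>, and to be at \<open>x\<close> at time \<open>t\<close> one must leave \<open>x\<close> during the first part or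
  be at \<open>x\<close> at both ends of the second.\<close>

lemma exit_prob_chain:
  assumes "0 \<le> r" "r \<le> s" "s \<le> t" "t \<le> a"
  shows "exit_prob r t x \<le> exit_prob r s x + exit_prob s t x"
    and "exit_prob s t x \<le> exit_prob r t x + exit_prob r s x"
proof -
  define g where "g = T s t (indicat_real {x})"
  have st: "0 \<le> s" "s \<le> t" "t \<le> a" "s \<le> a" using assms by auto
  have g: "g \<in> bounded_measurable"
    unfolding g_def by (intro semigroup_bounded_measurable bounded_measurable_indicat st) simp
  note [measurable] = g[THEN bounded_measurable_measurable]
  have g_eq: "g z = measure (Q s t z) {x}" for z
    unfolding g_def by (rule semigroup_indicator) (use st in auto)
  have g01: "0 \<le> g z" "g z \<le> 1" for z
    using prob_space.prob_le_1[OF kernel_prob[OF st(1-3)]] by (auto simp: g_eq)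
  interpret prob_space "Q r s x" by (rule kernel_prob) (use assms in auto)
  have sets_rs [measurable_cong]: "sets (Q r s x) = sets borel" by (rule kernel_sets) (use assms in auto)
  have sp: "space (Q r s x) = UNIV" using sets_eq_imp_space_eq[OF sets_rs] by simp
  have int_g: "integrable (Q r s x) g"
    by (rule integrable_const_bound[where B = 1]) (use g01 in auto)
  have int_i: "integrable (Q r s x) (\<lambda>z. c * indicat_real A z)" if "A \<in> sets borel" for c A
    using that by (intro integrable_const_bound[where B = "\<bar>c\<bar>"]) (auto simp: indicator_def)
  have m: "measure (Q r t x) {x} = (LINT z|Q r s x. g z)"
    using semigroup_comp[OF assms bounded_measurable_indicat[of "{x}"], of x]
      semigroup_indicator[of r t "{x}" x] assms
    by (simp add: g_def[symmetric]) (simp add: semigroup_op_def)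
  have "(LINT z|Q r s x. g x * indicat_real {x} z) \<le> (LINT z|Q r s x. g z)"
    using g01 by (intro integral_mono int_g int_i) (auto simp: indicator_def)
  then have "g x * measure (Q r s x) {x} \<le> measure (Q r t x) {x}" by (simp add: m sp)
  moreover have "0 \<le> (1 - g x) * (1 - measure (Q r s x) {x})" using g01(2)[of x] by simp
  ultimately show "exit_prob r t x \<le> exit_prob r s x + exit_prob s t x"
    by (simp add: exit_prob_def g_eq[symmetric] algebra_simps)
  have "(LINT z|Q r s x. g z) \<le> (LINT z|Q r s x. g x + 1 * indicat_real (- {x}) z)"
    using g01 by (intro integral_mono int_g Bochner_Integration.integrable_add int_i)
      (auto simp: indicator_def intro: add_increasing2 order_trans[OF g01(2)] g01)
  also have "\<dots> = g x + measure (Q r s x) (- {x})"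
    using int_i[of "- {x}" 1] prob_space by (simp add: sp)
  also have "measure (Q r s x) (- {x}) = exit_prob r s x"
    using prob_compl[of "{x}"] by (simp add: sp Compl_eq_Diff_UNIV sets_rs exit_prob_def)
  finally show "exit_prob s t x \<le> exit_prob r t x + exit_prob r s x"
    by (simp add: exit_prob_def g_eq[symmetric] m)
qed

lemma semigroup_Lipschitz_start:
  assumes "h \<in> D" "0 \<le> t" "t \<le> a"
  obtains K where "K \<ge> 0" "\<And>r s x. 0 \<le> r \<Longrightarrow> r \<le> t \<Longrightarrow> 0 \<le> s \<Longrightarrow> s \<le> t \<Longrightarrow> \<bar>T r t h x - T s t h x\<bar> \<le> K * \<bar>r - s\<bar>"
proof -
  have "strongly_C1_on {0..t} (\<lambda>s. T s t h)"
    using generator assms unfolding has_generator_def by auto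
  from strongly_C1_Lipschitz[OF assms(2) this] that show thesis by (metis atLeastAtMost_iff)
qed

lemma semigroup_Lipschitz_end:
  assumes "h \<in> D" "0 \<le> s" "s \<le> a"
  obtains K where "K \<ge> 0" "\<And>r t x. s \<le> r \<Longrightarrow> r \<le> a \<Longrightarrow> s \<le> t \<Longrightarrow> t \<le> a \<Longrightarrow> \<bar>T s r h x - T s t h x\<bar> \<le> K * \<bar>r - t\<bar>"
proof -
  have "strongly_C1_on {s..a} (\<lambda>t. T s t h)"
    using generator assms unfolding has_generator_def by auto
  from strongly_C1_Lipschitz[OF assms(3) this] that show thesis by (metis atLeastAtMost_iff)
qed

text \<open>Strong convergence to the identity, known on \<open>D\<close> and hence by density for indicators, improves by the
  gliding hump argument to convergence of the exit probabilities uniformly in the starting point.\<close>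

lemma exit_prob_vanishes:
  fixes s t x :: "nat \<Rightarrow> real"
  assumes st: "\<And>k. 0 \<le> s k" "\<And>k. s k \<le> t k" "\<And>k. t k \<le> a"
    and lim: "\<And>h. h \<in> D \<Longrightarrow> \<exists>K. \<forall>k x. \<bar>T (s k) (t k) h x - h x\<bar> \<le> K / real (Suc k)"
    and "\<delta> > 0" and exit: "\<And>k. exit_prob (s k) (t k) (x k) > \<delta>"
  shows False
proof (rule gliding_hump[where P = "\<lambda>k. Q (s k) (t k) (x k)" and x = x])
  show "prob_space (Q (s k) (t k) (x k))" "sets (Q (s k) (t k) (x k)) = sets borel" for k
    by (intro kernel_prob kernel_sets st)+
  show "measure (Q (s k) (t k) (x k)) {x k} < 1" for k
    using exit[of k] \<open>\<delta> > 0\<close> by (simp add: exit_prob_def)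
  fix A :: "real set" assume A: "A \<in> sets borel"
  obtain h where h: "h \<in> D" "\<And>x. \<bar>indicat_real A x - h x\<bar> < \<delta> / 24"
    using D_approx[OF bounded_measurable_indicat[OF A], of "\<delta> / 24"] \<open>\<delta> > 0\<close> by auto
  obtain K where K: "\<And>k x. \<bar>T (s k) (t k) h x - h x\<bar> \<le> K / real (Suc k)" using lim[OF h(1)] by blast
  have "(\<lambda>k. K / real (Suc k)) \<longlonglongrightarrow> 0" by (rule LIMSEQ_Suc[OF lim_const_over_n])
  then have "eventually (\<lambda>k. K / real (Suc k) < \<delta> / 12) sequentially"
    using \<open>\<delta> > 0\<close> by (intro order_tendstoD) auto
  then show "eventually (\<lambda>k. \<bar>measure (Q (s k) (t k) (x k)) A - indicat_real A (x k)\<bar>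
      \<le> (1 - measure (Q (s k) (t k) (x k)) {x k}) / 6) sequentially"
  proof eventually_elim
    case (elim k)
    have "\<bar>T (s k) (t k) (\<lambda>y. indicat_real A y - h y) (x k)\<bar> \<le> \<delta> / 24"
    proof (rule semigroup_bound[OF st])
      show le: "\<bar>indicat_real A y - h y\<bar> \<le> \<delta> / 24" for y using h(2)[of y] by simp
      show "(\<lambda>y. indicat_real A y - h y) \<in> bounded_measurable"
        by (rule bounded_measurableI[OF _ le])
           (use A D_bounded_measurable[OF h(1)] in \<open>auto intro!: borel_measurable_diff simp: bounded_measurable_measurable\<close>)
    qed
    moreover have "T (s k) (t k) (\<lambda>y. indicat_real A y - h y) (x k)
        = measure (Q (s k) (t k) (x k)) A - T (s k) (t k) h (x k)"
      using st A D_bounded_measurable[OF h(1)]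
      by (subst semigroup_diff) (auto simp: semigroup_indicator bounded_measurable_indicat)
    moreover have "\<bar>T (s k) (t k) h (x k) - h (x k)\<bar> < \<delta> / 12" using K elim by (rule le_less_trans)
    ultimately show ?case
      using h(2)[of "x k"] exit[of k] unfolding exit_prob_def by argo
  qed
qed

lemma exit_prob_small_left:
  assumes "0 \<le> v" "v \<le> a" "\<delta> > 0"
  shows "\<exists>\<eta>>0. \<forall>s x. 0 \<le> s \<and> v - \<eta> < s \<and> s \<le> v \<longrightarrow> exit_prob s v x \<le> \<delta>"
proof (rule ccontr)
  assume neg: "\<not> ?thesis"
  have "\<exists>s x. 0 \<le> s \<and> v - 1 / real (Suc k) < s \<and> s \<le> v \<and> exit_prob s v x > \<delta>" for k
    using neg by (metis not_le of_nat_0_less_iff zero_less_Suc zero_less_divide_1_iff)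
  then obtain s x where sx: "\<And>k. 0 \<le> s k" "\<And>k. v - 1 / real (Suc k) < s k" "\<And>k. s k \<le> v"
      "\<And>k. exit_prob (s k) v (x k) > \<delta>" by metis
  show False
  proof (rule exit_prob_vanishes[where s = s and t = "\<lambda>_. v" and x = x])
    fix h assume h: "h \<in> D"
    obtain K where K: "K \<ge> 0"
      "\<And>r s x. 0 \<le> r \<Longrightarrow> r \<le> v \<Longrightarrow> 0 \<le> s \<Longrightarrow> s \<le> v \<Longrightarrow> \<bar>T r v h x - T s v h x\<bar> \<le> K * \<bar>r - s\<bar>"
      using semigroup_Lipschitz_start[OF h assms(1,2)] by blast
    have "\<bar>T (s k) v h x - h x\<bar> \<le> K / real (Suc k)" for k x
    proof -
      have "\<bar>T (s k) v h x - h x\<bar> \<le> K * \<bar>s k - v\<bar>"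
        using K(2)[of "s k" v x] sx assms semigroup_refl[OF assms(1,2) D_bounded_measurable[OF h]] by simp
      also have "\<dots> \<le> K * (1 / real (Suc k))"
        using sx(2,3)[of k] by (intro mult_left_mono K) linarith
      finally show ?thesis by simp
    qed
    then show "\<exists>K. \<forall>k x. \<bar>T (s k) v h x - h x\<bar> \<le> K / real (Suc k)" by blast
  qed (use sx assms in auto)
qed

lemma exit_prob_small_right:
  assumes "0 \<le> v" "v \<le> a" "\<delta> > 0"
  shows "\<exists>\<eta>>0. \<forall>t x. v \<le> t \<and> t < v + \<eta> \<and> t \<le> a \<longrightarrow> exit_prob v t x \<le> \<delta>"
proof (rule ccontr)
  assume neg: "\<not> ?thesis"
  have "\<exists>t x. v \<le> t \<and> t < v + 1 / real (Suc k) \<and> t \<le> a \<and> exit_prob v t x > \<delta>" for k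
    using neg by (metis not_le of_nat_0_less_iff zero_less_Suc zero_less_divide_1_iff)
  then obtain t x where tx: "\<And>k. v \<le> t k" "\<And>k. t k < v + 1 / real (Suc k)" "\<And>k. t k \<le> a"
      "\<And>k. exit_prob v (t k) (x k) > \<delta>" by metis
  show False
  proof (rule exit_prob_vanishes[where s = "\<lambda>_. v" and t = t and x = x])
    fix h assume h: "h \<in> D"
    obtain K where K: "K \<ge> 0"
      "\<And>r t x. v \<le> r \<Longrightarrow> r \<le> a \<Longrightarrow> v \<le> t \<Longrightarrow> t \<le> a \<Longrightarrow> \<bar>T v r h x - T v t h x\<bar> \<le> K * \<bar>r - t\<bar>"
      using semigroup_Lipschitz_end[OF h assms(1,2)] by blast
    have "\<bar>T v (t k) h x - h x\<bar> \<le> K / real (Suc k)" for k x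
    proof -
      have "\<bar>T v (t k) h x - h x\<bar> \<le> K * \<bar>t k - v\<bar>"
        using K(2)[of "t k" v x] tx assms semigroup_refl[OF assms(1,2) D_bounded_measurable[OF h]] by simp
      also have "\<dots> \<le> K * (1 / real (Suc k))"
        using tx(1,2)[of k] by (intro mult_left_mono K) linarith
      finally show ?thesis by simp
    qed
    then show "\<exists>K. \<forall>k x. \<bar>T v (t k) h x - h x\<bar> \<le> K / real (Suc k)" by blast
  qed (use tx assms in auto)
qed

text \<open>The parameter \<open>c\<close> may be negative and \<open>d\<close> may exceed \<open>a\<close>, so that the property can be used on
  arbitrary small intervals around a point of \<open>[0, a]\<close>.\<close>

definition rate_bounded :: "real \<Rightarrow> real \<Rightarrow> bool" where
  "rate_bounded c d \<longleftrightarrow>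
    (\<exists>K. \<forall>s t x. 0 \<le> s \<and> c \<le> s \<and> s \<le> t \<and> t \<le> d \<and> t \<le> a \<longrightarrow> exit_prob s t x \<le> K * (t - s))"

text \<open>For a test function \<open>h \<in> D\<close> the map \<open>s \<mapsto> T s m h\<close> is Lipschitz, so the difference
  \<open>T s m h - T t m h\<close> is of order \<open>t - s\<close>. If some exit probabilities from \<open>s\<close> to \<open>t\<close> were not of this order,
  this difference would be negligible compared with them. As \<open>T t m\<close> is close to the identity near
  \<open>m\<close>, the kernels from \<open>s\<close> to \<open>t\<close> would then be too close to Dirac measures on every Borel set for the
  gliding hump argument. The numerical constants are chosen to give \<open>1/12 + 1/48 + 1/48 \<le> 1/6\<close>.\<close>

lemma rate_bounded_near:
  assumes "0 \<le> m" "m \<le> a"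
    and near: "\<And>t x. 0 \<le> t \<Longrightarrow> c \<le> t \<Longrightarrow> t \<le> m \<Longrightarrow> exit_prob t m x \<le> 1 / 48"
  shows "rate_bounded c m"
proof (rule ccontr)
  assume neg: "\<not> rate_bounded c m"
  have "\<exists>s t x. 0 \<le> s \<and> c \<le> s \<and> s \<le> t \<and> t \<le> m \<and> t \<le> a \<and> exit_prob s t x > real k * (t - s)" for k
    using neg unfolding rate_bounded_def by (metis not_le)
  then obtain s t x where st: "\<And>k. 0 \<le> s k" "\<And>k. c \<le> s k" "\<And>k. s k \<le> t k" "\<And>k. t k \<le> m" "\<And>k. t k \<le> a"
      and rate: "\<And>k. exit_prob (s k) (t k) (x k) > real k * (t k - s k)" by metis
  have pos: "exit_prob (s k) (t k) (x k) > 0" for k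
    using rate[of k] st(3)[of k] by (smt (verit) mult_nonneg_nonneg of_nat_0_le_iff)
  have t0: "0 \<le> t k" "s k \<le> m" for k using st[of k] by auto
  show False
  proof (rule gliding_hump[where P = "\<lambda>k. Q (s k) (t k) (x k)" and x = x])
    show "prob_space (Q (s k) (t k) (x k))" "sets (Q (s k) (t k) (x k)) = sets borel" for k
      by (intro kernel_prob kernel_sets st)+
    show "measure (Q (s k) (t k) (x k)) {x k} < 1" for k
      using pos[of k] by (simp add: exit_prob_def)
    fix A :: "real set" assume A: "A \<in> sets borel"
    note iA = bounded_measurable_indicat[OF A]
    obtain h where h: "h \<in> D" "\<And>x. \<bar>indicat_real A x - h x\<bar> < 1 / 96"
      using D_approx[OF iA, of "1 / 96"] by auto
    note hB = D_bounded_measurable[OF h(1)]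
    define d where "d = (\<lambda>y. indicat_real A y - h y)"
    have dB: "d \<in> bounded_measurable" and d_le: "\<And>y. \<bar>d y\<bar> \<le> 1 / 96"
    proof -
      show le: "\<bar>d y\<bar> \<le> 1 / 96" for y using h(2)[of y] by (simp add: d_def)
      show "d \<in> bounded_measurable"
        by (rule bounded_measurableI[OF _ le])
           (use A hB in \<open>auto intro!: borel_measurable_diff simp: d_def bounded_measurable_measurable\<close>)
    qed
    obtain K where K: "K \<ge> 0"
      "\<And>r s x. 0 \<le> r \<Longrightarrow> r \<le> m \<Longrightarrow> 0 \<le> s \<Longrightarrow> s \<le> m \<Longrightarrow> \<bar>T r m h x - T s m h x\<bar> \<le> K * \<bar>r - s\<bar>"
      using semigroup_Lipschitz_start[OF h(1) assms(1,2)] by blast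
    have "eventually (\<lambda>k. 48 * K \<le> real k) sequentially"
      using filterlim_real_sequentially by (simp add: filterlim_at_top)
    then show "eventually (\<lambda>k. \<bar>measure (Q (s k) (t k) (x k)) A - indicat_real A (x k)\<bar>
        \<le> (1 - measure (Q (s k) (t k) (x k)) {x k}) / 6) sequentially"
    proof eventually_elim
      case (elim k)
      define \<alpha> where "\<alpha> = exit_prob (s k) (t k) (x k)"
      note stk = st(1,3,5)[of k] and tmk = t0(1)[of k] st(4)[of k] assms(2)
      define g where "g = T (t k) m (indicat_real A)"
      have gB: "g \<in> bounded_measurable"
        unfolding g_def by (rule semigroup_bounded_measurable[OF tmk iA])
      define f where "f = (\<lambda>y. indicat_real A y - g y)"
      have f_le: "\<bar>f y\<bar> \<le> 1 / 24" for y
      proof -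
        have "\<bar>g y - indicat_real A y\<bar> \<le> 2 * 1 * exit_prob (t k) m y"
          unfolding g_def by (rule semigroup_diff_exit[OF tmk iA]) (auto simp: indicator_def)
        also have "\<dots> \<le> 1 / 24" using near[of "t k" y] st[of k] by linarith
        finally show ?thesis by (simp add: f_def abs_minus_commute)
      qed
      have fB: "f \<in> bounded_measurable"
        by (rule bounded_measurableI[OF _ f_le])
           (use A gB in \<open>auto intro!: borel_measurable_diff simp: f_def bounded_measurable_measurable\<close>)
      have 1: "\<bar>T (s k) (t k) f (x k) - f (x k)\<bar> \<le> \<alpha> / 12"
        using semigroup_diff_exit[OF stk fB f_le, of "x k"] by (simp add: \<alpha>_def)
      \<comment> \<open>\<open>f\<close> measures how far \<open>T (t k) m\<close> is from the identity, and \<open>d\<close> below how far \<open>A\<close> is from the test function.\<close>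
      have 2: "T (s k) (t k) f (x k) = measure (Q (s k) (t k) (x k)) A - T (s k) m (indicat_real A) (x k)"
        unfolding f_def using semigroup_diff[OF stk iA gB] semigroup_indicator[OF stk A]
          semigroup_comp[OF stk(1,2) tmk(2,3) iA] by (simp add: g_def)
      have 3: "\<bar>T (s k) m d (x k) - T (t k) m d (x k)\<bar> \<le> \<alpha> / 48"
      proof -
        have "\<bar>T (s k) (t k) (T (t k) m d) (x k) - T (t k) m d (x k)\<bar> \<le> 2 * (1 / 96) * exit_prob (s k) (t k) (x k)"
          by (rule semigroup_diff_exit[OF stk])
             (use semigroup_bounded_measurable[OF tmk dB] semigroup_bound[OF tmk dB d_le] in auto)
        then show ?thesis using semigroup_comp[OF stk(1,2) tmk(2,3) dB] by (simp add: \<alpha>_def)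
      qed
      have 4: "T r m d (x k) = T r m (indicat_real A) (x k) - T r m h (x k)" if "0 \<le> r" "r \<le> m" for r
        unfolding d_def using semigroup_diff[OF that assms(2) iA hB] .
      have 5: "\<bar>T (s k) m h (x k) - T (t k) m h (x k)\<bar> \<le> \<alpha> / 48"
      proof -
        have "\<bar>T (s k) m h (x k) - T (t k) m h (x k)\<bar> \<le> K * (t k - s k)"
          using K(2)[of "s k" "t k" "x k"] st[of k] t0[of k] by simp
        also have "\<dots> \<le> (real k / 48) * (t k - s k)"
          using elim st(3)[of k] by (intro mult_right_mono) auto
        also have "\<dots> \<le> \<alpha> / 48" using rate[of k] by (simp add: \<alpha>_def)
        finally show ?thesis .
      qed
      have "f (x k) = indicat_real A (x k) - T (t k) m (indicat_real A) (x k)" by (simp add: f_def g_def)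
      then show ?case
        using 1 2 3 4[of "s k"] 4[of "t k"] 5 st[of k] t0[of k] pos[of k]
        unfolding \<alpha>_def exit_prob_def by linarith
    qed
  qed
qed

lemma rate_bounded_trans:
  assumes "rate_bounded b c" "rate_bounded c d"
  shows "rate_bounded b d"
proof -
  obtain K where K: "\<And>s t x. 0 \<le> s \<Longrightarrow> b \<le> s \<Longrightarrow> s \<le> t \<Longrightarrow> t \<le> c \<Longrightarrow> t \<le> a \<Longrightarrow> exit_prob s t x \<le> K * (t - s)"
    using assms(1) unfolding rate_bounded_def by blast
  obtain K' where K': "\<And>s t x. 0 \<le> s \<Longrightarrow> c \<le> s \<Longrightarrow> s \<le> t \<Longrightarrow> t \<le> d \<Longrightarrow> t \<le> a \<Longrightarrow> exit_prob s t x \<le> K' * (t - s)"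
    using assms(2) unfolding rate_bounded_def by blast
  have mono: "K * (t - s) \<le> max K K' * (t - s)" "K' * (t - s) \<le> max K K' * (t - s)" if "s \<le> t" for s t :: real
    using that by (auto intro!: mult_right_mono)
  have "exit_prob s t x \<le> max K K' * (t - s)"
    if st: "0 \<le> s" "b \<le> s" "s \<le> t" "t \<le> d" "t \<le> a" for s t x
  proof -
    consider "t \<le> c" | "c \<le> s" | "s \<le> c" "c \<le> t" by linarith
    then show ?thesis
    proof cases
      case 1
      then show ?thesis using K[of s t x] mono(1)[of s t] st by linarith
    next
      case 2
      then show ?thesis using K'[of s t x] mono(2)[of s t] st by linarith
    next
      case 3
      have "exit_prob s t x \<le> exit_prob s c x + exit_prob c t x"
        by (rule exit_prob_chain) (use st 3 in auto)
      also have "\<dots> \<le> max K K' * (c - s) + max K K' * (t - c)"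
        using K[of s c x] mono(1)[of s c] K'[of c t x] mono(2)[of c t] st 3 by linarith
      finally show ?thesis by (simp add: algebra_simps)
    qed
  qed
  then show ?thesis unfolding rate_bounded_def by blast
qed

lemma rate_bounded_mono: "rate_bounded b d \<Longrightarrow> b \<le> b' \<Longrightarrow> d' \<le> d \<Longrightarrow> rate_bounded b' d'"
  unfolding rate_bounded_def by (meson order_trans)

text \<open>The local bounds extend to the whole interval by compactness, as exit probabilities are
  subadditive along consecutive time intervals.\<close>

lemma bounded_rates:
  assumes "0 \<le> a"
  obtains K where "K \<ge> 0" "\<And>s t x. 0 \<le> s \<Longrightarrow> s \<le> t \<Longrightarrow> t \<le> a \<Longrightarrow> exit_prob s t x \<le> K * (t - s)"
proof -
  have "rate_bounded 0 a"
  proof (rule Bolzano[where P = rate_bounded])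
    show "rate_bounded b d" if "rate_bounded b c" "rate_bounded c d" for b c d
      using that by (rule rate_bounded_trans)
  next
    fix v assume local: "0 \<le> v" "v \<le> a"
    obtain \<eta>1 where \<eta>1: "\<eta>1 > 0" "\<And>s x. 0 \<le> s \<Longrightarrow> v - \<eta>1 < s \<Longrightarrow> s \<le> v \<Longrightarrow> exit_prob s v x \<le> 1 / 48"
      using exit_prob_small_left[of v "1 / 48"] local by auto
    obtain \<eta>2 where \<eta>2: "\<eta>2 > 0" "\<And>t x. v \<le> t \<Longrightarrow> t < v + \<eta>2 \<Longrightarrow> t \<le> a \<Longrightarrow> exit_prob v t x \<le> 1 / 96"
      using exit_prob_small_right[of v "1 / 96"] local by auto
    \<comment> \<open>To the right of \<open>v\<close> the reference time \<open>m\<close> must not lie before \<open>t\<close>; the bound \<open>1/48 = 1/96 + 1/96\<close> comes from comparing both times with \<open>v\<close>.\<close>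
    define m where "m = min (v + \<eta>2 / 2) a"
    have left: "rate_bounded (v - \<eta>1 / 2) v"
      using local \<eta>1 by (intro rate_bounded_near) auto
    have "exit_prob t m x \<le> 1 / 48" if "v \<le> t" "t \<le> m" for t x
    proof -
      have "exit_prob t m x \<le> exit_prob v m x + exit_prob v t x"
        by (rule exit_prob_chain) (use that local in \<open>auto simp: m_def\<close>)
      moreover have "m < v + \<eta>2" "m \<le> a" using \<eta>2(1) by (auto simp: m_def min_def)
      ultimately show ?thesis
        using \<eta>2(2)[of m x] \<eta>2(2)[of t x] that by linarith
    qed
    then have right: "rate_bounded v m"
      using local \<eta>2(1) by (intro rate_bounded_near) (auto simp: m_def)
    then have right: "rate_bounded v (v + \<eta>2 / 2)"
      unfolding rate_bounded_def m_def by auto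
    have "rate_bounded (v - \<eta>1 / 2) (v + \<eta>2 / 2)" by (rule rate_bounded_trans[OF left right])
    then show "\<exists>e>0. \<forall>c d. c \<le> v \<and> v \<le> d \<and> d - c < e \<longrightarrow> rate_bounded c d"
      using \<eta>1(1) \<eta>2(1)
      by (intro exI[of _ "min (\<eta>1 / 2) (\<eta>2 / 2)"]) (auto intro: rate_bounded_mono)
  qed fact
  then obtain K where K: "\<And>s t x. 0 \<le> s \<Longrightarrow> s \<le> t \<Longrightarrow> t \<le> a \<Longrightarrow> exit_prob s t x \<le> K * (t - s)"
    unfolding rate_bounded_def by blast
  show thesis
  proof
    show "max K 0 \<ge> 0" by simp
    show "exit_prob s t x \<le> max K 0 * (t - s)" if "0 \<le> s" "s \<le> t" "t \<le> a" for s t x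
      using K[OF that, of x] mult_right_mono[of K "max K 0" "t - s"] that by linarith
  qed
qed

section \<open>The backward equation\<close>

text \<open>\<open>T r t h = T r s (T s t h)\<close> for \<open>r < s\<close>, so the generator at time \<open>s\<close>, applied to \<open>T s t h \<in> D\<close>, is
  a left derivative of \<open>r \<mapsto> T r t h\<close> at \<open>s\<close>. At \<open>s = 0\<close> there is no left derivative, whence the strict
  inequality here and below.\<close>

lemma generator_left_derivative:
  assumes "0 < s" "s \<le> t" "t \<le> a" "h \<in> D"
  shows "G s (T s t h) \<in> bounded_measurable"
    and "((\<lambda>r. (T r t h x - T s t h x) / (r - s)) \<longlongrightarrow> - G s (T s t h) x) (at s within {0..<s})"
proof -
  define k where "k = T s t h"
  have k: "k \<in> D" unfolding k_def by (rule semigroup_D) (use assms in auto)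
  have "has_strong_derivative (\<lambda>r. T r s k) (\<lambda>x. - G s k x) s {0..<s}"
    using generator k assms unfolding has_generator_def by auto
  then have G: "(\<lambda>x. - G s k x) \<in> bounded_measurable"
    and lim: "((\<lambda>r. (T r s k x - T s s k x) / (r - s)) \<longlongrightarrow> - G s k x) (at s within {0..<s})"
    unfolding has_strong_derivative_def by (auto intro: tendsto_uniform_limitI)
  obtain C where C: "\<And>x. \<bar>- G s k x\<bar> \<le> C" using G by (meson bounded_measurableE)
  have "(\<lambda>x. - (- G s k x)) \<in> borel_measurable borel"
    using G by (intro borel_measurable_uminus bounded_measurable_measurable)
  then show "G s (T s t h) \<in> bounded_measurable"
    using C unfolding k_def by (intro bounded_measurableI[where C = C]) auto
  have "T r s k x = T r t h x" if "r \<in> {0..<s}" for r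
    unfolding k_def using that assms D_bounded_measurable by (intro semigroup_comp[symmetric]) auto
  moreover have "T s s k x = T s t h x"
    using semigroup_refl[of s k x] assms D_bounded_measurable[OF k] by (simp add: k_def)
  ultimately have "((\<lambda>r. (T r s k x - T s s k x) / (r - s)) \<longlongrightarrow> - G s k x) (at s within {0..<s})
      \<longleftrightarrow> ((\<lambda>r. (T r t h x - T s t h x) / (r - s)) \<longlongrightarrow> - G s k x) (at s within {0..<s})"
    by (intro Lim_cong_within) auto
  with lim show "((\<lambda>r. (T r t h x - T s t h x) / (r - s)) \<longlongrightarrow> - G s (T s t h) x) (at s within {0..<s})"
    unfolding k_def by blast
qed

lemma at_left_nontrivial: "0 < (s::real) \<Longrightarrow> at s within {0..<s} \<noteq> bot"
  using islimpt_greaterThanLessThan2[of 0 s] islimpt_subset[of s "{0<..<s}" "{0..<s}"]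
  by (auto simp: trivial_limit_within)

text \<open>Strong differentiability provides a derivative within the interval, and its value is already determined by the left
  difference quotients.\<close>

lemma backward_equation:
  assumes "0 < c" "c \<le> t" "t \<le> a" "h \<in> D"
  shows "\<And>s. s \<in> {c..t} \<Longrightarrow> ((\<lambda>r. T r t h x) has_real_derivative - G s (T s t h) x) (at s within {c..t})"
    and "continuous_on {c..t} (\<lambda>s. G s (T s t h) x)"
proof -
  have "strongly_C1_on {0..t} (\<lambda>s. T s t h)"
    using generator assms unfolding has_generator_def by auto
  then obtain H' where H': "\<And>s. s \<in> {0..t} \<Longrightarrow> has_strong_derivative (\<lambda>s. T s t h) (H' s) s {0..t}"
      "\<And>s. s \<in> {0..t} \<Longrightarrow> uniform_limit UNIV H' (H' s) (at s within {0..t})"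
    unfolding strongly_C1_on_def by blast
  have der: "((\<lambda>r. T r t h x) has_real_derivative H' s x) (at s within {0..t})" if "s \<in> {0..t}" for s x
    using H'(1)[OF that] by (rule has_strong_derivative_pointwise)
  have eq: "H' s x = - G s (T s t h) x" if "s \<in> {c..t}" for s x
  proof (rule tendsto_unique)
    show "at s within {0..<s} \<noteq> bot" using that assms by (intro at_left_nontrivial) auto
    show "((\<lambda>r. (T r t h x - T s t h x) / (r - s)) \<longlongrightarrow> - G s (T s t h) x) (at s within {0..<s})"
      using that assms by (intro generator_left_derivative) auto
    have "((\<lambda>r. (T r t h x - T s t h x) / (r - s)) \<longlongrightarrow> H' s x) (at s within {0..t})"
      using der[of s x] that assms by (simp add: has_field_derivative_iff)
    then show "((\<lambda>r. (T r t h x - T s t h x) / (r - s)) \<longlongrightarrow> H' s x) (at s within {0..<s})"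
      by (rule tendsto_within_subset) (use that in auto)
  qed
  show "((\<lambda>r. T r t h x) has_real_derivative - G s (T s t h) x) (at s within {c..t})"
    if "s \<in> {c..t}" for s
    using DERIV_subset[OF der[of s x], of "{c..t}"] eq[OF that] that assms by auto
  have "continuous_on {c..t} (\<lambda>s. H' s x)"
    unfolding continuous_on_def
  proof
    fix s assume s: "s \<in> {c..t}"
    then have "((\<lambda>r. H' r x) \<longlongrightarrow> H' s x) (at s within {0..t})"
      using H'(2)[of s] assms by (auto intro: tendsto_uniform_limitI)
    then show "((\<lambda>r. H' r x) \<longlongrightarrow> H' s x) (at s within {c..t})"
      by (rule tendsto_within_subset) (use assms in auto)
  qed
  then have "continuous_on {c..t} (\<lambda>s. - H' s x)" by (rule continuous_on_minus)
  then show "continuous_on {c..t} (\<lambda>s. G s (T s t h) x)"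
    by (rule continuous_on_eq) (simp add: eq)
qed

text \<open>The difference quotients of \<open>r \<mapsto> T r s k\<close> at \<open>s\<close> are controlled by the exit probabilities from \<open>r\<close> to
  \<open>s\<close>, so bounded rates give a bound that involves \<open>h\<close> only through its supremum norm.\<close>

lemma generator_bounded:
  assumes "0 \<le> a"
  obtains K where "K \<ge> 0"
    "\<And>s t h C x. 0 < s \<Longrightarrow> s \<le> t \<Longrightarrow> t \<le> a \<Longrightarrow> h \<in> D \<Longrightarrow> (\<And>y. \<bar>h y\<bar> \<le> C) \<Longrightarrow> \<bar>G s (T s t h) x\<bar> \<le> K * C"
proof -
  obtain K where K: "K \<ge> 0" "\<And>s t x. 0 \<le> s \<Longrightarrow> s \<le> t \<Longrightarrow> t \<le> a \<Longrightarrow> exit_prob s t x \<le> K * (t - s)"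
    using bounded_rates[OF assms] by blast
  have "\<bar>G s (T s t h) x\<bar> \<le> (2 * K) * C"
    if st: "0 < s" "s \<le> t" "t \<le> a" and h: "h \<in> D" and C: "\<And>y. \<bar>h y\<bar> \<le> C" for s t h C x
  proof -
    have hB: "h \<in> bounded_measurable" by (rule D_bounded_measurable) fact
    have C0: "C \<ge> 0" using C[of 0] by linarith
    define k where "k = T s t h"
    have kB: "k \<in> bounded_measurable"
      unfolding k_def by (rule semigroup_bounded_measurable) (use st hB in auto)
    have k_le: "\<bar>k y\<bar> \<le> C" for y
      unfolding k_def by (rule semigroup_bound) (use st hB C in auto)
    have lim: "((\<lambda>r. norm ((T r t h x - T s t h x) / (r - s))) \<longlongrightarrow> norm (- G s (T s t h) x)) (at s within {0..<s})"
      by (intro tendsto_norm generator_left_derivative) fact+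
    have "norm ((T r t h x - T s t h x) / (r - s)) \<le> 2 * K * C" if r: "r \<in> {0..<s}" for r
    proof -
      have "T r t h x = T r s k x"
        unfolding k_def using r st hB by (intro semigroup_comp) auto
      then have "\<bar>T r t h x - T s t h x\<bar> \<le> 2 * C * exit_prob r s x"
        using semigroup_diff_exit[of r s k C x] r st kB k_le by (simp add: k_def)
      also have "\<dots> \<le> 2 * C * (K * (s - r))"
        using K(2)[of r s x] r st C0 by (intro mult_left_mono) auto
      finally show ?thesis using r by (simp add: abs_divide divide_simps mult_ac)
    qed
    then have "eventually (\<lambda>r. norm ((T r t h x - T s t h x) / (r - s)) \<le> 2 * K * C) (at s within {0..<s})"
      by (auto simp: eventually_at_filter)
    from tendsto_upperbound[OF lim this at_left_nontrivial] show ?thesis using st by simp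
  qed
  then show thesis using that[of "2 * K"] K(1) by simp
qed

end

section \<open>Differentiation under a probability measure\<close>

lemma derivative_quotient_LIMSEQ:
  fixes H :: "real \<Rightarrow> real"
  assumes "(H has_real_derivative D) (at v within S)" "\<And>n. w n \<in> S - {v}" "w \<longlonglongrightarrow> v"
  shows "(\<lambda>n. (H (w n) - H v) / (w n - v)) \<longlonglongrightarrow> D"
  using assms unfolding has_field_derivative_iff tendsto_at_iff_sequentially by (auto simp: comp_def)

text \<open>A derivative is a pointwise limit of difference quotients along a sequence.\<close>

lemma measurable_derivative:
  fixes H H' :: "real \<Rightarrow> 'b \<Rightarrow> real"
  assumes "a < b" and v: "v \<in> {a..b}"
    and meas: "\<And>v. v \<in> {a..b} \<Longrightarrow> H v \<in> borel_measurable M"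
    and der: "\<And>x. ((\<lambda>r. H r x) has_real_derivative H' v x) (at v within {a..b})"
  shows "H' v \<in> borel_measurable M"
proof -
  have "v islimpt {a..b}" using v \<open>a < b\<close> by (simp add: islimpt_Icc)
  then obtain w where w: "\<And>n. w n \<in> {a..b} - {v}" "w \<longlonglongrightarrow> v"
    unfolding islimpt_sequential by blast
  have "w n \<in> {a..b}" for n using w(1)[of n] by blast
  then have "(\<lambda>x. (H (w n) x - H v x) / (w n - v)) \<in> borel_measurable M" for n
    by (intro borel_measurable_divide borel_measurable_diff borel_measurable_const meas v)
  with derivative_quotient_LIMSEQ[OF der w] show ?thesis by (rule borel_measurable_LIMSEQ_real)
qed

text \<open>The two integrals are exchanged by differentiating under the integral sign and applying the fundamental
  theorem of calculus; Fubini's theorem would first require the joint measurability of \<open>H'\<close>.\<close>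

lemma integral_derivative_under_prob:
  fixes H H' :: "real \<Rightarrow> 'b \<Rightarrow> real"
  assumes "prob_space P" and "a < b"
    and meas: "\<And>v. v \<in> {a..b} \<Longrightarrow> H v \<in> borel_measurable P"
    and bound: "\<And>v x. v \<in> {a..b} \<Longrightarrow> \<bar>H v x\<bar> \<le> C"
    and der: "\<And>v x. v \<in> {a..b} \<Longrightarrow> ((\<lambda>r. H r x) has_real_derivative H' v x) (at v within {a..b})"
    and cont: "\<And>x. continuous_on {a..b} (\<lambda>v. H' v x)"
    and bound': "\<And>v x. v \<in> {a..b} \<Longrightarrow> \<bar>H' v x\<bar> \<le> C'"
  shows "(LINT v:{a..b}|lborel. LINT x|P. H' v x) = (LINT x|P. H b x) - (LINT x|P. H a x)"
proof -
  interpret prob_space P by fact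
  note quot_lim = derivative_quotient_LIMSEQ[OF der]
  have quot_meas: "(\<lambda>x. (H r x - H v x) / (r - v)) \<in> borel_measurable P"
    if "v \<in> {a..b}" "r \<in> {a..b}" for v r
    by (intro borel_measurable_divide borel_measurable_diff borel_measurable_const meas that)
  have meas': "H' v \<in> borel_measurable P" if v: "v \<in> {a..b}" for v
    by (rule measurable_derivative[of a b v H P H']) (fact | rule meas der, fact)+
  have int: "integrable P (H v)" if "v \<in> {a..b}" for v
    using bound[OF that] by (intro integrable_const_bound[where B = C] meas that AE_I2) simp
  define R where "R v = (LINT x|P. H v x)" for v
  define R' where "R' v = (LINT x|P. H' v x)" for v
  have R: "(R has_real_derivative R' v) (at v within {a..b})" if v: "v \<in> {a..b}" for v
    unfolding has_field_derivative_iff tendsto_at_iff_sequentially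
  proof (intro allI impI)
    fix w :: "nat \<Rightarrow> real" assume w: "\<forall>n. w n \<in> {a..b} - {v}" "w \<longlonglongrightarrow> v"
    have wn: "w n \<in> {a..b}" for n using w by auto
    have "(\<lambda>n. LINT x|P. (H (w n) x - H v x) / (w n - v)) \<longlonglongrightarrow> R' v"
      unfolding R'_def
    proof (rule integral_dominated_convergence[where w = "\<lambda>_. C'"])
      show "AE x in P. (\<lambda>n. (H (w n) x - H v x) / (w n - v)) \<longlonglongrightarrow> H' v x"
        using quot_lim[OF v] w by simp
      show "AE x in P. norm ((H (w n) x - H v x) / (w n - v)) \<le> C'" for n
      proof (rule AE_I2)
        fix x
        have "norm (H (w n) x - H v x) \<le> C' * norm (w n - v)"
          by (rule field_differentiable_bound[OF _ der]) (use bound' v wn in auto)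
        then show "norm ((H (w n) x - H v x) / (w n - v)) \<le> C'"
          using w(1) by (auto simp: divide_simps)
      qed
    qed (rule meas'[OF v] quot_meas[OF v wn] | simp)+
    moreover have "(LINT x|P. (H (w n) x - H v x) / (w n - v)) = (R (w n) - R v) / (w n - v)" for n
      using int[OF v] int[OF wn] by (simp add: R_def)
    ultimately show "((\<lambda>r. (R r - R v) / (r - v)) \<circ> w) \<longlonglongrightarrow> R' v" by (simp only: comp_def)
  qed
  have "continuous_on {a..b} R'"
    unfolding continuous_on_sequentially
  proof (intro allI ballI impI, elim conjE)
    fix w :: "nat \<Rightarrow> real" and v assume v: "v \<in> {a..b}" and w: "\<forall>n. w n \<in> {a..b}" "w \<longlonglongrightarrow> v"
    have "(\<lambda>n. LINT x|P. H' (w n) x) \<longlonglongrightarrow> (LINT x|P. H' v x)"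
    proof (rule integral_dominated_convergence[where w = "\<lambda>_. C'"])
      show "AE x in P. (\<lambda>n. H' (w n) x) \<longlonglongrightarrow> H' v x"
        using cont v w unfolding continuous_on_sequentially by (auto simp: comp_def)
      show "AE x in P. norm (H' (w n) x) \<le> C'" for n using bound' w(1) by (intro AE_I2) simp
    qed (rule meas' | use v w in simp)+
    then show "(R' \<circ> w) \<longlonglongrightarrow> R' v" by (simp add: R'_def comp_def)
  qed
  moreover have "(R has_vector_derivative R' v) (at v within {a..b})" if "a \<le> v" "v \<le> b" for v
    using R[of v] that by (simp add: has_real_derivative_iff_has_vector_derivative)
  ultimately have "(\<integral>v. indicator {a..b} v *\<^sub>R R' v \<partial>lborel) = R b - R a"
    using \<open>a < b\<close> by (intro integral_FTC_Icc) auto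
  then show ?thesis by (simp add: set_lebesgue_integral_def R_def R'_def)
qed

section \<open>The sorted list of indices\<close>

lemma map_nth_upt: "b \<le> length xs \<Longrightarrow> map ((!) xs) [a..<b] = take (b - a) (drop a xs)"
  by (rule nth_equalityI) auto

text \<open>The indices of the earlier increments \<open>j < i\<close>, sorted, split at \<open>\<pi> i\<close> into \<open>ks\<close> and \<open>ms\<close>; the two
  new indices fit exactly between them. Since the list is sorted, the neighbours \<open>\<pi> i - 1\<close> and
  \<open>\<pi> i\<close> occur side by side at one position only, which identifies \<open>pos\<close>.\<close>

lemma idx_split:
  fixes \<pi> :: "nat \<Rightarrow> nat"
  assumes i: "2 \<le> i" and m_pos: "1 \<le> \<pi> i"
  obtains ks ms where
    "pos \<pi> i = length ks + 2" "2 * (i - 1) = length ks + 2 + length ms"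
    "idx \<pi> i = 1 # ks @ [\<pi> i - 1, \<pi> i] @ ms"
    "idx_seg \<pi> i 1 (pos \<pi> i - 2) = ks" "idx_seg \<pi> i 1 (pos \<pi> i - 1) = ks @ [\<pi> i - 1]"
    "idx_seg \<pi> i (pos \<pi> i + 1) (2 * (i - 1)) = ms"
    "sorted (ks @ [\<pi> i - 1, \<pi> i] @ ms)"
    "set (ks @ ms) = (\<Union>j\<in>{2..<i}. {\<pi> j - 1, \<pi> j})"
proof -
  define m where "m = \<pi> i"
  define L where "L = concat (map (\<lambda>j. [\<pi> j - 1, \<pi> j]) [2..<i])"
  define ks where "ks = sort (filter (\<lambda>x. x < m) L)"
  define ms where "ms = sort (filter (\<lambda>x. \<not> x < m) L)"
  have m: "1 \<le> m" using m_pos by (simp add: m_def)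
  have sorted: "sorted (ks @ [m - 1, m] @ ms)"
    using m by (auto simp: sorted_append ks_def ms_def)
  have full: "concat (map (\<lambda>j. [\<pi> j - 1, \<pi> j]) [2..<i + 1]) = L @ [m - 1, m]"
    using i by (simp add: L_def m_def)
  have "mset (ks @ [m - 1, m] @ ms) = mset (L @ [m - 1, m])"
    using multiset_partition[of "mset L" "\<lambda>x. x < m"] by (simp add: ks_def ms_def)
  then have idx: "idx \<pi> i = 1 # ks @ [m - 1, m] @ ms"
    unfolding idx_def full using sorted by (simp add: properties_for_sort)
  have "length L = 2 * (i - 2)"
    by (simp add: L_def length_concat comp_def sum_list_triv)
  moreover have "length ks + length ms = length L"
    by (simp add: ks_def ms_def sum_length_filter_compl)
  ultimately have len: "2 * (i - 1) = length ks + 2 + length ms" using i by simp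
  let ?L = "ks @ [m - 1, m] @ ms"
  have pos: "pos \<pi> i = length ks + 2"
    unfolding pos_def
  proof (rule the_equality)
    show "2 \<le> length ks + 2 \<and> length ks + 2 \<le> 2 * (i - 1) \<and> idx \<pi> i ! (length ks + 2 - 1) = \<pi> i - 1
        \<and> idx \<pi> i ! (length ks + 2) = \<pi> i"
      using len by (simp add: idx nth_append m_def)
  next
    fix p assume p: "2 \<le> p \<and> p \<le> 2 * (i - 1) \<and> idx \<pi> i ! (p - 1) = \<pi> i - 1 \<and> idx \<pi> i ! p = \<pi> i"
    then have L: "?L ! (p - 2) = m - 1" "?L ! (p - 1) = m" and plen: "p - 1 < length ?L"
      using len by (auto simp: idx m_def nth_Cons' numeral_2_eq_2)
    have mid: "?L ! length ks = m - 1" "?L ! (length ks + 1) = m" by (simp_all add: nth_append)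
    have "\<not> p - 1 \<le> length ks"
      using sorted_nth_mono[OF sorted, of "p - 1" "length ks"] L mid m by auto
    moreover have "\<not> length ks + 1 \<le> p - 2"
    proof
      assume "length ks + 1 \<le> p - 2"
      moreover have "p - 2 < length ?L" using plen by linarith
      ultimately have "?L ! (length ks + 1) \<le> ?L ! (p - 2)" by (rule sorted_nth_mono[OF sorted])
      then show False using L(1) mid(2) m by linarith
    qed
    ultimately show "p = length ks + 2" using p by linarith
  qed
  show thesis
  proof (rule that[of ks ms])
    show "idx_seg \<pi> i 1 (pos \<pi> i - 2) = ks"
      unfolding idx_seg_def pos idx by (subst map_nth_upt) auto
    show "idx_seg \<pi> i 1 (pos \<pi> i - 1) = ks @ [\<pi> i - 1]"
      unfolding idx_seg_def pos idx by (subst map_nth_upt) (auto simp: m_def)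
    show "idx_seg \<pi> i (pos \<pi> i + 1) (2 * (i - 1)) = ms"
      unfolding idx_seg_def pos idx len by (subst map_nth_upt) auto
    show "set (ks @ ms) = (\<Union>j\<in>{2..<i}. {\<pi> j - 1, \<pi> j})"
      by (auto simp: ks_def ms_def L_def)
  qed (use pos len idx sorted in \<open>simp_all add: m_def\<close>)
qed

section \<open>Generators inside strings of operators\<close>

context transition_semigroup
begin

lemma chain:
  assumes "\<And>i j. i \<le> j \<Longrightarrow> j \<le> n \<Longrightarrow> u i \<le> u j" "0 \<le> u 0" "u n \<le> a"
  shows "transition_chain Q u n"
proof -
  have u: "0 \<le> u i" "u i \<le> a" if "i \<le> n" for i
    using assms(1)[of 0 i] assms(1)[of i n] assms(2,3) that by auto
  show ?thesis
  proof
    show "Q (u i) (u j) \<in> borel \<rightarrow>\<^sub>M prob_algebra borel" if "i \<le> j" "j \<le> n" for i j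
      using that u[of i] u[of j] assms(1)[of i j] by (intro kernel) auto
    show "Q (u i) (u i) x = return borel x" if "i \<le> n" for i x
      using system u[OF that] unfolding transition_system_def by blast
    show "Q (u i) (u k) x = Q (u i) (u j) x \<bind> Q (u j) (u k)" if "i \<le> j" "j \<le> k" "k \<le> n" for i j k x
      using system that u[of i] u[of k] assms(1)[of i j] assms(1)[of j k] unfolding transition_system_def by auto
  qed
qed

text \<open>The backward equation for a function \<open>\<phi> y\<close> that varies with the point \<open>y\<close> of a probability space,
  evaluated at a point \<open>s y\<close> and integrated over \<open>y\<close>. The uniform bound on the generator provides the
  domination. The weight \<open>\<psi>\<close> stays outside the generator, which thus acts on elements of
  \<open>D\<close> and not on their multiples.\<close>

lemma generator_under_paths:
  fixes \<phi> :: "'b \<Rightarrow> real \<Rightarrow> real" and \<psi> s :: "'b \<Rightarrow> real"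
  assumes cd: "0 < c" "c < d" "d \<le> a"
    and \<phi>: "\<And>y. \<phi> y \<in> D" "\<And>y x. \<bar>\<phi> y x\<bar> \<le> C" and \<psi>: "\<And>y. \<bar>\<psi> y\<bar> \<le> B"
    and meas: "\<And>v. v \<in> {c..d} \<Longrightarrow> (\<lambda>y. \<psi> y * T v d (\<phi> y) (s y)) \<in> borel_measurable M"
  shows "v \<in> {c..d} \<Longrightarrow> (\<lambda>y. \<psi> y * G v (T v d (\<phi> y)) (s y)) \<in> borel_measurable M" (is "_ \<Longrightarrow> ?meas")
    and "\<exists>K. \<forall>v\<in>{c..d}. \<forall>y. \<bar>\<psi> y * G v (T v d (\<phi> y)) (s y)\<bar> \<le> K" (is ?bound)
    and "prob_space M \<Longrightarrow> (LINT v:{c..d}|lborel. LINT y|M. \<psi> y * G v (T v d (\<phi> y)) (s y))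
      = (LINT y|M. \<psi> y * T c d (\<phi> y) (s y)) - (LINT y|M. \<psi> y * \<phi> y (s y))" (is "_ \<Longrightarrow> ?eq")
proof -
  have B: "B \<ge> 0" and C: "C \<ge> 0"
    using \<psi>[of undefined] \<phi>(2)[of undefined undefined] by linarith+
  define H where "H v y = - (\<psi> y * T v d (\<phi> y) (s y))" for v y
  define H' where "H' v y = \<psi> y * G v (T v d (\<phi> y)) (s y)" for v y
  have H_meas: "H v \<in> borel_measurable M" if "v \<in> {c..d}" for v
    unfolding H_def using meas[OF that] by (rule borel_measurable_uminus)
  have H_der: "((\<lambda>r. H r y) has_real_derivative H' v y) (at v within {c..d})" if "v \<in> {c..d}" for v y
  proof -
    have "((\<lambda>r. - (\<psi> y * T r d (\<phi> y) (s y))) has_real_derivative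
        - (\<psi> y * - G v (T v d (\<phi> y)) (s y))) (at v within {c..d})"
      using cd \<phi>(1) that by (intro DERIV_minus DERIV_cmult backward_equation(1)) auto
    then show ?thesis by (simp add: H_def H'_def)
  qed
  have H_bound: "\<bar>H v y\<bar> \<le> B * C" if "v \<in> {c..d}" for v y
    unfolding H_def abs_minus_cancel abs_mult
    using cd that B \<psi> \<phi> by (intro mult_mono semigroup_bound D_bounded_measurable) auto
  obtain K where "K \<ge> 0" and K: "\<And>s t h C x. 0 < s \<Longrightarrow> s \<le> t \<Longrightarrow> t \<le> a \<Longrightarrow> h \<in> D
      \<Longrightarrow> (\<And>y. \<bar>h y\<bar> \<le> C) \<Longrightarrow> \<bar>G s (T s t h) x\<bar> \<le> K * C"
    by (rule generator_bounded) (use cd in auto)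
  have H'_bound: "\<bar>H' v y\<bar> \<le> B * (K * C)" if "v \<in> {c..d}" for v y
    unfolding H'_def abs_mult using cd that B \<psi> \<phi> by (intro mult_mono K) auto
  then show ?bound unfolding H'_def by blast
  show ?meas if "v \<in> {c..d}"
    using measurable_derivative[of c d v H M H', OF cd(2) that H_meas H_der[OF that]] by (simp add: H'_def[abs_def])
  have cont: "continuous_on {c..d} (\<lambda>v. H' v y)" for y
    unfolding H'_def using cd \<phi>(1) by (intro continuous_on_mult continuous_on_const backward_equation(2)) auto
  show ?eq if "prob_space M"
  proof -
    have "(LINT v:{c..d}|lborel. LINT y|M. H' v y) = (LINT y|M. H d y) - (LINT y|M. H c y)"
      by (rule integral_derivative_under_prob[OF that cd(2) H_meas H_bound H_der cont H'_bound])
    moreover have "T d d (\<phi> y) x = \<phi> y x" for y x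
      using cd \<phi>(1) by (intro semigroup_refl D_bounded_measurable) auto
    ultimately show ?thesis by (simp add: H_def H'_def)
  qed
qed

text \<open>The right sides of (b1) and (b2). The function \<open>\<phi> y\<close> to which the generator is applied is the rest of the
  string as a function of the variable \<open>m\<close>, the earlier variables of the path \<open>y\<close> being frozen. At
  \<open>v = u m\<close> the operator in front of it is the identity, so the assumption at this single time says
  that \<open>\<phi> y \<in> D\<close>.\<close>

lemma generator_term:
  assumes mono: "\<And>i j. i \<le> j \<Longrightarrow> j \<le> n \<Longrightarrow> u i \<le> u j" and u0: "0 \<le> u 0" and un: "u n \<le> a"
    and m: "1 \<le> m" "m \<le> n" "0 < u (m - 1)" "u (m - 1) < u m"
    and ks: "sorted (1 # ks)" "last (1 # ks) = m - 1" "\<And>k. k \<in> set ks \<Longrightarrow> k \<le> n"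
    and ms: "sorted (m # ms)" "\<And>k. k \<in> set ms \<Longrightarrow> k \<le> n"
    and F: "F \<in> bounded_path"
    and arg_D: "\<And>y. generator_arg Q u (u m) m ms F y \<in> D"
  shows "(LINT v:{u (m - 1)..u m}|lborel. iterated_generator Q G u 1 ks v m ms F y0)
    = iterated Q u 1 (ks @ m # ms) F y0 - iterated Q u 1 ks (\<lambda>y. iterated Q u m ms F (y(m := y (m - 1)))) y0"
proof -
  interpret transition_chain Q u n by (rule chain) fact+
  define F' where "F' = iterated Q u m ms F"
  define \<phi> where "\<phi> y z = F' (y(m := z))" for y z
  have F': "F' \<in> bounded_path" unfolding F'_def by (rule iterated_bounded) fact+
  obtain C where C: "\<And>y. \<bar>F' y\<bar> \<le> C" using F' by (meson bounded_pathE)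
  have um: "0 \<le> u m" "u m \<le> a" using mono[of 0 m] mono[of m n] u0 un m by auto
  have \<phi>_B: "\<phi> y \<in> bounded_measurable" for y
    unfolding \<phi>_def using F' by (rule bounded_path_section)
  have arg: "generator_arg Q u v m ms F y = T v (u m) (\<phi> y)" for v y
    by (simp add: generator_arg_def semigroup_op_def[abs_def] \<phi>_def[abs_def] F'_def)
  have "T (u m) (u m) (\<phi> y) = \<phi> y" for y
    using um \<phi>_B by (intro ext semigroup_refl)
  then have \<phi>_D: "\<phi> y \<in> D" for y using arg_D[of y] by (simp add: arg)
  \<comment> \<open>For \<open>v\<close> between two grid times the kernel is a step of the chain whose time \<open>u (m - 1)\<close> is moved to \<open>v\<close>; this yields its measurability in \<open>y\<close>.\<close>
  have T_eq: "T v (u m) (\<phi> y) (y (m - 1)) = iterated Q (u(m - 1 := v)) (m - 1) [m] F' y" for v y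
  proof -
    have "m \<noteq> m - 1" using m(1) by linarith
    then show ?thesis by (simp add: semigroup_op_def \<phi>_def)
  qed
  have T_B: "(\<lambda>y. T v (u m) (\<phi> y) (y (m - 1))) \<in> bounded_path" if v: "v \<in> {u (m - 1)..u m}" for v
  proof -
    have "(u(m - 1 := v)) i \<le> (u(m - 1 := v)) j" if "i \<le> j" "j \<le> n" for i j
    proof (cases "i = m - 1 \<and> j \<noteq> m - 1")
      case True
      then have "u m \<le> u j" using that by (intro mono) linarith+
      with True v show ?thesis by simp
    next
      case False
      then show ?thesis using v mono[of i j] mono[of i "m - 1"] that by auto
    qed
    moreover have "0 \<le> (u(m - 1 := v)) 0" "(u(m - 1 := v)) n \<le> a"
      using u0 un v m by auto
    ultimately interpret v: transition_chain Q "u(m - 1 := v)" n by (rule chain)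
    show ?thesis unfolding T_eq by (rule v.iterated_bounded) (use F' m in auto)
  qed
  have ps: "prob_space (path_law Q u 1 ks y0)" "sets (path_law Q u 1 ks y0) = sets paths"
    using path_law_prob[OF ks(1,3)] by auto
  let ?P = "path_law Q u 1 ks y0"
  have meas: "(\<lambda>y. 1 * T v (u m) (\<phi> y) (y (m - 1))) \<in> borel_measurable M"
    if "v \<in> {u (m - 1)..u m}" "sets M = sets paths" for v M
    using T_B[OF that(1), THEN bounded_path_measurable] by (simp add: measurable_cong_sets[OF that(2) refl])
  have bounds: "\<bar>\<phi> y x\<bar> \<le> C" "\<bar>1\<bar> \<le> (1::real)" for y x by (simp_all add: \<phi>_def C)
  note gen = generator_under_paths[OF m(3,4) um(2) \<phi>_D bounds, where s = "\<lambda>y. y (m - 1)"]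
  have G_B: "(\<lambda>y. G v (T v (u m) (\<phi> y)) (y (m - 1))) \<in> bounded_path" if v: "v \<in> {u (m - 1)..u m}" for v
  proof -
    obtain K where "\<And>y. \<bar>1 * G v (T v (u m) (\<phi> y)) (y (m - 1))\<bar> \<le> K" using gen(2)[OF meas] v by blast
    moreover have "(\<lambda>y. 1 * G v (T v (u m) (\<phi> y)) (y (m - 1))) \<in> borel_measurable paths"
      by (rule gen(1)[OF meas v]) auto
    ultimately show ?thesis by (intro bounded_pathI) auto
  qed
  have "(LINT v:{u (m - 1)..u m}|lborel. iterated_generator Q G u 1 ks v m ms F y0)
    = (LINT v:{u (m - 1)..u m}|lborel. LINT y|?P. 1 * G v (T v (u m) (\<phi> y)) (y (m - 1)))"
  proof (rule set_lebesgue_integral_cong)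
    show "\<forall>v. v \<in> {u (m - 1)..u m} \<longrightarrow> iterated_generator Q G u 1 ks v m ms F y0
        = (LINT y|?P. 1 * G v (T v (u m) (\<phi> y)) (y (m - 1)))"
      unfolding iterated_generator_def arg ks(2)
      using iterated_eq_integral[OF ks(1,3) G_B] by simp
  qed simp
  also have "\<dots> = (LINT y|?P. 1 * T (u (m - 1)) (u m) (\<phi> y) (y (m - 1))) - (LINT y|?P. 1 * \<phi> y (y (m - 1)))"
    by (rule gen(3)[OF meas]) (use ps in auto)
  also have "(LINT y|?P. 1 * T (u (m - 1)) (u m) (\<phi> y) (y (m - 1)))
      = iterated Q u 1 ks (\<lambda>y. T (u (m - 1)) (u m) (\<phi> y) (y (m - 1))) y0"
    using iterated_eq_integral[OF ks(1,3) T_B, of "u (m - 1)"] m by simp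
  also have "(\<lambda>y. T (u (m - 1)) (u m) (\<phi> y) (y (m - 1))) = iterated Q u (last (1 # ks)) (m # ms) F"
    unfolding ks(2) by (simp add: semigroup_op_def \<phi>_def F'_def fun_eq_iff)
  also have "iterated Q u 1 ks (iterated Q u (last (1 # ks)) (m # ms) F) y0 = iterated Q u 1 (ks @ m # ms) F y0"
    by (rule iterated_append[symmetric])
  also have "(LINT y|?P. 1 * \<phi> y (y (m - 1))) = iterated Q u 1 ks (\<lambda>y. F' (y(m := y (m - 1)))) y0"
  proof -
    have "(\<lambda>y. F' (y(m := y (m - 1)))) \<in> bounded_path"
      by (rule bounded_path_comp_path[OF F']) measurable
    from iterated_eq_integral[OF ks(1,3) this] show ?thesis by (simp add: \<phi>_def)
  qed
  finally show ?thesis unfolding F'_def .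
qed

text \<open>The left sides of (b1) and (b2): the generator of one flow under the path law of the other.\<close>

lemma backward_term:
  assumes "transition_chain Q' u n"
    and ks: "sorted (1 # ks)" "\<And>k. k \<in> set ks \<Longrightarrow> k \<le> n"
    and cd: "0 < c" "c < d" "d \<le> a"
    and \<psi>: "\<psi> \<in> bounded_path" and s [measurable]: "s \<in> borel_measurable paths" and h: "h \<in> D"
  shows "(LINT w:{c..d}|lborel. iterated Q' u 1 ks (\<lambda>y. \<psi> y * G w (T w d h) (s y)) y0)
    = iterated Q' u 1 ks (\<lambda>y. \<psi> y * T c d h (s y)) y0 - iterated Q' u 1 ks (\<lambda>y. \<psi> y * h (s y)) y0"
proof -
  interpret transition_chain Q' u n by fact
  let ?P = "path_law Q' u 1 ks y0"
  have ps: "prob_space ?P" "sets ?P = sets paths" using path_law_prob[OF ks] by auto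
  note hB = D_bounded_measurable[OF h]
  obtain C where C: "\<And>x. \<bar>h x\<bar> \<le> C" using hB by (meson bounded_measurableE)
  obtain B where B: "\<And>y. \<bar>\<psi> y\<bar> \<le> B" using \<psi> by (meson bounded_pathE)
  have T_B: "(\<lambda>y. \<psi> y * T w d h (s y)) \<in> bounded_path" if "w \<in> {c..d}" for w
    using that cd by (intro bounded_path_mult \<psi> bounded_path_comp semigroup_bounded_measurable hB s) auto
  have h_B: "(\<lambda>y. \<psi> y * h (s y)) \<in> bounded_path"
    by (intro bounded_path_mult \<psi> bounded_path_comp hB s)
  have meas: "(\<lambda>y. \<psi> y * T w d h (s y)) \<in> borel_measurable M"
    if "w \<in> {c..d}" "sets M = sets paths" for w M
    using T_B[OF that(1), THEN bounded_path_measurable] by (simp add: measurable_cong_sets[OF that(2) refl])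
  note gen = generator_under_paths[OF cd h C B, where s = s]
  have G_B: "(\<lambda>y. \<psi> y * G w (T w d h) (s y)) \<in> bounded_path" if w: "w \<in> {c..d}" for w
  proof -
    obtain K where "\<And>y. \<bar>\<psi> y * G w (T w d h) (s y)\<bar> \<le> K" using gen(2)[OF meas] w by blast
    moreover have "(\<lambda>y. \<psi> y * G w (T w d h) (s y)) \<in> borel_measurable paths"
      by (rule gen(1)[OF meas w]) auto
    ultimately show ?thesis by (intro bounded_pathI) auto
  qed
  have "(LINT w:{c..d}|lborel. iterated Q' u 1 ks (\<lambda>y. \<psi> y * G w (T w d h) (s y)) y0)
    = (LINT w:{c..d}|lborel. LINT y|?P. \<psi> y * G w (T w d h) (s y))"
    by (rule set_lebesgue_integral_cong) (use iterated_eq_integral[OF ks G_B] in auto)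
  also have "\<dots> = (LINT y|?P. \<psi> y * T c d h (s y)) - (LINT y|?P. \<psi> y * h (s y))"
    by (rule gen(3)[OF meas]) (use ps in auto)
  finally show ?thesis
    using iterated_eq_integral[OF ks T_B, of c] iterated_eq_integral[OF ks h_B] cd by simp
qed

end

section \<open>Condition (b) without generators\<close>

lemma incr_sum_measurable [measurable]: "incr_sum \<pi> k \<in> borel_measurable paths"
  unfolding incr_sum_def[abs_def] by measurable

lemma incr_prod_bounded_path:
  assumes "\<And>j. j \<in> {2..k} \<Longrightarrow> h j \<in> bounded_measurable"
  shows "incr_prod \<pi> h k \<in> bounded_path"
proof -
  have "(\<lambda>y. \<Prod>j=2..k. h j (y (\<pi> j) - y (\<pi> j - 1))) \<in> bounded_path"
    by (intro bounded_path_prod bounded_path_comp assms) measurable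
  then show ?thesis by (simp add: incr_prod_def[abs_def])
qed

lemma depends_on_incr_prod: "depends_on (incr_prod \<pi> h k) (\<Union>j\<in>{2..k}. {\<pi> j - 1, \<pi> j})"
  unfolding depends_on_def incr_prod_def by (intro allI impI prod.cong) auto

lemma depends_on_incr_sum: "depends_on (incr_sum \<pi> k) (insert 1 (\<Union>j\<in>{2..k}. {\<pi> j - 1, \<pi> j}))"
  unfolding depends_on_def incr_sum_def by (intro allI impI arg_cong2[where f = "(+)"] sum.cong) auto

lemma depends_on_mult_comp:
  assumes "depends_on F C" "depends_on s C"
  shows "depends_on (\<lambda>y. F y * k (s y)) C"
  using assms unfolding depends_on_def by metis

lemma strict_mono_up_to:
  fixes t :: "nat \<Rightarrow> real"
  assumes "\<And>i. i < n \<Longrightarrow> t i < t (i + 1)" "i < j" "j \<le> n"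
  shows "t i < t j"
  using assms(2,3)
proof (induction j)
  case (Suc j)
  then have "i = j \<or> t i < t j" by linarith
  moreover have "t j < t (Suc j)" using assms(1)[of j] Suc.prems by simp
  ultimately show ?case by auto
qed simp

text \<open>The comparison of two chains at the partition times of the flows. The assumption \<open>arg_D\<close> is the domain
  condition at the upper end \<open>u (\<pi> i)\<close> of the integration interval in (b); the invariance of \<open>D\<close>
  under the semigroup carries it to the earlier times.\<close>

locale flow_comparison =
  f: transition_semigroup "t n" Qf D Gf + g: transition_semigroup "u n" Qg D Gg
  for n :: nat and t u :: "nat \<Rightarrow> real" and Qf Qg :: "real \<Rightarrow> real \<Rightarrow> real \<Rightarrow> real measure"
    and D :: "(real \<Rightarrow> real) set" and Gf Gg :: "real \<Rightarrow> (real \<Rightarrow> real) \<Rightarrow> real \<Rightarrow> real" +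
  fixes \<pi> :: "nat \<Rightarrow> nat" and \<mu> :: "real measure"
  assumes n_pos: "1 \<le> n"
    and prob_initial: "prob_space \<mu>" and sets_initial: "sets \<mu> = sets borel"
    and perm: "\<pi> permutes {1..n}" and perm_1: "\<pi> 1 = 1"
    and t_0: "t 0 = 0" and t_less: "\<And>i. i < n \<Longrightarrow> t i < t (i + 1)"
    and u_0: "u 0 = 0" and u_less: "\<And>i. i < n \<Longrightarrow> u i < u (i + 1)"
    and start: "Qf 0 (t 1) = Qg 0 (u 1)"
    and arg_D: "\<And>i h y. i \<in> {2..n} \<Longrightarrow> (\<forall>j\<in>{2..i}. h j \<in> D) \<Longrightarrow>
      generator_arg Qg u (u (\<pi> i)) (\<pi> i) (idx_seg \<pi> i (pos \<pi> i + 1) (2 * (i - 1)))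
        (if pos \<pi> i = 2 * (i - 1) then integrand_b1 \<pi> h i else integrand_b2 \<pi> h i) y \<in> D"
begin

lemma t_strict: "i < j \<Longrightarrow> j \<le> n \<Longrightarrow> t i < t j"
  by (rule strict_mono_up_to[where t = t, OF t_less])

lemma u_strict: "i < j \<Longrightarrow> j \<le> n \<Longrightarrow> u i < u j"
  by (rule strict_mono_up_to[where t = u, OF u_less])

lemma t_mono: "i \<le> j \<Longrightarrow> j \<le> n \<Longrightarrow> t i \<le> t j"
  using t_strict[of i j] by (cases "i = j") auto

lemma u_mono: "i \<le> j \<Longrightarrow> j \<le> n \<Longrightarrow> u i \<le> u j"
  using u_strict[of i j] by (cases "i = j") auto

sublocale f_chain: transition_chain Qf t n
  by (rule f.chain) (use t_mono t_0 in auto)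

sublocale g_chain: transition_chain Qg u n
  by (rule g.chain) (use u_mono u_0 in auto)

lemma perm_range:
  assumes "i \<in> {2..n}"
  shows "\<pi> i \<in> {2..n}"
proof -
  have "\<pi> i \<in> {1..n}" using permutes_in_image[OF perm, of i] assms by simp
  moreover have "\<pi> i \<noteq> \<pi> 1" using inj_eq[OF permutes_inj[OF perm], of i 1] assms by simp
  ultimately show ?thesis using perm_1 by auto
qed

text \<open>The conditional expectation of a function of the second chain given its state at time \<open>u 1\<close>, as a function
  of a path that carries this state at index 1.\<close>

definition future_mean :: "((nat \<Rightarrow> real) \<Rightarrow> real) \<Rightarrow> (nat \<Rightarrow> real) \<Rightarrow> real" where
  "future_mean F = iterated Qg u 1 [1 + 1..<n + 1] F"

text \<open>The test function \<open>integrand_b1\<close> with its last factor replaced by the conditional expectation of this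
  factor under the first flow.\<close>

definition predicted :: "nat \<Rightarrow> (nat \<Rightarrow> real \<Rightarrow> real) \<Rightarrow> (nat \<Rightarrow> real) \<Rightarrow> real" where
  "predicted i h y = incr_prod \<pi> h (i - 1) y * semigroup_op Qf (t (i - 1)) (t i) (h i) (incr_sum \<pi> (i - 1) y)"

definition condition_b :: "nat \<Rightarrow> (nat \<Rightarrow> real \<Rightarrow> real) \<Rightarrow> real \<Rightarrow> bool" where
  "condition_b i h x1 \<longleftrightarrow> (let p = pos \<pi> i; l = (!) (idx \<pi> i) in
          (p = 2 * (i - 1) \<longrightarrow>
            (LINT w:{t (i - 1)..t i}|lborel.
               iterated Qg u 1 (idx_seg \<pi> i 1 (p - 2))
                 (\<lambda>y. incr_prod \<pi> h (i - 1) y *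
                      Gf w (semigroup_op Qf w (t i) (h i)) (incr_sum \<pi> (i - 1) y)) (\<lambda>_. x1)) =
            (LINT v:{u (l (p - 1))..u (l p)}|lborel.
               iterated_generator Qg Gg u 1 (idx_seg \<pi> i 1 (p - 1)) v (l p) []
                 (integrand_b1 \<pi> h i) (\<lambda>_. x1))) \<and>
          (p < 2 * (i - 1) \<longrightarrow>
            (LINT w:{t (i - 1)..t i}|lborel.
               iterated Qg u 1 (idx_seg \<pi> i 1 (p - 2) @ idx_seg \<pi> i (p + 1) (2 * (i - 1)))
                 (\<lambda>y. incr_prod \<pi> h (i - 1) y *
                      Gf w (semigroup_op Qf w (t i) (h i)) (incr_sum \<pi> (i - 1) y)) (\<lambda>_. x1)) =
            (LINT v:{u (l (p - 1))..u (l p)}|lborel.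
               iterated_generator Qg Gg u 1 (idx_seg \<pi> i 1 (p - 1)) v (l p)
                 (idx_seg \<pi> i (p + 1) (2 * (i - 1)))
                 (integrand_b2 \<pi> h i) (\<lambda>_. x1))))"

lemma predicted_bounded_path:
  assumes i: "i \<in> {2..n}" and h: "\<And>j. j \<in> {2..i} \<Longrightarrow> h j \<in> bounded_measurable"
  shows "predicted i h \<in> bounded_path" "integrand_b1 \<pi> h i \<in> bounded_path"
    "(\<lambda>y. incr_prod \<pi> h (i - 1) y * h i (incr_sum \<pi> (i - 1) y)) \<in> bounded_path"
proof -
  have prod: "incr_prod \<pi> h (i - 1) \<in> bounded_path"
    by (rule incr_prod_bounded_path) (use h in auto)
  have Th: "semigroup_op Qf (t (i - 1)) (t i) (h i) \<in> bounded_measurable"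
    using i h t_mono[of "i - 1" i] t_mono[of 0 "i - 1"] t_mono[of i n] t_0
    by (intro f.semigroup_bounded_measurable) auto
  have hi: "h i \<in> bounded_measurable" using i h by auto
  show "predicted i h \<in> bounded_path" "integrand_b1 \<pi> h i \<in> bounded_path"
    "(\<lambda>y. incr_prod \<pi> h (i - 1) y * h i (incr_sum \<pi> (i - 1) y)) \<in> bounded_path"
    unfolding predicted_def[abs_def] integrand_b1_def[abs_def]
    by (intro bounded_path_mult bounded_path_comp prod Th hi incr_sum_measurable)+
qed

text \<open>The identity (*) of the introduction. \<open>X1\<close> and \<open>X3\<close> are its two sides and \<open>X2\<close> is the common function that is
  subtracted from both.\<close>

lemma condition_b_iff:
  assumes i: "i \<in> {2..n}" and h: "\<forall>j\<in>{2..i}. h j \<in> D"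
  shows "condition_b i h x1 \<longleftrightarrow> future_mean (predicted i h) (\<lambda>_. x1) = future_mean (integrand_b1 \<pi> h i) (\<lambda>_. x1)"
proof -
  define m where "m = \<pi> i"
  have m: "2 \<le> m" "m \<le> n" using perm_range[OF i] by (auto simp: m_def)
  obtain ks ms where
    pos: "pos \<pi> i = length ks + 2" and len: "2 * (i - 1) = length ks + 2 + length ms"
    and idx: "idx \<pi> i = 1 # ks @ [m - 1, m] @ ms"
    and seg: "idx_seg \<pi> i 1 (pos \<pi> i - 2) = ks" "idx_seg \<pi> i 1 (pos \<pi> i - 1) = ks @ [m - 1]"
      "idx_seg \<pi> i (pos \<pi> i + 1) (2 * (i - 1)) = ms"
    and sorted: "sorted (ks @ [m - 1, m] @ ms)"
    and set: "set (ks @ ms) = (\<Union>j\<in>{2..<i}. {\<pi> j - 1, \<pi> j})"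
  proof -
    have "2 \<le> i" "1 \<le> m" using i m by auto
    then show thesis by (rule idx_split[of i \<pi>, folded m_def]) (rule that)
  qed
  have range: "1 \<le> k \<and> k \<le> n" if "k \<in> set (ks @ ms)" for k
    using that perm_range i unfolding set by fastforce
  have sorted1: "sorted (1 # ks @ ms)" "sorted (1 # ks @ [m - 1])" "sorted (1 # (ks @ [m - 1]) @ m # ms)"
      "sorted (m # ms)"
    using sorted range m by (auto simp: sorted_append)
  have le_n: "k \<le> n" if "k \<in> set ks \<or> k \<in> set ms \<or> k = m \<or> k = m - 1" for k
    using that range m by auto
  have set': "(\<Union>j\<in>{2..i - 1}. {\<pi> j - 1, \<pi> j}) = set ks \<union> set ms"
  proof -
    have "{2..i - 1} = {2..<i}" using i by auto
    then show ?thesis using set by simp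
  qed
  have set_i: "(\<Union>j\<in>{2..i}. {\<pi> j - 1, \<pi> j}) = set ks \<union> set ms \<union> {m - 1, m}"
  proof -
    have "{2..i} = insert i {2..i - 1}" using i by auto
    then show ?thesis using set' by (auto simp: m_def)
  qed
  define \<psi> where "\<psi> = incr_prod \<pi> h (i - 1)"
  define S' where "S' = incr_sum \<pi> (i - 1)"
  define S where "S = incr_sum \<pi> i"
  have S_eq: "S y = S' y + (y m - y (m - 1))" for y
  proof -
    have "{2..i} = insert i {2..i - 1}" and notin: "i \<notin> {2..i - 1}" using i by auto
    then have "(\<Sum>j=2..i. y (\<pi> j) - y (\<pi> j - 1))
        = (y (\<pi> i) - y (\<pi> i - 1)) + (\<Sum>j=2..i - 1. y (\<pi> j) - y (\<pi> j - 1))"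
      by (simp only: sum.insert[OF finite_atLeastAtMost notin])
    then show ?thesis by (simp add: S_def S'_def incr_sum_def m_def)
  qed
  define X1 where "X1 = predicted i h"
  define X2 where "X2 y = \<psi> y * h i (S' y)" for y
  define X3 where "X3 = integrand_b1 \<pi> h i"
  have X1: "X1 = (\<lambda>y. \<psi> y * semigroup_op Qf (t (i - 1)) (t i) (h i) (S' y))"
    by (simp add: X1_def predicted_def[abs_def] \<psi>_def S'_def)
  have X3: "X3 = (\<lambda>y. \<psi> y * h i (S y))"
    by (simp add: X3_def integrand_b1_def[abs_def] \<psi>_def S_def)
  have hB: "h j \<in> bounded_measurable" if "j \<in> {2..i}" for j
    using h that f.D_bounded_measurable by blast
  have \<psi>_B: "\<psi> \<in> bounded_path"
    unfolding \<psi>_def by (rule incr_prod_bounded_path) (use hB in auto)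
  note B = predicted_bounded_path[OF i hB]
  have X1_B: "X1 \<in> bounded_path" and X3_B: "X3 \<in> bounded_path" and X2_B: "X2 \<in> bounded_path"
    using B by (simp_all add: X1_def X3_def X2_def[abs_def] \<psi>_def S'_def)
  have dep_\<psi>: "depends_on \<psi> (set ks \<union> set ms)"
    using depends_on_incr_prod[of \<pi> h "i - 1"] unfolding set' \<psi>_def .
  have dep_S': "depends_on S' (insert 1 (set ks \<union> set ms))"
    using depends_on_incr_sum[of \<pi> "i - 1"] unfolding set' S'_def .
  have dep_S: "depends_on S (insert 1 (set ks \<union> set ms \<union> {m - 1, m}))"
    using depends_on_incr_sum[of \<pi> i] unfolding set_i S_def .
  have dep1: "depends_on X1 (insert 1 (set ks \<union> set ms))" "depends_on X2 (insert 1 (set ks \<union> set ms))"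
    unfolding X1 X2_def[abs_def]
    by (rule depends_on_mult_comp, rule depends_on_mono[OF dep_\<psi>], blast, rule dep_S')+
  have dep3: "depends_on X3 (insert 1 (set ks \<union> set ms \<union> {m - 1, m}))"
    unfolding X3
    by (rule depends_on_mult_comp, rule depends_on_mono[OF dep_\<psi>], blast, rule dep_S)
  have X_full: "iterated Qg u 1 (ks @ ms) X (\<lambda>_. x1) = future_mean X (\<lambda>_. x1)"
    if "X \<in> bounded_path" "depends_on X (insert 1 (set ks \<union> set ms))" for X
    unfolding future_mean_def using sorted1 le_n n_pos that
    by (intro g_chain.iterated_eq_full depends_on_mono[OF that(2)]) auto
  have X_full': "iterated Qg u 1 ((ks @ [m - 1]) @ m # ms) X (\<lambda>_. x1) = future_mean X (\<lambda>_. x1)"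
    if "X \<in> bounded_path" "depends_on X (insert 1 (set ks \<union> set ms \<union> {m - 1, m}))" for X
    unfolding future_mean_def using le_n n_pos that
    by (intro g_chain.iterated_eq_full sorted1 depends_on_mono[OF that(2)]) auto
  have t_i: "0 < t (i - 1)" "t (i - 1) < t i" "t i \<le> t n"
    using i t_strict[of 0 "i - 1"] t_strict[of "i - 1" i] t_mono[of i n] t_0 by auto
  have hi: "h i \<in> D" using h i by auto
  have left: "(LINT w:{t (i - 1)..t i}|lborel. iterated Qg u 1 (ks @ ms)
      (\<lambda>y. incr_prod \<pi> h (i - 1) y * Gf w (semigroup_op Qf w (t i) (h i)) (incr_sum \<pi> (i - 1) y)) (\<lambda>_. x1))
    = future_mean X1 (\<lambda>_. x1) - future_mean X2 (\<lambda>_. x1)"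
  proof -
    have "(LINT w:{t (i - 1)..t i}|lborel. iterated Qg u 1 (ks @ ms)
        (\<lambda>y. \<psi> y * Gf w (semigroup_op Qf w (t i) (h i)) (S' y)) (\<lambda>_. x1))
      = iterated Qg u 1 (ks @ ms) X1 (\<lambda>_. x1) - iterated Qg u 1 (ks @ ms) X2 (\<lambda>_. x1)"
      unfolding X1 X2_def[abs_def]
      by (rule f.backward_term[OF g_chain.transition_chain_axioms sorted1(1) _ t_i \<psi>_B _ hi])
         (use le_n in \<open>auto simp: S'_def\<close>)
    then show ?thesis using X_full[OF X1_B dep1(1)] X_full[OF X2_B dep1(2)] by (simp add: \<psi>_def S'_def)
  qed
  have um: "0 < u (m - 1)" "u (m - 1) < u m"
    using m u_strict[of 0 "m - 1"] u_strict[of "m - 1" m] u_0 by auto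
  have right: "(LINT v:{u (m - 1)..u m}|lborel.
        iterated_generator Qg Gg u 1 (ks @ [m - 1]) v m ms X (\<lambda>_. x1))
      = future_mean X (\<lambda>_. x1)
        - iterated Qg u 1 (ks @ [m - 1]) (\<lambda>y. iterated Qg u m ms X (y(m := y (m - 1)))) (\<lambda>_. x1)"
    if "X \<in> bounded_path" "depends_on X (insert 1 (set ks \<union> set ms \<union> {m - 1, m}))"
      "\<And>y. generator_arg Qg u (u m) m ms X y \<in> D" for X
    unfolding X_full'[OF that(1,2), symmetric]
    by (rule g.generator_term[OF u_mono]) (use u_0 m um sorted1 le_n that in auto)
  have l_eq: "idx \<pi> i ! (pos \<pi> i - 1) = m - 1" "idx \<pi> i ! pos \<pi> i = m"
    by (simp_all add: idx pos nth_append)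
  have case_eq: "pos \<pi> i = 2 * (i - 1) \<longleftrightarrow> ms = []" "pos \<pi> i < 2 * (i - 1) \<longleftrightarrow> ms \<noteq> []"
    unfolding pos len by simp_all
  have argD: "generator_arg Qg u (u m) m ms (if ms = [] then integrand_b1 \<pi> h i else integrand_b2 \<pi> h i) y \<in> D" for y
    using arg_D[OF i h, of y] unfolding case_eq seg by (simp add: m_def)
  show ?thesis
  proof (cases "ms = []")
    case True
    have m_notin: "m \<notin> set ks" "m \<noteq> 1" "m - 1 \<noteq> m" using sorted m by (auto simp: sorted_append)
    \<comment> \<open>No variable lives after time \<open>u m\<close>, and no earlier increment involves the index \<open>m\<close>.\<close>
    have "X3 (y(m := y (m - 1))) = X2 y" for y
    proof -
      have "\<psi> (y(m := y (m - 1))) = \<psi> y" "S' (y(m := y (m - 1))) = S' y"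
        using m_notin True by (auto intro!: depends_onD[OF dep_\<psi>] depends_onD[OF dep_S'])
      then show ?thesis using m_notin by (simp add: X3 X2_def S_eq)
    qed
    moreover have "iterated Qg u 1 (ks @ [m - 1]) X2 (\<lambda>_. x1) = future_mean X2 (\<lambda>_. x1)"
      unfolding future_mean_def using sorted1 le_n n_pos X2_B True
      by (intro g_chain.iterated_eq_full depends_on_mono[OF dep1(2)]) auto
    ultimately have "(LINT v:{u (m - 1)..u m}|lborel.
        iterated_generator Qg Gg u 1 (ks @ [m - 1]) v m [] X3 (\<lambda>_. x1)) = future_mean X3 (\<lambda>_. x1) - future_mean X2 (\<lambda>_. x1)"
      using right[OF X3_B dep3] argD True by (simp add: X3_def)
    then have "condition_b i h x1 \<longleftrightarrow> future_mean X1 (\<lambda>_. x1) - future_mean X2 (\<lambda>_. x1) = future_mean X3 (\<lambda>_. x1) - future_mean X2 (\<lambda>_. x1)"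
      using left True unfolding condition_b_def Let_def case_eq l_eq seg by (simp add: X3_def)
    then show ?thesis by (simp add: X1_def X3_def)
  next
    case False
    define X4 where "X4 = integrand_b2 \<pi> h i"
    have X4: "X4 = (\<lambda>y. X3 y - X2 y)"
      by (simp add: X4_def integrand_b2_def[abs_def] X3 X2_def \<psi>_def S_def S'_def algebra_simps)
    have X4_B: "X4 \<in> bounded_path" unfolding X4 by (rule bounded_path_diff[OF X3_B X2_B])
    have dep4: "depends_on X4 (insert 1 (set ks \<union> set ms \<union> {m - 1, m}))"
    proof -
      have "depends_on X2 (insert 1 (set ks \<union> set ms \<union> {m - 1, m}))"
        by (rule depends_on_mono[OF dep1(2)]) blast
      with dep3 show ?thesis unfolding X4 depends_on_def by metis
    qed
    \<comment> \<open>The later operators write only coordinates beyond \<open>m\<close>, and a repeated index \<open>m\<close> rewrites its own value; hence the equality of the values at \<open>m - 1\<close> and \<open>m\<close> persists.\<close>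
    have "iterated Qg u m ms X4 (y(m := y (m - 1))) = 0" for y
    proof -
      have "set ks \<subseteq> {..m}" using sorted m by (auto simp: sorted_append)
      then have "depends_on X4 ({..m} \<union> set ms)" using m by (intro depends_on_mono[OF dep4]) auto
      then have "iterated Qg u m ms X4 (y(m := y (m - 1)))
        = iterated Qg u m [m + 1..<n + 1] X4 (y(m := y (m - 1)))"
        using sorted1 le_n m X4_B by (intro g_chain.iterated_eq_full) auto
      also have "\<dots> = 0"
      proof (rule g_chain.iterated_const)
        fix z assume z: "\<And>j. j \<notin> set [m + 1..<n + 1] \<Longrightarrow> z j = (y(m := y (m - 1))) j"
        have "z m = y (m - 1)" using z[of m] by simp
        moreover have "z (m - 1) = (y(m := y (m - 1))) (m - 1)" by (rule z) (use m in \<open>auto simp del: upt_Suc\<close>)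
        moreover have "m - 1 \<noteq> m" using m by linarith
        ultimately have "z m = z (m - 1)" by simp
        then show "X4 z = 0" by (simp add: X4 X3 X2_def S_eq)
      qed (auto simp del: upt_Suc)
      finally show ?thesis .
    qed
    moreover have "iterated Qg u 1 (ks @ [m - 1]) (\<lambda>_. 0) (\<lambda>_. x1) = 0"
      by (rule g_chain.iterated_const) (use sorted1 le_n in auto)
    moreover have "future_mean X4 (\<lambda>_. x1) = future_mean X3 (\<lambda>_. x1) - future_mean X2 (\<lambda>_. x1)"
      unfolding future_mean_def X4 by (rule g_chain.iterated_diff[OF _ _ X3_B X2_B]) (auto simp del: upt_Suc)
    ultimately have "(LINT v:{u (m - 1)..u m}|lborel.
        iterated_generator Qg Gg u 1 (ks @ [m - 1]) v m ms X4 (\<lambda>_. x1)) = future_mean X3 (\<lambda>_. x1) - future_mean X2 (\<lambda>_. x1)"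
      using right[OF X4_B dep4] argD False by (simp add: X4_def)
    then have "condition_b i h x1 \<longleftrightarrow> future_mean X1 (\<lambda>_. x1) - future_mean X2 (\<lambda>_. x1) = future_mean X3 (\<lambda>_. x1) - future_mean X2 (\<lambda>_. x1)"
      using left False unfolding condition_b_def Let_def case_eq l_eq seg by (simp add: X4_def)
    then show ?thesis by (simp add: X1_def X3_def)
  qed
qed

end

section \<open>Equality of laws from test functions\<close>

text \<open>The first \<open>k + 1\<close> coordinates live in a finite product, where rectangles determine a measure.\<close>

lemma same_law_from_rectangles:
  assumes M: "prob_space M" "X \<in> M \<rightarrow>\<^sub>M paths" and N: "prob_space N" "Y \<in> N \<rightarrow>\<^sub>M paths"
    and eq: "\<And>\<Gamma>. (\<And>j. \<Gamma> j \<in> sets borel) \<Longrightarrow>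
      (LINT x|M. (\<Prod>j\<le>k. indicat_real (\<Gamma> j) (X x j))) = (LINT y|N. (\<Prod>j\<le>k. indicat_real (\<Gamma> j) (Y y j)))"
    and F: "F \<in> bounded_path" "depends_on F {..k}"
  shows "(LINT x|M. F (X x)) = (LINT y|N. F (Y y))"
proof -
  let ?PI = "Pi\<^sub>M {..k} (\<lambda>_. borel :: real measure)"
  let ?r = "\<lambda>z. restrict z {..k}"
  let ?e = "\<lambda>z j. if j \<le> k then z j else 0"
  have r: "?r \<in> paths \<rightarrow>\<^sub>M ?PI" by (rule measurable_restrict_subset) simp
  have e: "?e \<in> ?PI \<rightarrow>\<^sub>M paths"
  proof (rule measurable_PiM_single')
    show "(\<lambda>z. if j \<le> k then z j else 0) \<in> borel_measurable ?PI" for j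
      by (cases "j \<le> k") (auto intro: measurable_component_singleton)
  qed auto
  note [measurable] = M(2) N(2) r e F(1)[THEN bounded_path_measurable]
  have emeasure_rect: "emeasure (distr K ?PI (\<lambda>x. ?r (Z x))) (Pi\<^sub>E {..k} \<Gamma>)
      = ennreal (LINT x|K. (\<Prod>j\<le>k. indicat_real (if j \<le> k then \<Gamma> j else UNIV) (Z x j)))"
    if K: "prob_space K" "Z \<in> K \<rightarrow>\<^sub>M paths" and \<Gamma>: "\<And>j. j \<in> {..k} \<Longrightarrow> \<Gamma> j \<in> sets borel" for K Z \<Gamma>
  proof -
    interpret K: prob_space K by fact
    note [measurable] = K(2)
    have rZ: "(\<lambda>x. ?r (Z x)) \<in> K \<rightarrow>\<^sub>M ?PI" by measurable
    have R: "Pi\<^sub>E {..k} \<Gamma> \<in> sets ?PI" using \<Gamma> by (intro sets_PiM_I_finite) auto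
    have "emeasure (distr K ?PI (\<lambda>x. ?r (Z x))) (Pi\<^sub>E {..k} \<Gamma>)
        = emeasure K ((\<lambda>x. ?r (Z x)) -` Pi\<^sub>E {..k} \<Gamma> \<inter> space K)"
      by (rule emeasure_distr[OF rZ R])
    also have "\<dots> = ennreal (LINT x|K. indicat_real ((\<lambda>x. ?r (Z x)) -` Pi\<^sub>E {..k} \<Gamma> \<inter> space K) x)"
      by (simp add: K.emeasure_eq_measure Int_absorb1)
    also have "(LINT x|K. indicat_real ((\<lambda>x. ?r (Z x)) -` Pi\<^sub>E {..k} \<Gamma> \<inter> space K) x)
        = (LINT x|K. (\<Prod>j\<le>k. indicat_real (if j \<le> k then \<Gamma> j else UNIV) (Z x j)))"
    proof (rule Bochner_Integration.integral_cong[OF refl])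
      fix x assume x: "x \<in> space K"
      have "(\<Prod>j\<le>k. indicat_real (if j \<le> k then \<Gamma> j else UNIV) (Z x j)) = (if \<forall>j\<le>k. Z x j \<in> \<Gamma> j then 1 else 0)"
        by (auto simp: indicator_def prod_zero_iff intro!: prod.neutral)
      then show "indicat_real ((\<lambda>x. ?r (Z x)) -` Pi\<^sub>E {..k} \<Gamma> \<inter> space K) x
          = (\<Prod>j\<le>k. indicat_real (if j \<le> k then \<Gamma> j else UNIV) (Z x j))"
        using x by (auto simp: indicator_def PiE_iff)
    qed
    finally show ?thesis .
  qed
  have law: "distr M ?PI (\<lambda>x. ?r (X x)) = distr N ?PI (\<lambda>y. ?r (Y y))"
  proof (rule measure_eqI_PiM_finite[where I = "{..k}" and M = "\<lambda>_. borel"])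
    fix \<Gamma> :: "nat \<Rightarrow> real set" assume \<Gamma>: "\<And>j. j \<in> {..k} \<Longrightarrow> \<Gamma> j \<in> sets borel"
    show "emeasure (distr M ?PI (\<lambda>x. ?r (X x))) (Pi\<^sub>E {..k} \<Gamma>) = emeasure (distr N ?PI (\<lambda>y. ?r (Y y))) (Pi\<^sub>E {..k} \<Gamma>)"
    proof -
      have "(if j \<le> k then \<Gamma> j else UNIV) \<in> sets borel" for j using \<Gamma>[of j] by simp
      note eq[where \<Gamma> = "\<lambda>j. if j \<le> k then \<Gamma> j else UNIV", OF this]
      with emeasure_rect[OF M, of \<Gamma>] emeasure_rect[OF N, of \<Gamma>] \<Gamma> show ?thesis by simp
    qed
  next
    show "range (\<lambda>_::nat. Pi\<^sub>E {..k} (\<lambda>_. UNIV)) \<subseteq> prod_algebra {..k} (\<lambda>_. borel :: real measure)"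
      by (auto intro!: prod_algebraI_finite)
    show "(\<Union>i::nat. Pi\<^sub>E {..k} (\<lambda>_. UNIV)) = space ?PI" by (simp add: space_PiM)
    interpret M: prob_space M by fact
    interpret prob_space "distr M ?PI (\<lambda>x. ?r (X x))" by (rule M.prob_space_distr) measurable
    show "emeasure (distr M ?PI (\<lambda>x. ?r (X x))) (Pi\<^sub>E {..k} (\<lambda>_. UNIV)) \<noteq> \<infinity>" for i :: nat
      by simp
  qed auto
  have F_eq: "F z = F (?e (?r z))" for z by (rule depends_onD[OF F(2)]) auto
  have "(LINT x|K. F (Z x)) = (LINT w|distr K ?PI (\<lambda>x. ?r (Z x)). F (?e w))"
    if [measurable]: "Z \<in> K \<rightarrow>\<^sub>M paths" for K :: "'z measure" and Z
    by (subst integral_distr) (auto simp: F_eq[symmetric])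
  then have "(LINT x|M. F (X x)) = (LINT w|distr M ?PI (\<lambda>x. ?r (X x)). F (?e w))"
    by (subst integral_distr) (auto simp: F_eq[symmetric])
  also have "\<dots> = (LINT y|N. F (Y y))"
    unfolding law by (subst integral_distr) (auto simp: F_eq[symmetric])
  finally show ?thesis .
qed

text \<open>The expectation of a product is continuous in each factor for the supremum norm, so factors from a dense
  space can be exchanged for arbitrary bounded measurable ones, one coordinate of \<open>J\<close> after the other.\<close>

lemma product_expectation_from_dense:
  fixes k :: nat
  assumes dense: "dense_subspace D"
    and M: "prob_space M" "X \<in> M \<rightarrow>\<^sub>M paths" and N: "prob_space N" "Y \<in> N \<rightarrow>\<^sub>M paths"
    and J: "finite J" "J \<subseteq> {..k}"
    and eq: "\<And>h. (\<And>j. h j \<in> bounded_measurable) \<Longrightarrow> (\<And>j. j \<in> J \<Longrightarrow> h j \<in> D) \<Longrightarrow>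
      (LINT x|M. (\<Prod>j\<le>k. h j (X x j))) = (LINT y|N. (\<Prod>j\<le>k. h j (Y y j)))"
    and h: "\<And>j. h j \<in> bounded_measurable"
  shows "(LINT x|M. (\<Prod>j\<le>k. h j (X x j))) = (LINT y|N. (\<Prod>j\<le>k. h j (Y y j)))"
  using J eq h
proof (induction J arbitrary: h rule: finite_induct)
  case empty
  then show ?case by blast
next
  case (insert a J)
  show ?case
  proof (rule insert.IH)
    fix h :: "nat \<Rightarrow> real \<Rightarrow> real"
    assume hB: "\<And>j. h j \<in> bounded_measurable" and hD: "\<And>j. j \<in> J \<Longrightarrow> h j \<in> D"
    have a: "a \<le> k" using insert.prems by auto
    have "\<forall>j. \<exists>C. C \<ge> 0 \<and> (\<forall>x. \<bar>h j x\<bar> \<le> C)" using hB by (meson bounded_measurableE)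
    then obtain C where C: "\<And>j. C j \<ge> 0" "\<And>j x. \<bar>h j x\<bar> \<le> C j" by metis
    define B where "B = (\<Prod>j\<in>{..k} - {a}. C j)"
    have B: "B \<ge> 0" unfolding B_def using C(1) by (intro prod_nonneg) auto
    have approx: "\<bar>(LINT x|K. (\<Prod>j\<le>k. h j (Z x j))) - (LINT x|K. (\<Prod>j\<le>k. (h(a := k')) j (Z x j)))\<bar> \<le> e * B"
      if K: "prob_space K" "Z \<in> K \<rightarrow>\<^sub>M paths" and k': "k' \<in> bounded_measurable" "\<And>x. \<bar>h a x - k' x\<bar> < e"
      for K :: "'z measure" and Z k' e
    proof -
      interpret K: prob_space K by fact
      note [measurable] = K(2)
      have bp: "(\<lambda>z. \<Prod>j\<le>k. g j (z j)) \<in> bounded_path" if "\<And>j. g j \<in> bounded_measurable" for g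
        by (intro bounded_path_prod bounded_path_comp that) measurable
      have int: "integrable K (\<lambda>x. \<Prod>j\<le>k. g j (Z x j))" if g: "\<And>j. g j \<in> bounded_measurable" for g
      proof -
        obtain c where "\<And>z. \<bar>\<Prod>j\<le>k. g j (z j)\<bar> \<le> c" using bp[OF g] by (meson bounded_pathE)
        then show ?thesis
          using measurable_compose[OF K(2) bp[OF g, THEN bounded_path_measurable]]
          by (intro K.integrable_const_bound[where B = c] AE_I2) auto
      qed
      have h': "(h(a := k')) j \<in> bounded_measurable" for j using hB k' by simp
      have split: "(\<Prod>j\<le>k. g j) = g a * (\<Prod>j\<in>{..k} - {a}. g j)" for g :: "nat \<Rightarrow> real"
        using a by (intro prod.remove) auto
      have diff: "\<bar>(\<Prod>j\<le>k. h j (z j)) - (\<Prod>j\<le>k. (h(a := k')) j (z j))\<bar> \<le> e * B" for z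
      proof -
        have "(\<Prod>j\<in>{..k} - {a}. (h(a := k')) j (z j)) = (\<Prod>j\<in>{..k} - {a}. h j (z j))"
          by (rule prod.cong) auto
        then have "(\<Prod>j\<le>k. h j (z j)) - (\<Prod>j\<le>k. (h(a := k')) j (z j))
            = (h a (z a) - k' (z a)) * (\<Prod>j\<in>{..k} - {a}. h j (z j))"
          unfolding split[of "\<lambda>j. h j (z j)"] split[of "\<lambda>j. (h(a := k')) j (z j)"]
          by (simp add: left_diff_distrib)
        moreover have "\<bar>\<Prod>j\<in>{..k} - {a}. h j (z j)\<bar> \<le> B"
          unfolding B_def abs_prod by (intro prod_mono) (auto simp: C)
        ultimately show ?thesis
          using k'(2)[of "z a"] B by (simp only: abs_mult) (intro mult_mono, auto)
      qed
      have "(LINT x|K. (\<Prod>j\<le>k. h j (Z x j))) - (LINT x|K. (\<Prod>j\<le>k. (h(a := k')) j (Z x j)))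
          = (LINT x|K. (\<Prod>j\<le>k. h j (Z x j)) - (\<Prod>j\<le>k. (h(a := k')) j (Z x j)))"
        by (rule Bochner_Integration.integral_diff[symmetric]) (rule int[OF hB] int[OF h'])+
      also have "\<bar>\<dots>\<bar> \<le> (LINT x|K. \<bar>(\<Prod>j\<le>k. h j (Z x j)) - (\<Prod>j\<le>k. (h(a := k')) j (Z x j))\<bar>)"
        by (rule integral_abs_bound)
      also have "\<dots> \<le> (LINT x|K. e * B)"
        using diff by (intro integral_mono integrable_abs Bochner_Integration.integrable_diff int hB h') auto
      finally show ?thesis by (simp add: K.prob_space)
    qed
    show "(LINT x|M. (\<Prod>j\<le>k. h j (X x j))) = (LINT y|N. (\<Prod>j\<le>k. h j (Y y j)))" (is "?l = ?r")
    proof (rule ccontr)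
      assume "?l \<noteq> ?r"
      \<comment> \<open>Each side moves by at most \<open>e * B\<close>, so this \<open>e\<close> leaves a gap.\<close>
      define e where "e = \<bar>?l - ?r\<bar> / (2 * B + 1)"
      have e: "e > 0" using \<open>?l \<noteq> ?r\<close> B by (simp add: e_def)
      obtain k' where k': "k' \<in> D" "\<And>x. \<bar>h a x - k' x\<bar> < e"
        using dense hB[of a] e unfolding dense_subspace_def by meson
      have k'B: "k' \<in> bounded_measurable" using dense k'(1) unfolding dense_subspace_def by blast
      have "(LINT x|M. (\<Prod>j\<le>k. (h(a := k')) j (X x j))) = (LINT y|N. (\<Prod>j\<le>k. (h(a := k')) j (Y y j)))"
        using hB hD k'(1) k'B by (intro insert.prems(2)) auto
      then have "\<bar>?l - ?r\<bar> \<le> e * B + e * B"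
        using approx[OF M k'B k'(2)] approx[OF N k'B k'(2)] by linarith
      moreover have "\<bar>?l - ?r\<bar> = e * (2 * B + 1)" using B by (simp add: e_def)
      ultimately show False using e by (simp add: algebra_simps)
    qed
  qed (use insert.prems in auto)
qed

lemma AE_eq_from_indicators:
  fixes e :: "real \<Rightarrow> real"
  assumes "prob_space \<nu>" "sets \<nu> = sets borel" "e \<in> bounded_measurable"
    and zero: "\<And>\<Gamma>. \<Gamma> \<in> sets borel \<Longrightarrow> (LINT x|\<nu>. indicat_real \<Gamma> x * e x) = 0"
  shows "AE x in \<nu>. e x = 0"
proof -
  interpret prob_space \<nu> by fact
  note [measurable_cong] = assms(2)
  note [measurable] = assms(3)[THEN bounded_measurable_measurable]
  obtain C where C: "\<And>x. \<bar>e x\<bar> \<le> C" using assms(3) by (meson bounded_measurableE)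
  have int: "integrable \<nu> e" by (rule integrable_const_bound[where B = C]) (use C in auto)
  have e_split: "\<bar>e x\<bar> = indicat_real {x. e x > 0} x * e x - indicat_real {x. e x < 0} x * e x" for x
    by (auto simp: indicator_def)
  have [measurable]: "{x. e x > 0} \<in> sets borel" "{x. e x < 0} \<in> sets borel" by measurable
  have "integrable \<nu> (\<lambda>x. indicat_real \<Gamma> x * e x)" if [measurable]: "\<Gamma> \<in> sets borel" for \<Gamma>
  proof (rule integrable_const_bound[where B = C])
    show "AE x in \<nu>. norm (indicat_real \<Gamma> x * e x) \<le> C"
      using C order_trans[OF abs_ge_zero C] by (auto simp: indicator_def)
  qed measurable
  then have "(LINT x|\<nu>. \<bar>e x\<bar>) = 0"
    unfolding e_split by (subst Bochner_Integration.integral_diff) (auto simp: zero)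
  then have "AE x in \<nu>. \<bar>e x\<bar> = 0"
    using int by (subst (asm) integral_nonneg_eq_0_iff_AE) auto
  then show ?thesis by simp
qed

lemma iterated_mult_const: "iterated Q u k ms (\<lambda>y. c * F y) y = c * iterated Q u k ms F y"
  by (induction ms arbitrary: k y) auto

text \<open>With \<open>\<sigma> = \<pi>\<close> this reads off the second chain the increments in the order of the first flow, and with
  \<open>\<sigma> = id\<close> it treats the first chain. The first two coordinates are kept as they are, so that
  the sequence of increments carries the same information as the initial state and the states at all
  later times.\<close>

definition increments :: "(nat \<Rightarrow> nat) \<Rightarrow> (nat \<Rightarrow> real) \<Rightarrow> nat \<Rightarrow> real" where
  "increments \<sigma> y j = (if j \<le> 1 then y j else y (\<sigma> j) - y (\<sigma> j - 1))"

lemma increments_measurable [measurable]: "increments \<sigma> \<in> paths \<rightarrow>\<^sub>M paths"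
proof (rule measurable_PiM_single')
  show "(\<lambda>y. increments \<sigma> y j) \<in> borel_measurable paths" for j
    by (cases "j \<le> 1") (auto simp: increments_def[abs_def])
qed (auto simp: space_PiM)

lemma incr_prod_increments: "incr_prod \<sigma> h k y = (\<Prod>j=2..k. h j (increments \<sigma> y j))"
  unfolding incr_prod_def increments_def by (intro prod.cong) auto

lemma incr_sum_increments: "1 \<le> k \<Longrightarrow> incr_sum \<sigma> k y = (\<Sum>j=1..k. increments \<sigma> y j)"
  unfolding incr_sum_def increments_def
  by (subst (2) sum.atLeast_Suc_atMost) (auto simp: numeral_2_eq_2 intro!: sum.cong)

lemma sum_increments_id: "1 \<le> k \<Longrightarrow> (\<Sum>j=1..k. increments id x j) = x k"
  by (induction k rule: dec_induct) (auto simp: increments_def)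

context transition_chain
begin

definition path_measure :: "real measure \<Rightarrow> (nat \<Rightarrow> real) measure" where
  "path_measure \<mu> = \<mu> \<bind> (\<lambda>x. path_law Q u 0 [1..<n + 1] (\<lambda>_. x))"

lemma path_measure:
  assumes "prob_space \<mu>" "sets \<mu> = sets borel"
  shows "prob_space (path_measure \<mu>)" "sets (path_measure \<mu>) = sets paths"
    and "F \<in> bounded_path \<Longrightarrow>
      (LINT y|path_measure \<mu>. F y) = (LINT x|\<mu>. iterated Q u 0 [1..<n + 1] F (\<lambda>_. x))"
proof -
  interpret \<mu>: prob_space \<mu> by fact
  have ord: "sorted (0 # [1..<n + 1])" "\<And>m. m \<in> set [1..<n + 1] \<Longrightarrow> m \<le> n" by (auto simp del: upt_Suc)
  have "(\<lambda>x. path_law Q u 0 [1..<n + 1] (\<lambda>_. x)) \<in> borel \<rightarrow>\<^sub>M prob_algebra paths"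
    by (rule measurable_compose[OF measurable_const_path path_law_measurable[OF ord]])
  then have meas: "(\<lambda>x. path_law Q u 0 [1..<n + 1] (\<lambda>_. x)) \<in> \<mu> \<rightarrow>\<^sub>M prob_algebra paths"
    by (simp add: measurable_cong_sets[OF assms(2) refl])
  note laws = path_law_prob[OF ord]
  show "prob_space (path_measure \<mu>)"
    unfolding path_measure_def
    by (rule \<mu>.prob_space_bind[OF _ measurable_prob_algebraD[OF meas]]) (use laws in auto)
  show "sets (path_measure \<mu>) = sets paths"
    unfolding path_measure_def by (rule sets_bind[OF laws(2) \<mu>.not_empty])
  show "(LINT y|path_measure \<mu>. F y) = (LINT x|\<mu>. iterated Q u 0 [1..<n + 1] F (\<lambda>_. x))"
    if F: "F \<in> bounded_path"
  proof -
    obtain C where C: "\<And>y. \<bar>F y\<bar> \<le> C" using F by (meson bounded_pathE)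
    have "(LINT y|path_measure \<mu>. F y) = (LINT x|\<mu>. LINT y|path_law Q u 0 [1..<n + 1] (\<lambda>_. x). F y)"
      unfolding path_measure_def
      by (rule integral_bind[where K = paths and B' = 1 and B = C])
         (use C F laws(1)[THEN prob_space.emeasure_space_1] \<mu>.emeasure_space_1
            measurable_prob_algebraD[OF meas] \<mu>.finite_measure_axioms in
           \<open>auto simp: bounded_path_measurable simp del: upt_Suc\<close>)
    then show ?thesis using iterated_eq_integral[OF ord F] by simp
  qed
qed

text \<open>The Markov property at step \<open>i\<close>: once the later variables are integrated out, the variable \<open>i\<close> is the
  last of the string and enters only through \<open>h\<close>.\<close>

lemma path_measure_markov:
  assumes \<mu>: "prob_space \<mu>" "sets \<mu> = sets borel" and i: "1 \<le> i" "i \<le> n"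
    and \<psi>: "\<psi> \<in> bounded_path" "depends_on \<psi> {..i - 1}"
    and h: "h \<in> bounded_measurable" and Th: "semigroup_op Q (u (i - 1)) (u i) h \<in> bounded_measurable"
  shows "(LINT x|path_measure \<mu>. \<psi> x * h (x i))
    = (LINT x|path_measure \<mu>. \<psi> x * semigroup_op Q (u (i - 1)) (u i) h (x (i - 1)))"
proof -
  have B1: "(\<lambda>x. \<psi> x * h (x i)) \<in> bounded_path"
    by (intro bounded_path_mult \<psi> bounded_path_comp h) measurable
  have B2: "(\<lambda>x. \<psi> x * semigroup_op Q (u (i - 1)) (u i) h (x (i - 1))) \<in> bounded_path"
    by (intro bounded_path_mult \<psi> bounded_path_comp Th) measurable
  have dep1: "depends_on (\<lambda>x. \<psi> x * h (x i)) {..i}"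
    by (rule depends_on_mult_comp[OF depends_on_mono[OF \<psi>(2)]]) (auto simp: depends_on_def)
  have dep2: "depends_on (\<lambda>x. \<psi> x * semigroup_op Q (u (i - 1)) (u i) h (x (i - 1))) {..i - 1}"
    by (rule depends_on_mult_comp[OF \<psi>(2)]) (auto simp: depends_on_def)
  have "iterated Q u 0 [1..<n + 1] (\<lambda>x. \<psi> x * h (x i)) y
      = iterated Q u 0 [1..<n + 1] (\<lambda>x. \<psi> x * semigroup_op Q (u (i - 1)) (u i) h (x (i - 1))) y" for y
  proof -
    have "iterated Q u 0 [1..<n + 1] (\<lambda>x. \<psi> x * h (x i)) y
        = iterated Q u 0 [1..<i + 1] (\<lambda>x. \<psi> x * h (x i)) y"
      using iterated_eq_full[OF _ _ _ B1 depends_on_mono[OF dep1], of 0 "[1..<i + 1]" y] i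
      by (force simp del: upt_Suc)
    also have "[1..<i + 1] = [1..<i] @ [i]" using i by simp
    also have "iterated Q u 0 ([1..<i] @ [i]) (\<lambda>x. \<psi> x * h (x i)) y
        = iterated Q u 0 [1..<i] (iterated Q u (last (0 # [1..<i])) [i] (\<lambda>x. \<psi> x * h (x i))) y"
      by (rule iterated_append)
    also have "last (0 # [1..<i]) = i - 1" using i by auto
    also have "iterated Q u (i - 1) [i] (\<lambda>x. \<psi> x * h (x i))
        = (\<lambda>x. \<psi> x * semigroup_op Q (u (i - 1)) (u i) h (x (i - 1)))"
    proof
      fix x
      have "\<psi> (x(i := z)) = \<psi> x" for z using i by (intro depends_onD[OF \<psi>(2)]) auto
      then show "iterated Q u (i - 1) [i] (\<lambda>x. \<psi> x * h (x i)) x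
          = \<psi> x * semigroup_op Q (u (i - 1)) (u i) h (x (i - 1))"
        by (simp add: semigroup_op_def)
    qed
    also have "iterated Q u 0 [1..<i] (\<lambda>x. \<psi> x * semigroup_op Q (u (i - 1)) (u i) h (x (i - 1))) y
        = iterated Q u 0 [1..<n + 1] (\<lambda>x. \<psi> x * semigroup_op Q (u (i - 1)) (u i) h (x (i - 1))) y"
      using iterated_eq_full[OF _ _ _ B2 depends_on_mono[OF dep2], of 0 "[1..<i]" y] i
      by (force simp del: upt_Suc)
    finally show ?thesis .
  qed
  then show ?thesis using path_measure(3)[OF \<mu> B1] path_measure(3)[OF \<mu> B2] by simp
qed

end

section \<open>The equivalence\<close>

lemma prod_increments:
  assumes "1 \<le> k"
  shows "(\<Prod>j\<le>k. H j (increments \<sigma> y j)) = H 0 (y 0) * H 1 (y 1) * incr_prod \<sigma> H k y"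
proof -
  have "{..k} = insert 0 (insert 1 {2..k})" using assms by auto
  then show ?thesis unfolding incr_prod_increments by (simp add: increments_def)
qed

lemma bounded_path_prod_coords:
  "(\<And>j. H j \<in> bounded_measurable) \<Longrightarrow> (\<lambda>d. \<Prod>j\<le>k. H j (d j)) \<in> bounded_path"
  by (intro bounded_path_prod bounded_path_comp) measurable

lemma depends_on_prod_coords: "depends_on (\<lambda>d. \<Prod>j\<le>k. H j (d j)) {..k}"
  unfolding depends_on_def by (intro allI impI prod.cong) auto

lemma depends_on_increments_id:
  "depends_on F {..k} \<Longrightarrow> depends_on (\<lambda>x. F (increments id x)) {..k}"
  unfolding depends_on_def increments_def by auto

context flow_comparison
begin

abbreviation Mf :: "(nat \<Rightarrow> real) measure" where "Mf \<equiv> f_chain.path_measure \<mu>"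
abbreviation Mg :: "(nat \<Rightarrow> real) measure" where "Mg \<equiv> g_chain.path_measure \<mu>"

lemmas Mf = f_chain.path_measure[OF prob_initial sets_initial]
lemmas Mg = g_chain.path_measure[OF prob_initial sets_initial]

lemma integrable_path:
  assumes "F \<in> bounded_path"
  shows "integrable Mf F" "integrable Mg F"
proof -
  note [measurable] = assms[THEN bounded_path_measurable]
  note [measurable_cong] = Mf(2) Mg(2)
  obtain C where C: "\<And>y. \<bar>F y\<bar> \<le> C" using assms by (meson bounded_pathE)
  interpret Mf: prob_space Mf by (rule Mf)
  interpret Mg: prob_space Mg by (rule Mg)
  show "integrable Mf F" by (rule Mf.integrable_const_bound[where B = C]) (use C in auto)
  show "integrable Mg F" by (rule Mg.integrable_const_bound[where B = C]) (use C in auto)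
qed

definition same_law :: "nat \<Rightarrow> bool" where
  "same_law k \<longleftrightarrow> (\<forall>F\<in>bounded_path. depends_on F {..k} \<longrightarrow>
    (LINT x|Mf. F (increments id x)) = (LINT y|Mg. F (increments \<pi> y)))"

lemma same_lawD:
  "same_law k \<Longrightarrow> F \<in> bounded_path \<Longrightarrow> depends_on F {..k} \<Longrightarrow>
    (LINT x|Mf. F (increments id x)) = (LINT y|Mg. F (increments \<pi> y))"
  unfolding same_law_def by blast

lemma same_law_mono: "same_law k \<Longrightarrow> k' \<le> k \<Longrightarrow> same_law k'"
  unfolding same_law_def by (meson depends_on_mono atMost_subset_iff)

definition condition_a :: bool where
  "condition_a \<longleftrightarrow> (\<forall>\<Gamma> :: nat \<Rightarrow> real set. (\<forall>i\<in>{0..n}. \<Gamma> i \<in> sets borel) \<longrightarrow>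
        (LINT x0|\<mu>. iterated Qf t 0 [1..<n + 1]
          (\<lambda>x. indicat_real (\<Gamma> 0) (x 0) * indicat_real (\<Gamma> 1) (x 1) *
               (\<Prod>i=2..n. indicat_real (\<Gamma> i) (x i - x (i - 1)))) (\<lambda>_. x0)) =
        (LINT y0|\<mu>. iterated Qg u 0 [1..<n + 1]
          (\<lambda>y. indicat_real (\<Gamma> 0) (y 0) * indicat_real (\<Gamma> 1) (y 1) *
               (\<Prod>i=2..n. indicat_real (\<Gamma> i) (y (\<pi> i) - y (\<pi> i - 1)))) (\<lambda>_. y0)))"

lemma condition_a_iff: "condition_a \<longleftrightarrow> same_law n"
proof -
  define I where "I \<Gamma> \<sigma> y = indicat_real (\<Gamma> 0) (y 0) * indicat_real (\<Gamma> 1) (y 1) *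
    (\<Prod>i=2..n. indicat_real (\<Gamma> i) (y (\<sigma> i) - y (\<sigma> i - 1)))"
    for \<Gamma> :: "nat \<Rightarrow> real set" and \<sigma> :: "nat \<Rightarrow> nat" and y :: "nat \<Rightarrow> real"
  have I: "I \<Gamma> \<sigma> y = (\<Prod>j\<le>n. indicat_real (\<Gamma> j) (increments \<sigma> y j))" for \<Gamma> \<sigma> y
    by (simp add: prod_increments[OF n_pos, where H = "\<lambda>j. indicat_real (\<Gamma> j)"] I_def incr_prod_def)
  have P: "(\<lambda>d. \<Prod>j\<le>n. indicat_real (\<Gamma> j) (d j)) \<in> bounded_path" if "\<And>j. \<Gamma> j \<in> sets borel" for \<Gamma>
    using that by (intro bounded_path_prod_coords bounded_measurable_indicat)
  have I_B: "I \<Gamma> \<sigma> \<in> bounded_path" if "\<And>j. \<Gamma> j \<in> sets borel" for \<Gamma> \<sigma>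
    using bounded_path_comp_path[OF P[OF that] increments_measurable] by (simp add: I[abs_def])
  have I_cong: "I \<Gamma> \<sigma> = I (\<lambda>j. if j \<le> n then \<Gamma> j else UNIV) \<sigma>" for \<Gamma> \<sigma>
    unfolding I by (intro ext prod.cong) auto
  have eq: "(LINT x|\<mu>. iterated Qf t 0 [1..<n + 1] (I \<Gamma> id) (\<lambda>_. x)) = (LINT x|Mf. I \<Gamma> id x)"
    "(LINT x|\<mu>. iterated Qg u 0 [1..<n + 1] (I \<Gamma> \<pi>) (\<lambda>_. x)) = (LINT y|Mg. I \<Gamma> \<pi> y)"
    if "\<And>j. j \<le> n \<Longrightarrow> \<Gamma> j \<in> sets borel" for \<Gamma>
    using that Mf(3)[OF I_B, of "\<lambda>j. if j \<le> n then \<Gamma> j else UNIV" id]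
      Mg(3)[OF I_B, of "\<lambda>j. if j \<le> n then \<Gamma> j else UNIV" \<pi>]
    by (simp_all add: I_cong[of \<Gamma>, symmetric])
  have cond: "condition_a \<longleftrightarrow> (\<forall>\<Gamma>. (\<forall>j\<in>{0..n}. \<Gamma> j \<in> sets borel) \<longrightarrow>
      (LINT x|\<mu>. iterated Qf t 0 [1..<n + 1] (I \<Gamma> id) (\<lambda>_. x)) =
      (LINT x|\<mu>. iterated Qg u 0 [1..<n + 1] (I \<Gamma> \<pi>) (\<lambda>_. x)))"
    unfolding condition_a_def I_def[abs_def] by simp
  also have "\<dots> \<longleftrightarrow> (\<forall>\<Gamma>. (\<forall>j\<in>{0..n}. \<Gamma> j \<in> sets borel) \<longrightarrow>
      (LINT x|Mf. I \<Gamma> id x) = (LINT y|Mg. I \<Gamma> \<pi> y))"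
    using eq by auto
  also have "\<dots> \<longleftrightarrow> same_law n"
  proof
    assume rect: "\<forall>\<Gamma>. (\<forall>j\<in>{0..n}. \<Gamma> j \<in> sets borel) \<longrightarrow> (LINT x|Mf. I \<Gamma> id x) = (LINT y|Mg. I \<Gamma> \<pi> y)"
    show "same_law n"
      unfolding same_law_def
    proof (intro ballI impI)
      fix F assume F: "F \<in> bounded_path" "depends_on F {..n}"
      show "(LINT x|Mf. F (increments id x)) = (LINT y|Mg. F (increments \<pi> y))"
      proof (rule same_law_from_rectangles[OF Mf(1) _ Mg(1) _ _ F])
        show "increments id \<in> Mf \<rightarrow>\<^sub>M paths" "increments \<pi> \<in> Mg \<rightarrow>\<^sub>M paths"
          by (simp_all add: measurable_cong_sets[OF Mf(2) refl] measurable_cong_sets[OF Mg(2) refl])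
      qed (use rect in \<open>simp add: I\<close>)
    qed
  next
    assume law: "same_law n"
    show "\<forall>\<Gamma>. (\<forall>j\<in>{0..n}. \<Gamma> j \<in> sets borel) \<longrightarrow> (LINT x|Mf. I \<Gamma> id x) = (LINT y|Mg. I \<Gamma> \<pi> y)"
    proof (intro allI impI)
      fix \<Gamma> :: "nat \<Rightarrow> real set" assume \<Gamma>: "\<forall>j\<in>{0..n}. \<Gamma> j \<in> sets borel"
      let ?\<Gamma> = "\<lambda>j. if j \<le> n then \<Gamma> j else UNIV"
      have "?\<Gamma> j \<in> sets borel" for j using \<Gamma> by simp
      from same_lawD[OF law P[of ?\<Gamma>, OF this] depends_on_prod_coords]
      show "(LINT x|Mf. I \<Gamma> id x) = (LINT y|Mg. I \<Gamma> \<pi> y)"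
        unfolding I_cong[of \<Gamma>] unfolding I .
    qed
  qed
  finally show ?thesis .
qed

lemma same_law_1: "same_law 1"
  unfolding same_law_def
proof (intro ballI impI)
  fix F assume F: "F \<in> bounded_path" "depends_on F {..1::nat}"
  have eq: "F (increments \<sigma> y) = F y" for \<sigma> y
    by (rule depends_onD[OF F(2)]) (auto simp: increments_def)
  have ord: "sorted (0 # [1::nat])" "m \<in> set [1] \<Longrightarrow> m \<le> n" "depends_on F ({..0} \<union> set [1])" for m
    using n_pos F(2) by (auto elim: depends_on_mono)
  have "iterated Qf t 0 [1..<n + 1] F y = iterated Qg u 0 [1..<n + 1] F y" for y
    using f_chain.iterated_eq_full[OF ord(1,2) _ F(1) ord(3), of y]
      g_chain.iterated_eq_full[OF ord(1,2) _ F(1) ord(3), of y] start t_0 u_0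
    by (simp del: upt_Suc)
  then show "(LINT x|Mf. F (increments id x)) = (LINT y|Mg. F (increments \<pi> y))"
    unfolding eq using Mf(3)[OF F(1)] Mg(3)[OF F(1)] by simp
qed

text \<open>By the Markov property the left side equals a function of the first \<open>i - 1\<close> increments of the
  first chain, to which the equality of laws up to \<open>i - 1\<close> applies.\<close>

lemma law_before:
  assumes i: "i \<in> {2..n}" and H: "\<And>j. H j \<in> bounded_measurable" and law: "same_law (i - 1)"
  shows "(LINT x|Mf. (\<Prod>j\<le>i - 1. H j (increments id x j)) * H i (x i))
    = (LINT y|Mg. H 0 (y 0) * H 1 (y 1) * predicted i H y)"
proof -
  let ?T = "semigroup_op Qf (t (i - 1)) (t i) (H i)"
  let ?\<psi> = "\<lambda>d. \<Prod>j\<le>i - 1. H j (d j)"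
  let ?\<Phi> = "\<lambda>d. ?\<psi> d * ?T (\<Sum>j=1..i - 1. d j)"
  have i1: "1 \<le> i - 1" using i by auto
  have T_B: "?T \<in> bounded_measurable"
    using i t_mono[of "i - 1" i] t_mono[of 0 "i - 1"] t_mono[of i n] t_0 H
    by (intro f.semigroup_bounded_measurable) auto
  have \<psi>: "?\<psi> \<in> bounded_path" "depends_on ?\<psi> {..i - 1}"
    using H by (auto intro: bounded_path_prod_coords depends_on_prod_coords)
  have \<Phi>: "?\<Phi> \<in> bounded_path" "depends_on ?\<Phi> {..i - 1}"
  proof -
    show "?\<Phi> \<in> bounded_path"
      by (intro bounded_path_mult \<psi> bounded_path_comp T_B) measurable
    show "depends_on ?\<Phi> {..i - 1}"
      by (rule depends_on_mult_comp[OF \<psi>(2)]) (auto simp: depends_on_def intro!: sum.cong)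
  qed
  have "(LINT x|Mf. ?\<psi> (increments id x) * H i (x i)) = (LINT x|Mf. ?\<psi> (increments id x) * ?T (x (i - 1)))"
  proof (rule f_chain.path_measure_markov[OF prob_initial sets_initial])
    show "(\<lambda>x. ?\<psi> (increments id x)) \<in> bounded_path"
      by (rule bounded_path_comp_path[OF \<psi>(1) increments_measurable])
    show "depends_on (\<lambda>x. ?\<psi> (increments id x)) {..i - 1}"
      by (rule depends_on_increments_id[OF \<psi>(2)])
    show "1 \<le> i" "i \<le> n" using i by simp_all
  qed (rule H T_B)+
  also have "\<dots> = (LINT x|Mf. ?\<Phi> (increments id x))"
    using sum_increments_id[OF i1] by simp
  also have "\<dots> = (LINT y|Mg. ?\<Phi> (increments \<pi> y))" by (rule same_lawD[OF law \<Phi>])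
  also have "\<dots> = (LINT y|Mg. H 0 (y 0) * H 1 (y 1) * predicted i H y)"
    unfolding prod_increments[OF i1] predicted_def incr_sum_increments[OF i1] by (simp add: mult.assoc)
  finally show ?thesis .
qed

text \<open>The same expectation, moved directly to the second chain when the laws agree up to \<open>i\<close>. Together with
  \<open>law_before\<close> this gives (*) in integrated form.\<close>

lemma law_after:
  assumes i: "i \<in> {2..n}" and H: "\<And>j. H j \<in> bounded_measurable" and law: "same_law i"
  shows "(LINT x|Mf. (\<Prod>j\<le>i - 1. H j (increments id x j)) * H i (x i))
    = (LINT y|Mg. H 0 (y 0) * H 1 (y 1) * integrand_b1 \<pi> H i y)"
proof -
  let ?\<psi> = "\<lambda>d. \<Prod>j\<le>i - 1. H j (d j)"
  let ?\<Phi> = "\<lambda>d. ?\<psi> d * H i (\<Sum>j=1..i. d j)"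
  have i1: "1 \<le> i - 1" "1 \<le> i" using i by auto
  have \<psi>: "?\<psi> \<in> bounded_path" "depends_on ?\<psi> {..i}"
    using H by (auto intro: bounded_path_prod_coords depends_on_mono[OF depends_on_prod_coords])
  have \<Phi>: "?\<Phi> \<in> bounded_path" "depends_on ?\<Phi> {..i}"
  proof -
    show "?\<Phi> \<in> bounded_path"
      by (intro bounded_path_mult \<psi> bounded_path_comp H) measurable
    show "depends_on ?\<Phi> {..i}"
      by (rule depends_on_mult_comp[OF \<psi>(2)]) (auto simp: depends_on_def intro!: sum.cong)
  qed
  have "(LINT x|Mf. ?\<psi> (increments id x) * H i (x i)) = (LINT x|Mf. ?\<Phi> (increments id x))"
    using sum_increments_id[OF i1(2)] by simp
  also have "\<dots> = (LINT y|Mg. ?\<Phi> (increments \<pi> y))" by (rule same_lawD[OF law \<Phi>])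
  also have "\<dots> = (LINT y|Mg. H 0 (y 0) * H 1 (y 1) * integrand_b1 \<pi> H i y)"
    unfolding prod_increments[OF i1(1)] integrand_b1_def incr_sum_increments[OF i1(2)]
    by (simp add: mult.assoc)
  finally show ?thesis .
qed

text \<open>Conditioning on the states at the times \<open>0\<close> and \<open>u 1\<close>.\<close>

lemma integral_split_start:
  assumes X: "X \<in> bounded_path" "depends_on X {1..n}"
    and w: "w0 \<in> bounded_measurable" "w1 \<in> bounded_measurable"
  shows "(LINT y|Mg. w0 (y 0) * w1 (y 1) * X y)
    = (LINT x0|\<mu>. w0 x0 * (LINT x1|Qg 0 (u 1) x0. w1 x1 * future_mean X (\<lambda>_. x1)))"
proof -
  have B: "(\<lambda>y. w0 (y 0) * w1 (y 1) * X y) \<in> bounded_path"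
    by (intro bounded_path_mult bounded_path_comp w X) measurable
  have "iterated Qg u 0 [1..<n + 1] (\<lambda>y. w0 (y 0) * w1 (y 1) * X y) (\<lambda>_. x0)
      = w0 x0 * (LINT x1|Qg 0 (u 1) x0. w1 x1 * future_mean X (\<lambda>_. x1))" for x0
  proof -
    have inner: "iterated Qg u 1 [1 + 1..<n + 1] (\<lambda>y. w0 (y 0) * w1 (y 1) * X y) ((\<lambda>_. x0)(1 := z))
        = w0 x0 * (w1 z * future_mean X (\<lambda>_. z))" for z
    proof -
      have "iterated Qg u 1 [1 + 1..<n + 1] (\<lambda>y. w0 (y 0) * w1 (y 1) * X y) ((\<lambda>_. x0)(1 := z))
          = iterated Qg u 1 [1 + 1..<n + 1] (\<lambda>y. w0 x0 * w1 z * X y) ((\<lambda>_. x0)(1 := z))"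
        by (rule iterated_cong_unwritten) (auto simp del: upt_Suc)
      also have "\<dots> = w0 x0 * w1 z * iterated Qg u 1 [1 + 1..<n + 1] X ((\<lambda>_. x0)(1 := z))"
        by (rule iterated_mult_const)
      also have "iterated Qg u 1 [1 + 1..<n + 1] X ((\<lambda>_. x0)(1 := z)) = future_mean X (\<lambda>_. z)"
        unfolding future_mean_def by (rule iterated_cong_start[OF X(2)]) (auto simp del: upt_Suc)
      finally show ?thesis by (simp only: mult.assoc)
    qed
    have "[1..<n + 1] = 1 # [1 + 1..<n + 1]" using n_pos by (simp add: upt_conv_Cons del: upt_Suc)
    then have "iterated Qg u 0 [1..<n + 1] (\<lambda>y. w0 (y 0) * w1 (y 1) * X y) (\<lambda>_. x0)
        = (LINT z|Qg (u 0) (u 1) x0. w0 x0 * (w1 z * future_mean X (\<lambda>_. z)))"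
      by (simp only: iterated.simps inner)
    then show ?thesis by (simp add: u_0)
  qed
  then show ?thesis using Mg(3)[OF B] by simp
qed

text \<open>Exceptional null sets of \<open>x1\<close> are traded for test functions \<open>w1\<close> of the state at time \<open>u 1\<close>. The test
  function \<open>w0\<close> comes for free, as the future does not depend on the initial state when the state
  at time \<open>u 1\<close> is given.\<close>

lemma AE_future_mean_eq_0_iff:
  assumes X: "X \<in> bounded_path" "depends_on X {1..n}"
  shows "(AE x1 in \<mu> \<bind> Qf 0 (t 1). future_mean X (\<lambda>_. x1) = 0) \<longleftrightarrow>
    (\<forall>w0\<in>bounded_measurable. \<forall>w1\<in>bounded_measurable. (LINT y|Mg. w0 (y 0) * w1 (y 1) * X y) = 0)"
proof -
  define e where "e x1 = future_mean X (\<lambda>_. x1)" for x1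
  interpret \<mu>: prob_space \<mu> by (rule prob_initial)
  note [measurable_cong] = sets_initial
  have K: "Qg 0 (u 1) \<in> borel \<rightarrow>\<^sub>M prob_algebra borel"
    using g_chain.chain_kernel[of 0 1] n_pos u_0 by simp
  have K_prob: "prob_space (Qg 0 (u 1) x)" and K_sets [measurable_cong]: "sets (Qg 0 (u 1) x) = sets borel" for x
    using g_chain.chain_prob[of 0 1 x] g_chain.chain_sets[of 0 1 x] n_pos u_0 by auto
  have K' [measurable]: "Qg 0 (u 1) \<in> \<mu> \<rightarrow>\<^sub>M subprob_algebra borel"
    using measurable_prob_algebraD[OF K] by (simp add: measurable_cong_sets[OF sets_initial refl])
  have mean_B: "future_mean X \<in> bounded_path"
    unfolding future_mean_def[abs_def] by (rule g_chain.iterated_bounded) (use X in \<open>auto simp del: upt_Suc\<close>)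
  have e_B: "e \<in> bounded_measurable"
  proof -
    obtain C where "\<And>y. \<bar>future_mean X y\<bar> \<le> C" using mean_B by (meson bounded_pathE)
    moreover have "e \<in> borel_measurable borel"
      unfolding e_def[abs_def] by (rule measurable_compose[OF measurable_const_path bounded_path_measurable[OF mean_B]])
    ultimately show ?thesis by (intro bounded_measurableI) (auto simp: e_def)
  qed
  note [measurable] = e_B[THEN bounded_measurable_measurable]
  note split = integral_split_start[OF X, folded e_def]
  have \<nu>: "prob_space (\<mu> \<bind> Qg 0 (u 1))" "sets (\<mu> \<bind> Qg 0 (u 1)) = sets borel"
    by (rule \<mu>.prob_space_bind[OF AE_I2[OF K_prob] K']) (rule sets_bind[OF K_sets \<mu>.not_empty])
  show ?thesis
    unfolding start e_def[symmetric]
  proof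
    assume "AE x1 in \<mu> \<bind> Qg 0 (u 1). e x1 = 0"
    then have AE0: "AE x0 in \<mu>. AE x1 in Qg 0 (u 1) x0. e x1 = 0"
      by (subst (asm) AE_bind[OF K']) auto
    show "\<forall>w0\<in>bounded_measurable. \<forall>w1\<in>bounded_measurable. (LINT y|Mg. w0 (y 0) * w1 (y 1) * X y) = 0"
    proof (intro ballI)
      fix w0 w1 assume w: "w0 \<in> bounded_measurable" "w1 \<in> bounded_measurable"
      have "AE x0 in \<mu>. w0 x0 * (LINT x1|Qg 0 (u 1) x0. w1 x1 * e x1) = 0"
        using AE0
      proof eventually_elim
        case (elim x0)
        then have "AE x1 in Qg 0 (u 1) x0. w1 x1 * e x1 = 0" by eventually_elim simp
        then have "(LINT x1|Qg 0 (u 1) x0. w1 x1 * e x1) = 0" by (rule integral_eq_zero_AE)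
        then show ?case by simp
      qed
      then show "(LINT y|Mg. w0 (y 0) * w1 (y 1) * X y) = 0"
        unfolding split[OF w] by (rule integral_eq_zero_AE)
    qed
  next
    assume zero: "\<forall>w0\<in>bounded_measurable. \<forall>w1\<in>bounded_measurable. (LINT y|Mg. w0 (y 0) * w1 (y 1) * X y) = 0"
    show "AE x1 in \<mu> \<bind> Qg 0 (u 1). e x1 = 0"
    proof (rule AE_eq_from_indicators[OF \<nu> e_B])
      fix \<Gamma> :: "real set" assume \<Gamma> [measurable]: "\<Gamma> \<in> sets borel"
      have one: "(\<lambda>_. 1) \<in> bounded_measurable" by (rule bounded_measurableI[where C = 1]) auto
      note i\<Gamma> = bounded_measurable_indicat[OF \<Gamma>]
      obtain C where C: "\<And>x. \<bar>e x\<bar> \<le> C" using e_B by (meson bounded_measurableE)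
      have "\<bar>indicat_real \<Gamma> x * e x\<bar> \<le> C" for x
        using C[of x] order_trans[OF abs_ge_zero C[of x]] by (auto simp: indicator_def)
      then have "(LINT x|(\<mu> \<bind> Qg 0 (u 1)). indicat_real \<Gamma> x * e x)
          = (LINT x0|\<mu>. LINT x1|Qg 0 (u 1) x0. indicat_real \<Gamma> x1 * e x1)"
        using K_prob[THEN prob_space.emeasure_space_1] \<mu>.emeasure_space_1 \<mu>.finite_measure_axioms K'
        by (intro integral_bind[where K = borel and B' = 1 and B = C]) auto
      also have "\<dots> = (LINT y|Mg. 1 * indicat_real \<Gamma> (y 1) * X y)"
        using split[OF one i\<Gamma>] by simp
      also have "\<dots> = 0"
        using bspec[OF bspec[OF zero one] i\<Gamma>] .
      finally show "(LINT x|(\<mu> \<bind> Qg 0 (u 1)). indicat_real \<Gamma> x * e x) = 0" .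
    qed
  qed
qed

lemma depends_on_predicted:
  assumes i: "i \<in> {2..n}"
  shows "depends_on (predicted i h) {1..n}" "depends_on (integrand_b1 \<pi> h i) {1..n}"
proof -
  have range: "(\<Union>j\<in>{2..k}. {\<pi> j - 1, \<pi> j}) \<subseteq> {1..n}" if "k \<le> i" for k
    using perm_range i that by fastforce
  have prod: "depends_on (incr_prod \<pi> h (i - 1)) {1..n}"
    by (rule depends_on_mono[OF depends_on_incr_prod range]) simp
  have sum: "depends_on (incr_sum \<pi> k) {1..n}" if "k \<le> i" for k
    using range[OF that] n_pos by (intro depends_on_mono[OF depends_on_incr_sum]) auto
  show "depends_on (predicted i h) {1..n}" "depends_on (integrand_b1 \<pi> h i) {1..n}"
    unfolding predicted_def[abs_def] integrand_b1_def[abs_def]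
    by (rule depends_on_mult_comp[OF prod sum], simp)+
qed

lemma AE_condition_b_iff:
  assumes i: "i \<in> {2..n}" and h: "\<forall>j\<in>{2..i}. h j \<in> D"
  shows "(AE x1 in \<mu> \<bind> Qf 0 (t 1). condition_b i h x1) \<longleftrightarrow>
    (\<forall>w0\<in>bounded_measurable. \<forall>w1\<in>bounded_measurable.
      (LINT y|Mg. w0 (y 0) * w1 (y 1) * predicted i h y)
        = (LINT y|Mg. w0 (y 0) * w1 (y 1) * integrand_b1 \<pi> h i y))"
proof -
  have hB: "h j \<in> bounded_measurable" if "j \<in> {2..i}" for j
    using h that f.D_bounded_measurable by blast
  note B = predicted_bounded_path(1,2)[OF i hB]
  have X: "(\<lambda>y. predicted i h y - integrand_b1 \<pi> h i y) \<in> bounded_path"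
    by (rule bounded_path_diff[OF B])
  have dep: "depends_on (\<lambda>y. predicted i h y - integrand_b1 \<pi> h i y) {1..n}"
    using depends_on_predicted[OF i, of h] unfolding depends_on_def by metis
  have "future_mean (\<lambda>y. predicted i h y - integrand_b1 \<pi> h i y) y = future_mean (predicted i h) y - future_mean (integrand_b1 \<pi> h i) y" for y
    unfolding future_mean_def by (rule g_chain.iterated_diff[OF _ _ B]) (auto simp del: upt_Suc)
  then have "(AE x1 in \<mu> \<bind> Qf 0 (t 1). condition_b i h x1) \<longleftrightarrow>
      (AE x1 in \<mu> \<bind> Qf 0 (t 1). future_mean (\<lambda>y. predicted i h y - integrand_b1 \<pi> h i y) (\<lambda>_. x1) = 0)"
    unfolding condition_b_iff[OF i h] by simp
  also have "\<dots> \<longleftrightarrow> (\<forall>w0\<in>bounded_measurable. \<forall>w1\<in>bounded_measurable.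
      (LINT y|Mg. w0 (y 0) * w1 (y 1) * (predicted i h y - integrand_b1 \<pi> h i y)) = 0)"
    by (rule AE_future_mean_eq_0_iff[OF X dep])
  also have "\<dots> \<longleftrightarrow> (\<forall>w0\<in>bounded_measurable. \<forall>w1\<in>bounded_measurable.
      (LINT y|Mg. w0 (y 0) * w1 (y 1) * predicted i h y)
        = (LINT y|Mg. w0 (y 0) * w1 (y 1) * integrand_b1 \<pi> h i y))"
  proof (intro ball_cong refl)
    fix w0 w1 assume w: "w0 \<in> bounded_measurable" "w1 \<in> bounded_measurable"
    have int: "integrable Mg (\<lambda>y. w0 (y 0) * w1 (y 1) * Z y)" if "Z \<in> bounded_path" for Z
      by (intro integrable_path bounded_path_mult bounded_path_comp w that) measurable
    have "(LINT y|Mg. w0 (y 0) * w1 (y 1) * (predicted i h y - integrand_b1 \<pi> h i y))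
      = (LINT y|Mg. w0 (y 0) * w1 (y 1) * predicted i h y)
        - (LINT y|Mg. w0 (y 0) * w1 (y 1) * integrand_b1 \<pi> h i y)"
      unfolding right_diff_distrib by (rule Bochner_Integration.integral_diff[OF int[OF B(1)] int[OF B(2)]])
    then show "(LINT y|Mg. w0 (y 0) * w1 (y 1) * (predicted i h y - integrand_b1 \<pi> h i y)) = 0 \<longleftrightarrow>
      (LINT y|Mg. w0 (y 0) * w1 (y 1) * predicted i h y)
        = (LINT y|Mg. w0 (y 0) * w1 (y 1) * integrand_b1 \<pi> h i y)" by simp
  qed
  finally show ?thesis .
qed

lemma same_law_imp_condition_b:
  assumes law: "same_law n" and i: "i \<in> {2..n}" and h: "\<forall>j\<in>{2..i}. h j \<in> D"
  shows "AE x1 in \<mu> \<bind> Qf 0 (t 1). condition_b i h x1"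
  unfolding AE_condition_b_iff[OF i h]
proof (intro ballI)
  fix w0 w1 assume w: "w0 \<in> bounded_measurable" "w1 \<in> bounded_measurable"
  define H where "H j = (if j = 0 then w0 else if j = 1 then w1 else if j \<in> {2..i} then h j else (\<lambda>_. 0))" for j
  have H: "H j \<in> bounded_measurable" for j
    using w h f.D_bounded_measurable by (auto simp: H_def intro: bounded_measurableI[where C = 0])
  have "incr_prod \<pi> H (i - 1) y = incr_prod \<pi> h (i - 1) y" for y
    unfolding incr_prod_def by (rule prod.cong) (auto simp: H_def)
  moreover have "H i = h i" using i by (auto simp: H_def)
  ultimately have eq: "predicted i H = predicted i h" "integrand_b1 \<pi> H i = integrand_b1 \<pi> h i"
    by (auto simp: predicted_def integrand_b1_def)
  have w_eq: "H 0 = w0" "H 1 = w1" by (simp_all add: H_def)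
  have "same_law (i - 1)" "same_law i" using i by (auto intro: same_law_mono[OF law])
  from law_before[where H = H, OF i H this(1)] law_after[where H = H, OF i H this(2)]
  show "(LINT y|Mg. w0 (y 0) * w1 (y 1) * predicted i h y)
      = (LINT y|Mg. w0 (y 0) * w1 (y 1) * integrand_b1 \<pi> h i y)"
    unfolding eq w_eq by simp
qed

text \<open>Induction on the number of increments. In the step, the last increment is replaced by the current
  state, \<open>x i\<close> for the first chain and \<open>incr_sum \<pi> i y\<close> for the second: for these vectors the required equality of
  expectations is exactly (*). The last increment is recovered by subtracting the previous ones.\<close>

lemma condition_b_imp_same_law:
  assumes b: "\<And>i h. i \<in> {2..n} \<Longrightarrow> \<forall>j\<in>{2..i}. h j \<in> D \<Longrightarrow> AE x1 in \<mu> \<bind> Qf 0 (t 1). condition_b i h x1"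
  shows "same_law n"
proof -
  have "same_law k" if "1 \<le> k" "k \<le> n" for k
    using that
  proof (induction k rule: dec_induct)
    case base
    show ?case by (rule same_law_1)
  next
    case (step k)
    define i where "i = Suc k"
    have i: "i \<in> {2..n}" "i - 1 = k" "1 \<le> k" "1 \<le> i" using step by (auto simp: i_def)
    have law: "same_law (i - 1)" using step i by simp
    define Xf where "Xf x = (increments id x)(i := x i)" for x
    define Xg where "Xg y = (increments \<pi> y)(i := incr_sum \<pi> i y)" for y
    have "Xf \<in> paths \<rightarrow>\<^sub>M paths" "Xg \<in> paths \<rightarrow>\<^sub>M paths"
      unfolding Xf_def[abs_def] Xg_def[abs_def]
      by (intro measurable_path_upd increments_measurable incr_sum_measurable; measurable)+
    then have X: "Xf \<in> Mf \<rightarrow>\<^sub>M paths" "Xg \<in> Mg \<rightarrow>\<^sub>M paths"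
      by (simp_all add: measurable_cong_sets[OF Mf(2) refl] measurable_cong_sets[OF Mg(2) refl])
    have split: "(\<Prod>j\<le>i. H j ((d(i := c)) j)) = (\<Prod>j\<le>i - 1. H j (d j)) * H i c"
      for H :: "nat \<Rightarrow> real \<Rightarrow> real" and d c
    proof -
      have "{..i} = insert i {..i - 1}" "i \<notin> {..i - 1}" using i by auto
      then have "(\<Prod>j\<le>i. H j ((d(i := c)) j)) = H i c * (\<Prod>j\<le>i - 1. H j ((d(i := c)) j))" by simp
      also have "(\<Prod>j\<le>i - 1. H j ((d(i := c)) j)) = (\<Prod>j\<le>i - 1. H j (d j))"
        using i by (intro prod.cong) auto
      finally show ?thesis by simp
    qed
    have dense_case: "(LINT x|Mf. (\<Prod>j\<le>i. H j (Xf x j))) = (LINT y|Mg. (\<Prod>j\<le>i. H j (Xg y j)))"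
      if H: "\<And>j. H j \<in> bounded_measurable" "\<And>j. j \<in> {2..i} \<Longrightarrow> H j \<in> D" for H
    proof -
      have "(LINT x|Mf. (\<Prod>j\<le>i. H j (Xf x j))) = (LINT y|Mg. H 0 (y 0) * H 1 (y 1) * predicted i H y)"
        unfolding Xf_def split by (rule law_before[OF i(1) H(1) law])
      also have "\<dots> = (LINT y|Mg. H 0 (y 0) * H 1 (y 1) * integrand_b1 \<pi> H i y)"
        using b[OF i(1), of H] AE_condition_b_iff[OF i(1), of H] H by blast
      also have "\<dots> = (LINT y|Mg. (\<Prod>j\<le>i. H j (Xg y j)))"
        unfolding Xg_def split i(2) prod_increments[OF i(3)] integrand_b1_def by (simp add: mult.assoc)
      finally show ?thesis .
    qed
    have law_X: "(LINT x|Mf. F (Xf x)) = (LINT y|Mg. F (Xg y))"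
      if F: "F \<in> bounded_path" "depends_on F {..i}" for F
    proof (rule same_law_from_rectangles[OF Mf(1) X(1) Mg(1) X(2) _ F])
      fix \<Gamma> :: "nat \<Rightarrow> real set" assume \<Gamma>: "\<And>j. \<Gamma> j \<in> sets borel"
      show "(LINT x|Mf. (\<Prod>j\<le>i. indicat_real (\<Gamma> j) (Xf x j)))
          = (LINT y|Mg. (\<Prod>j\<le>i. indicat_real (\<Gamma> j) (Xg y j)))"
      proof (rule product_expectation_from_dense[OF f.dense Mf(1) X(1) Mg(1) X(2)])
        show "finite {2..i}" "{2..i} \<subseteq> {..i}" by auto
        show "indicat_real (\<Gamma> j) \<in> bounded_measurable" for j
          by (rule bounded_measurable_indicat[OF \<Gamma>])
      qed (rule dense_case)
    qed
    have "same_law i"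
      unfolding same_law_def
    proof (intro ballI impI)
      fix F assume F: "F \<in> bounded_path" "depends_on F {..i}"
      define restore_last where "restore_last z = z(i := z i - (\<Sum>j=1..i - 1. z j))" for z :: "nat \<Rightarrow> real"
      have "restore_last \<in> paths \<rightarrow>\<^sub>M paths"
        unfolding restore_last_def[abs_def] by (intro measurable_path_upd) measurable
      then have B: "(\<lambda>z. F (restore_last z)) \<in> bounded_path" by (rule bounded_path_comp_path[OF F(1)])
      have "depends_on (\<lambda>z. F (restore_last z)) {..i}"
        unfolding depends_on_def
      proof (intro allI impI)
        fix y y' :: "nat \<Rightarrow> real" assume eq: "\<forall>j\<in>{..i}. y j = y' j"
        then have "(\<Sum>j=1..i - 1. y j) = (\<Sum>j=1..i - 1. y' j)" by (intro sum.cong) auto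
        then show "F (restore_last y) = F (restore_last y')"
          using eq by (intro depends_onD[OF F(2)]) (auto simp: restore_last_def)
      qed
      note law_X[OF B this]
      moreover have restore_last: "restore_last ((increments \<sigma> y)(i := \<Sum>j=1..i. increments \<sigma> y j)) = increments \<sigma> y" for \<sigma> y
      proof -
        have "{1..i} = insert i {1..i - 1}" "i \<notin> {1..i - 1}" using i by auto
        then have "(\<Sum>j=1..i. increments \<sigma> y j) = increments \<sigma> y i + (\<Sum>j=1..i - 1. increments \<sigma> y j)"
          by simp
        moreover have "(\<Sum>j=1..i - 1. ((increments \<sigma> y)(i := c)) j) = (\<Sum>j=1..i - 1. increments \<sigma> y j)" for c
          using i by (intro sum.cong) auto
        ultimately show ?thesis by (simp add: restore_last_def fun_eq_iff)
      qed
      moreover have "restore_last (Xf x) = increments id x" for x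
        using restore_last[of id x] unfolding Xf_def sum_increments_id[OF i(4)] .
      moreover have "restore_last (Xg y) = increments \<pi> y" for y
        unfolding Xg_def incr_sum_increments[OF i(4)] by (rule restore_last)
      ultimately show "(LINT x|Mf. F (increments id x)) = (LINT y|Mg. F (increments \<pi> y))" by simp
    qed
    then show ?case by (simp add: i_def)
  qed
  then show ?thesis using n_pos by blast
qed

lemma condition_a_iff_condition_b:
  "condition_a \<longleftrightarrow>
    (\<forall>i\<in>{2..n}. \<forall>h. (\<forall>j\<in>{2..i}. h j \<in> D) \<longrightarrow> (AE x1 in \<mu> \<bind> Qf 0 (t 1). condition_b i h x1))"
  unfolding condition_a_iff using same_law_imp_condition_b condition_b_imp_same_law by blast

end

theorem lemma6:
  fixes \<A> \<A>' :: "'s::t2_space set set"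
    and \<mu> :: "real measure"
    and n :: nat
    and A A' :: "nat \<Rightarrow> 's set"
    and \<pi> :: "nat \<Rightarrow> nat"
    and f g :: "real \<Rightarrow> 's set"
    and t u :: "nat \<Rightarrow> real"
    and Qf Qg :: "real \<Rightarrow> real \<Rightarrow> real \<Rightarrow> real measure"
    and D :: "(real \<Rightarrow> real) set"
    and Gf Gg :: "real \<Rightarrow> (real \<Rightarrow> real) \<Rightarrow> real \<Rightarrow> real"
  assumes "indexing_collection \<A>"
    and "prob_space \<mu>" and "sets \<mu> = sets borel"
    and "finite_sub_semilattice \<A> \<A>'"
    and "consistent_ordering \<A> \<A>' n A"
    and "consistent_ordering \<A> \<A>' n A'"
    and "\<pi> permutes {1..n}" and "\<pi> 1 = 1"
    and "\<forall>i\<in>{1..n}. A i = A' (\<pi> i)"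
    and "connects \<A> n A t f"
    and "connects \<A> n A' u g"
    and "\<forall>i\<in>{1..n}. f (t i) = (\<Union>j\<in>{1..i}. A j)"
    and "\<forall>i\<in>{1..n}. g (u i) = (\<Union>j\<in>{1..i}. A' j)"
    and "transition_system (t n) Qf"
    and "transition_system (u n) Qg"
    and "dense_subspace D"
    and "has_generator (t n) Qf D Gf"
    and "has_generator (u n) Qg D Gg"
    and "Qf 0 (t 1) = Qg 0 (u 1)"
    and "\<And>i h v y. i \<in> {2..n} \<Longrightarrow> (\<forall>j\<in>{2..i}. h j \<in> D) \<Longrightarrow> v \<in> {u (\<pi> i - 1)..u (\<pi> i)} \<Longrightarrow>
      generator_arg Qg u v (\<pi> i) (idx_seg \<pi> i (pos \<pi> i + 1) (2 * (i - 1)))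
        (if pos \<pi> i = 2 * (i - 1) then integrand_b1 \<pi> h i else integrand_b2 \<pi> h i) y \<in> D"
  shows
    "(\<forall>\<Gamma> :: nat \<Rightarrow> real set. (\<forall>i\<in>{0..n}. \<Gamma> i \<in> sets borel) \<longrightarrow>
        (LINT x0|\<mu>. iterated Qf t 0 [1..<n + 1]
          (\<lambda>x. indicat_real (\<Gamma> 0) (x 0) * indicat_real (\<Gamma> 1) (x 1) *
               (\<Prod>i=2..n. indicat_real (\<Gamma> i) (x i - x (i - 1)))) (\<lambda>_. x0)) =
        (LINT y0|\<mu>. iterated Qg u 0 [1..<n + 1]
          (\<lambda>y. indicat_real (\<Gamma> 0) (y 0) * indicat_real (\<Gamma> 1) (y 1) *
               (\<Prod>i=2..n. indicat_real (\<Gamma> i) (y (\<pi> i) - y (\<pi> i - 1)))) (\<lambda>_. y0)))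
     \<longleftrightarrow>
     (\<forall>i\<in>{2..n}. \<forall>h. (\<forall>j\<in>{2..i}. h j \<in> D) \<longrightarrow>
        (AE x1 in \<mu> \<bind> Qf 0 (t 1).
          let p = pos \<pi> i; l = (!) (idx \<pi> i) in
          (p = 2 * (i - 1) \<longrightarrow>
            (LINT w:{t (i - 1)..t i}|lborel.
               iterated Qg u 1 (idx_seg \<pi> i 1 (p - 2))
                 (\<lambda>y. incr_prod \<pi> h (i - 1) y *
                      Gf w (semigroup_op Qf w (t i) (h i)) (incr_sum \<pi> (i - 1) y)) (\<lambda>_. x1)) =
            (LINT v:{u (l (p - 1))..u (l p)}|lborel.
               iterated_generator Qg Gg u 1 (idx_seg \<pi> i 1 (p - 1)) v (l p) []
                 (integrand_b1 \<pi> h i) (\<lambda>_. x1))) \<and>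
          (p < 2 * (i - 1) \<longrightarrow>
            (LINT w:{t (i - 1)..t i}|lborel.
               iterated Qg u 1 (idx_seg \<pi> i 1 (p - 2) @ idx_seg \<pi> i (p + 1) (2 * (i - 1)))
                 (\<lambda>y. incr_prod \<pi> h (i - 1) y *
                      Gf w (semigroup_op Qf w (t i) (h i)) (incr_sum \<pi> (i - 1) y)) (\<lambda>_. x1)) =
            (LINT v:{u (l (p - 1))..u (l p)}|lborel.
               iterated_generator Qg Gg u 1 (idx_seg \<pi> i 1 (p - 1)) v (l p)
                 (idx_seg \<pi> i (p + 1) (2 * (i - 1)))
                 (integrand_b2 \<pi> h i) (\<lambda>_. x1)))))"
proof -
  have n: "1 \<le> n"
  proof (rule ccontr)
    assume "\<not> 1 \<le> n"
    then have "{1..n} = {}" by simp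
    moreover have "A ` {1..n} = \<A>'"
      using assms(5) unfolding consistent_ordering_def bij_betw_def by (elim conjE)
    moreover have "\<A>' \<noteq> {}" using assms(4) unfolding finite_sub_semilattice_def by blast
    ultimately show False by simp
  qed
  obtain F where F: "flow_decomposition \<A> f n t F"
    using assms(10) unfolding connects_def by blast
  obtain F' where F': "flow_decomposition \<A> g n u F'"
    using assms(11) unfolding connects_def by blast
  interpret flow_comparison n t u Qf Qg D Gf Gg \<pi> \<mu>
  proof (intro flow_comparison.intro transition_semigroup.intro flow_comparison_axioms.intro)
    show "t 0 = 0" "u 0 = 0"
      using F F' unfolding flow_decomposition_def by blast+
    show "t i < t (i + 1)" if "i < n" for i
      using F that unfolding flow_decomposition_def by blast
    show u_step: "u i < u (i + 1)" if "i < n" for i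
      using F' that unfolding flow_decomposition_def by blast
    have step: "u (k - 1) < u k" if "1 \<le> k" "k \<le> n" for k
    proof -
      have "k - 1 < n" "k - 1 + 1 = k" using that by auto
      with u_step[of "k - 1"] show ?thesis by simp
    qed
    fix i :: nat and h :: "nat \<Rightarrow> real \<Rightarrow> real" and y :: "nat \<Rightarrow> real"
    assume i: "i \<in> {2..n}" and h: "\<forall>j\<in>{2..i}. h j \<in> D"
    have "\<pi> i \<in> {1..n}" using permutes_in_image[OF assms(7), of i] i by simp
    then have "u (\<pi> i) \<in> {u (\<pi> i - 1)..u (\<pi> i)}" using step[of "\<pi> i"] by simp
    from assms(20)[OF i h this]
    show "generator_arg Qg u (u (\<pi> i)) (\<pi> i) (idx_seg \<pi> i (pos \<pi> i + 1) (2 * (i - 1)))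
        (if pos \<pi> i = 2 * (i - 1) then integrand_b1 \<pi> h i else integrand_b2 \<pi> h i) y \<in> D" .
  qed (fact n assms)+
  show ?thesis
    using condition_a_iff_condition_b unfolding condition_a_def condition_b_def .
qed

end
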